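(* Let $M$ be a Riemannian surface with constant Gaussian curvature, isometric to one of the model surfaces $\mathbb R^2$, $\mathbb S_r$ ($r>0$), or $\mathbb H_k$ ($k>0$) described in the context. Let $P(I(X)=1)$ denote the Buffon probability for $M$ with a geodesic needle of length $2L$ and a grating of spacing $2L$, as defined in the context. Then \[\lim_{L\to 0^+} P(I(X)=1) = \frac{2}{\pi},\] where $L$ tends to $0$ through its admissible values.
   Context: Model surfaces: $\mathbb R^2$ is the Euclidean plane; $\mathbb S_r$ is the round sphere of radius $r>0$ in $\mathbb R^3$ with its geodesic distance; $\mathbb H_k$ ($k>0$) is the open unit disk with the Riemannian metric ${\rm d}s^2=\frac{4k^2}{(1-(x^2+y^2))^2}({\rm d}x\otimes {\rm d}x+{\rm d}y\otimes {\rm d}y)$. Admissible $L$: any $L>0$ if $M$ is $\mathbb R^2$ or $\mathbb H_k$; $L=\frac{\pi r}{2n}$ with $n$ a natural number greater than $1$ if $M$ is $\mathbb S_r$. (So for $\mathbb S_r$, $L\to0^+$ means $L=\frac{\pi r}{2n}$ with $n\to\infty$.) Equators and gratings: an equator $\mathcal E$ for $M$ is a directed (complete) geodesic of $M$. For $x\in\mathcal E$ and a real number $z$ (taken mod $2\pi r$ for $\mathbb S_r$), $p_x(z)$ is the point of $\mathcal E$ at signed distance $z$ from $x$ along $\mathcal E$. A grating line for $\mathcal E$ is a (complete) geodesic that meets $\mathcal E$ at a right angle. A grating $G(L)$ with equator $\mathcal E$ and spacing $2L$ is a set of grating lines for $\mathcal E$ whose points of intersection with $\mathcal E$ form an evenly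 spaced set with smallest spacing $2L$, extending along all of $\mathcal E$; that is, for any point $x_0$ in $G(L)\cap\mathcal E$, $G(L)\cap\mathcal E=\{p_{x_0}(2mL)\colon m\in\mathbb Z\}$. Needle and Buffon probability: a needle is a geodesic segment of length $2L$ with a marked endpoint (its tip). For $x\in\mathcal E$, let $X$ be uniformly distributed on $[-L,L]$; given $X=z$, the needle has midpoint $p_x(z)$ and its tip is uniformly distributed, with respect to arc length, on the geodesic circle of radius $L$ centered at $p_x(z)$. Let $I_x(X)$ be the random variable equal to $1$ if the needle intersects (some line of) $G(L)$ and $0$ otherwise. Write $I(X)=I_{x_0}(X)$, where $\mathcal E$ is an equator, $G(L)$ is a grating with equator $\mathcal E$ and spacing $2L$, and $x_0\in G(L)\cap\mathcal E$. The Buffon probability is $P(I(X)=1)$. *)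

theory Defs
  imports "HOL-Probability.Probability"
begin

text \<open>
  A Riemannian surface enters as a metric space with carrier \<open>M\<close> and its Riemannian distance
  \<open>d\<close>.  By the Myers-Steenrod theorem Riemannian isometries are the same as distance-preserving
  bijections, and geodesics, angles, arc length and geodesic circles are all determined by
  \<open>d\<close>.
\<close>

section \<open>Model surfaces\<close>

text \<open>
  The distance on a surface \<open>S\<close> in a Euclidean space given by a Riemannian metric tensor:
  \<open>g p u v\<close> is the inner product of the tangent vectors \<open>u\<close>, \<open>v\<close> at \<open>p\<close>.
  The value outside \<open>S\<close> is irrelevant; it is \<open>0\<close> so that \<open>Metric_space\<close>, which requires
  nonnegativity and symmetry everywhere, applies.
\<close>

definition riem_length ::
    "('a::euclidean_space \<Rightarrow> 'a \<Rightarrow> 'a \<Rightarrow> real) \<Rightarrow> (real \<Rightarrow> 'a) \<Rightarrow> real" where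
  "riem_length g c =
     integral {0..1} (\<lambda>t. sqrt (g (c t) (vector_derivative c (at t)) (vector_derivative c (at t))))"

definition riem_dist ::
    "'a::euclidean_space set \<Rightarrow> ('a \<Rightarrow> 'a \<Rightarrow> 'a \<Rightarrow> real) \<Rightarrow> 'a \<Rightarrow> 'a \<Rightarrow> real" where
  "riem_dist S g x y =
     (if x \<in> S \<and> y \<in> S
      then Inf {riem_length g c | c. c C1_differentiable_on {0..1} \<and> path_image c \<subseteq> S \<and>
                                     pathstart c = x \<and> pathfinish c = y}
      else 0)"

definition hyp_metric :: "real \<Rightarrow> real^2 \<Rightarrow> real^2 \<Rightarrow> real^2 \<Rightarrow> real" where
  "hyp_metric k p u v =
     4 * k\<^sup>2 / (1 - ((p $ 1)\<^sup>2 + (p $ 2)\<^sup>2))\<^sup>2 * (u $ 1 * v $ 1 + u $ 2 * v $ 2)"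

datatype model = Plane | Sphere real | Hyperbolic real

fun valid_model :: "model \<Rightarrow> bool" where
  "valid_model Plane \<longleftrightarrow> True"
| "valid_model (Sphere r) \<longleftrightarrow> r > 0"
| "valid_model (Hyperbolic k) \<longleftrightarrow> k > 0"

definition isometric ::
    "'a set \<Rightarrow> ('a \<Rightarrow> 'a \<Rightarrow> real) \<Rightarrow> 'b set \<Rightarrow> ('b \<Rightarrow> 'b \<Rightarrow> real) \<Rightarrow> bool" where
  "isometric M d N e \<longleftrightarrow>
     (\<exists>f. bij_betw f M N \<and> (\<forall>x\<in>M. \<forall>y\<in>M. e (f x) (f y) = d x y))"

fun isometric_to_model :: "'a set \<Rightarrow> ('a \<Rightarrow> 'a \<Rightarrow> real) \<Rightarrow> model \<Rightarrow> bool" where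
  "isometric_to_model M d Plane \<longleftrightarrow> isometric M d (UNIV :: (real^2) set) dist"
| "isometric_to_model M d (Sphere r) \<longleftrightarrow>
     isometric M d (sphere (0 :: real^3) r) (riem_dist (sphere 0 r) (\<lambda>p u v. u \<bullet> v))"
| "isometric_to_model M d (Hyperbolic k) \<longleftrightarrow>
     isometric M d (ball (0 :: real^2) 1) (riem_dist (ball 0 1) (hyp_metric k))"

fun admissible :: "model \<Rightarrow> real set" where
  "admissible Plane = {0<..}"
| "admissible (Sphere r) = {pi * r / (2 * real n) | n. n > 1}"
| "admissible (Hyperbolic k) = {0<..}"

section \<open>Geodesics, angles, arc length\<close>

text \<open>Unit-speed geodesics are the locally distance-preserving curves.\<close>

definition geodesic_on ::
    "'a set \<Rightarrow> ('a \<Rightarrow> 'a \<Rightarrow> real) \<Rightarrow> real set \<Rightarrow> (real \<Rightarrow> 'a) \<Rightarrow> bool" where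
  "geodesic_on M d J c \<longleftrightarrow> c ` J \<subseteq> M \<and>
     (\<forall>t\<in>J. \<exists>e>0. \<forall>u\<in>J. \<forall>v\<in>J. \<bar>u - t\<bar> < e \<longrightarrow> \<bar>v - t\<bar> < e \<longrightarrow> d (c u) (c v) = \<bar>u - v\<bar>)"

abbreviation complete_geodesic ::
    "'a set \<Rightarrow> ('a \<Rightarrow> 'a \<Rightarrow> real) \<Rightarrow> (real \<Rightarrow> 'a) \<Rightarrow> bool" where
  "complete_geodesic M d c \<equiv> geodesic_on M d UNIV c"

text \<open>
  The angle between two geodesics issuing from \<open>a 0 = b 0\<close> is the limit of Euclidean comparison
  angles (law of cosines); in a Riemannian manifold it is the angle between the initial velocities.
\<close>

definition comparison_angle :: "('a \<Rightarrow> 'a \<Rightarrow> real) \<Rightarrow> 'a \<Rightarrow> 'a \<Rightarrow> 'a \<Rightarrow> real" where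
  "comparison_angle d p x y =
     arccos (((d p x)\<^sup>2 + (d p y)\<^sup>2 - (d x y)\<^sup>2) / (2 * d p x * d p y))"

definition has_angle ::
    "('a \<Rightarrow> 'a \<Rightarrow> real) \<Rightarrow> (real \<Rightarrow> 'a) \<Rightarrow> (real \<Rightarrow> 'a) \<Rightarrow> real \<Rightarrow> bool" where
  "has_angle d a b \<theta> \<longleftrightarrow> a 0 = b 0 \<and>
     ((\<lambda>(s, t). comparison_angle d (a 0) (a s) (b t)) \<longlongrightarrow> \<theta>) (at_right 0 \<times>\<^sub>F at_right 0)"

definition meets_orthogonally ::
    "('a \<Rightarrow> 'a \<Rightarrow> real) \<Rightarrow> (real \<Rightarrow> 'a) \<Rightarrow> (real \<Rightarrow> 'a) \<Rightarrow> bool" where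
  "meets_orthogonally d a b \<longleftrightarrow>
     (\<exists>s t. has_angle d (\<lambda>u. a (s + u)) (\<lambda>u. b (t + u)) (pi / 2))"

definition arc_length ::
    "('a \<Rightarrow> 'a \<Rightarrow> real) \<Rightarrow> (real \<Rightarrow> 'a) \<Rightarrow> real \<Rightarrow> real \<Rightarrow> ennreal" where
  "arc_length d c s t =
     Sup {(\<Sum>i<n. ennreal (d (c (\<tau> i)) (c (\<tau> (Suc i))))) | n \<tau>.
            mono_on {..n} \<tau> \<and> \<tau> 0 = s \<and> \<tau> n = t}"

definition arc_length_parametrization ::
    "('a \<Rightarrow> 'a \<Rightarrow> real) \<Rightarrow> 'a set \<Rightarrow> real \<Rightarrow> (real \<Rightarrow> 'a) \<Rightarrow> bool" where
  "arc_length_parametrization d C l c \<longleftrightarrow> l > 0 \<and>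
     c ` {0..l} = C \<and> inj_on c {0..<l} \<and> c l = c 0 \<and>
     (\<forall>s t. 0 \<le> s \<and> s \<le> t \<and> t \<le> l \<longrightarrow> arc_length d c s t = ennreal (t - s))"

definition geodesic_circle :: "'a set \<Rightarrow> ('a \<Rightarrow> 'a \<Rightarrow> real) \<Rightarrow> 'a \<Rightarrow> real \<Rightarrow> 'a set" where
  "geodesic_circle M d p R = {q \<in> M. d p q = R}"

definition borel_of_metric :: "'a set \<Rightarrow> ('a \<Rightarrow> 'a \<Rightarrow> real) \<Rightarrow> 'a measure" where
  "borel_of_metric M d = sigma M {U. openin (Metric_space.mtopology M d) U}"

text \<open>
  The uniform distribution with respect to arc length on a simple closed curve \<open>C\<close>.  It does not
  depend on the parametrization, so that \<open>THE\<close> picks a measure and not a parametrization.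
\<close>

definition uniform_on_curve :: "'a set \<Rightarrow> ('a \<Rightarrow> 'a \<Rightarrow> real) \<Rightarrow> 'a set \<Rightarrow> 'a measure" where
  "uniform_on_curve M d C = (THE \<mu>. \<exists>l c. arc_length_parametrization d C l c \<and>
     \<mu> = distr (uniform_measure (restrict_space lborel {0..l}) {0..l}) (borel_of_metric M d) c)"

section \<open>Gratings and needles\<close>

text \<open>
  An equator is a complete geodesic \<open>E\<close>, directed by its unit-speed parametrization.  A point
  \<open>x\<close> of it is given as \<open>E t\<close>, so that \<open>p\<^sub>x(z)\<close> is \<open>E (t + z)\<close>; on a sphere
  \<open>E\<close> is periodic with period \<open>2 \<pi> r\<close>.  Grating lines are point sets.
\<close>

definition grating_line ::
    "'a set \<Rightarrow> ('a \<Rightarrow> 'a \<Rightarrow> real) \<Rightarrow> (real \<Rightarrow> 'a) \<Rightarrow> 'a set \<Rightarrow> bool" where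
  "grating_line M d E l \<longleftrightarrow>
     (\<exists>c. complete_geodesic M d c \<and> l = range c \<and> meets_orthogonally d c E)"

definition grating ::
    "'a set \<Rightarrow> ('a \<Rightarrow> 'a \<Rightarrow> real) \<Rightarrow> (real \<Rightarrow> 'a) \<Rightarrow> real \<Rightarrow> 'a set set \<Rightarrow> bool" where
  "grating M d E L G \<longleftrightarrow> G \<noteq> {} \<and> (\<forall>l\<in>G. grating_line M d E l) \<and>
     (\<forall>t. E t \<in> \<Union>G \<longrightarrow> \<Union>G \<inter> range E = {E (t + 2 * of_int m * L) | m :: int. True})"

definition needle ::
    "'a set \<Rightarrow> ('a \<Rightarrow> 'a \<Rightarrow> real) \<Rightarrow> real \<Rightarrow> 'a \<Rightarrow> 'a \<Rightarrow> 'a set \<Rightarrow> bool" where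
  "needle M d L p q N \<longleftrightarrow>
     (\<exists>c. geodesic_on M d {-L..L} c \<and> c 0 = p \<and> c L = q \<and> N = c ` {-L..L})"

text \<open>
  The random experiment, with outcome the pair of the position \<open>z\<close> of the midpoint
  \<open>E (t\<^sub>0 + z)\<close> and the tip \<open>q\<close>: \<open>z\<close> is uniform on \<open>[-L, L]\<close> and, given
  \<open>z\<close>, the tip is uniform on the circle of radius \<open>L\<close> about the midpoint.
\<close>

definition needle_law ::
    "'a set \<Rightarrow> ('a \<Rightarrow> 'a \<Rightarrow> real) \<Rightarrow> real \<Rightarrow> (real \<Rightarrow> 'a) \<Rightarrow> real \<Rightarrow> (real \<times> 'a) measure" where
  "needle_law M d L E t\<^sub>0 =
     bind (uniform_measure lborel {-L..L})
       (\<lambda>z. distr (uniform_on_curve M d (geodesic_circle M d (E (t\<^sub>0 + z)) L))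
              (borel \<Otimes>\<^sub>M borel_of_metric M d) (\<lambda>q. (z, q)))"

text \<open>For admissible \<open>L\<close> the needle with given midpoint and tip is unique.\<close>

definition hits ::
    "'a set \<Rightarrow> ('a \<Rightarrow> 'a \<Rightarrow> real) \<Rightarrow> real \<Rightarrow> (real \<Rightarrow> 'a) \<Rightarrow> 'a set set \<Rightarrow> real \<Rightarrow> real \<times> 'a \<Rightarrow> real" where
  "hits M d L E G t\<^sub>0 = (\<lambda>(z, q).
     if \<exists>N. needle M d L (E (t\<^sub>0 + z)) q N \<and> (\<exists>l\<in>G. N \<inter> l \<noteq> {}) then 1 else 0)"

definition buffon_probability ::
    "'a set \<Rightarrow> ('a \<Rightarrow> 'a \<Rightarrow> real) \<Rightarrow> real \<Rightarrow> (real \<Rightarrow> 'a) \<Rightarrow> 'a set set \<Rightarrow> real \<Rightarrow> real" where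
  "buffon_probability M d L E G t\<^sub>0 =
     measure (needle_law M d L E t\<^sub>0)
       {\<omega> \<in> space (needle_law M d L E t\<^sub>0). hits M d L E G t\<^sub>0 \<omega> = 1}"

end

theory Submission
  imports Defs
begin

text \<open>
  For a needle whose midpoint is at distance \<open>z\<close> from a grating line, measured along the equator, and
  which makes the angle \<open>\<theta>\<close> with the equator, right-angled trigonometry in constant curvature shows that it
  meets the line iff \<open>tn \<bar>z\<bar> \<le> tn L \<bar>cos \<theta>\<bar>\<close>, where \<open>tn\<close> is \<open>x\<close>, \<open>tan (x / r)\<close> or \<open>tanh (x / k)\<close>; by
  admissibility the nearest grating line is the only one that matters.  As \<open>\<theta>\<close> is uniform, the Buffon
  probability is the mean over \<open>z = L u\<close> of \<open>2 / pi\<close> times \<open>arccos (tn \<bar>L u\<bar> / tn L)\<close>, and by dominated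
  convergence it tends to the mean of \<open>2 / pi\<close> times \<open>arccos \<bar>u\<bar>\<close> over \<open>[-1, 1]\<close>, which is \<open>2 / pi\<close>.
  The three geometries are treated at once: each model has polar coordinates along any geodesic in which a
  single law of cosines holds, and that law determines geodesics, perpendiculars and circles.
\<close>

section \<open>Trigonometry in constant curvature\<close>

text \<open>The difficulty is less the integral than that every notion is defined through the bare
  distance. On the sphere and on the disc that distance is an infimum of lengths over all
  \<open>C1\<close> curves, so an explicit formula must be shown to be this infimum. Geodesics are
  merely locally distance-preserving curves, grating lines are point sets with a right angle in the
  sense of comparison angles, and the law of the tip is a definite description over all arc-length
  parametrizations of a circle. The law of cosines settles all of this: it makes a geodesic with
  given start determined by its angle, turns a perpendicular into the solution set of one relation
  between \<open>sn\<close> and \<open>cs\<close>, and makes a chord of a circle depend on the angle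
  difference only. On the sphere it determines distances only up to a bound, hence the radius
  \<open>\<rho>\<close>; as \<open>L\<close> tends to 0, that is enough. The constant
  \<open>2 / pi\<close> appears because the integral of \<open>arccos\<close> over
  \<open>[0, 1]\<close> is 1.\<close>

text \<open>
  Trigonometry in constant curvature \<open>\<kappa>\<close>: \<open>sn\<close> and \<open>cs\<close> are the generalized sine and cosine, and
  \<open>md\<close> stands for \<open>(1 - cs) / \<kappa>\<close>, whose limit for \<open>\<kappa> = 0\<close> is \<open>x\<^sup>2 / 2\<close>.  Below the radius \<open>\<rho>\<close> these
  functions behave as in the plane.
\<close>

locale trig =
  fixes \<kappa> \<rho> :: real and sn cs md :: "real \<Rightarrow> real"
  assumes rho_pos: "0 < \<rho>"
    and sn_add: "sn (x + y) = sn x * cs y + cs x * sn y"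
    and md_add: "md (x + y) = md x * cs y + md y + sn x * sn y"
    and cs_md: "cs x = 1 - \<kappa> * md x"
    and sn_minus [simp]: "sn (- x) = - sn x"
    and md_minus [simp]: "md (- x) = md x"
    and sn_pos: "0 < x \<Longrightarrow> x \<le> \<rho> \<Longrightarrow> 0 < sn x"
    and cs_pos: "\<bar>x\<bar> \<le> \<rho> \<Longrightarrow> 0 < cs x"
    and continuous_sn: "continuous_on UNIV sn"
    and sn_lim: "((\<lambda>x. sn x / x) \<longlongrightarrow> 1) (at 0)"
begin

lemma sn_0 [simp]: "sn 0 = 0"
  using sn_minus[of 0] by simp

lemma cs_minus [simp]: "cs (- x) = cs x"
  by (simp add: cs_md)

lemma sn_diff: "sn (x - y) = sn x * cs y - cs x * sn y"
  using sn_add[of x "- y"] by simp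

lemma md_diff: "md (x - y) = md x * cs y + md y - sn x * sn y"
  using md_add[of x "- y"] by simp

text \<open>The uniform substitute for product-to-sum formulas: it survives in the flat case, where
  it is \<open>(x + y)^2 / 2 - (x - y)^2 / 2 = 2 x y\<close>.\<close>

lemma md_add_minus_diff: "md (x + y) - md (x - y) = 2 * sn x * sn y"
  by (simp add: md_add md_diff)

lemma md_0 [simp]: "md 0 = 0"
proof -
  have "md 0 * cs 0 = 0" using md_add[of 0 0] by simp
  then show ?thesis using cs_pos[of 0] rho_pos by simp
qed

lemma cs_0 [simp]: "cs 0 = 1"
  by (simp add: cs_md)

lemma md_double: "md (2 * x) = 2 * (sn x)\<^sup>2"
  using md_add_minus_diff[of x x] by (simp add: power2_eq_square)

lemma md_half: "md x = 2 * (sn (x / 2))\<^sup>2"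
  using md_double[of "x / 2"] by simp

lemma sn_sq: "(sn x)\<^sup>2 = md x * (1 + cs x)"
  using md_add[of x x] md_double[of x] by (simp add: algebra_simps power2_eq_square)

lemma cs_sq: "(cs x)\<^sup>2 = 1 - \<kappa> * (sn x)\<^sup>2"
  unfolding sn_sq by (simp add: cs_md algebra_simps power2_eq_square)

text \<open>Monotonicity without derivatives: the difference is twice the product of
  \<open>sn\<close> at the half-sum and at the half-difference, and both lie in the interval where
  \<open>sn\<close> is positive.\<close>

lemma md_less: assumes "0 \<le> x" "x < y" "y \<le> \<rho>" shows "md x < md y"
proof -
  have "md y - md x = 2 * sn ((y + x) / 2) * sn ((y - x) / 2)"
    using md_add_minus_diff[of "(y + x) / 2" "(y - x) / 2"] by (simp add: field_simps)
  moreover have "sn ((y + x) / 2) > 0" "sn ((y - x) / 2) > 0"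
    using assms by (auto intro!: sn_pos)
  ultimately show ?thesis
    by (smt (verit) mult_pos_pos)
qed

lemma md_le_iff: "0 \<le> x \<Longrightarrow> x \<le> \<rho> \<Longrightarrow> 0 \<le> y \<Longrightarrow> y \<le> \<rho> \<Longrightarrow> md x \<le> md y \<longleftrightarrow> x \<le> y"
  using md_less[of x y] md_less[of y x] by (cases x y rule: linorder_cases) auto

lemma md_abs: "md \<bar>x\<bar> = md x"
  by (simp add: abs_if)

lemma sn_nonneg: "0 \<le> x \<Longrightarrow> x \<le> \<rho> \<Longrightarrow> 0 \<le> sn x"
  using sn_pos[of x] by (cases "x = 0") auto

lemma abs_sn: "\<bar>x\<bar> \<le> \<rho> \<Longrightarrow> \<bar>sn x\<bar> = sn \<bar>x\<bar>"
  using sn_nonneg[of x] sn_nonneg[of "-x"] by (cases "x \<ge> 0") auto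

lemma continuous_md: "continuous_on UNIV md"
proof -
  have *: "continuous_on UNIV (\<lambda>x. sn (x / 2))"
    by (rule continuous_on_compose2[OF continuous_sn]) (auto intro!: continuous_intros)
  have "md = (\<lambda>x. 2 * (sn (x / 2))\<^sup>2)" by (auto simp: md_half[symmetric])
  then show ?thesis by (auto intro!: continuous_intros *)
qed

lemma continuous_cs: "continuous_on UNIV cs"
proof -
  have "cs = (\<lambda>x. 1 - \<kappa> * md x)" by (auto simp: cs_md)
  then show ?thesis by (auto intro!: continuous_intros continuous_md)
qed

lemma md_lim: "((\<lambda>x. md x / x\<^sup>2) \<longlongrightarrow> 1 / 2) (at 0)"
proof -
  have "((\<lambda>x. sn (x / 2) / (x / 2)) \<longlongrightarrow> 1) (at 0)"
    by (rule filterlim_compose[OF sn_lim])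
       (auto simp: filterlim_at eventually_at intro!: tendsto_eq_intros exI[of _ 1])
  then have "((\<lambda>x. (sn (x / 2) / (x / 2))\<^sup>2 / 2) \<longlongrightarrow> 1\<^sup>2 / 2) (at 0)"
    by (intro tendsto_intros) auto
  moreover have "(\<lambda>x. (sn (x / 2) / (x / 2))\<^sup>2 / 2) = (\<lambda>x. md x / x\<^sup>2)"
    by (auto simp: md_half power2_eq_square)
  ultimately show ?thesis by simp
qed

text \<open>On the sphere \<open>md\<close> is periodic, so \<open>md (f y)\<close> can be small
  while \<open>f y\<close> is large. The second assumption keeps \<open>f y\<close> on the branch
  where \<open>md\<close> controls it; for distances it is supplied by \<open>md_dist_le\<close> or
  \<open>md_D_le\<close>.\<close>

lemma tendsto_0_if_md_tendsto_0:
  assumes lim: "((\<lambda>y. md (f y)) \<longlongrightarrow> 0) \<F>"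
    and ev: "\<forall>\<^sub>F y in \<F>. 0 \<le> f y \<and> (\<forall>u\<in>{0..\<rho>}. md (f y) \<le> md u \<longrightarrow> f y \<le> u)"
  shows "(f \<longlongrightarrow> 0) \<F>"
proof (rule tendstoI)
  fix e :: real assume e: "0 < e"
  define \<delta> where "\<delta> = min (e / 2) \<rho>"
  have \<delta>: "0 < \<delta>" "\<delta> \<le> \<rho>" "\<delta> < e" using e rho_pos by (auto simp: \<delta>_def min_def)
  have "md \<delta> > 0" using md_less[of 0 \<delta>] \<delta> by simp
  from order_tendstoD(2)[OF lim this] ev show "\<forall>\<^sub>F y in \<F>. dist (f y) 0 < e"
  proof eventually_elim
    case (elim y)
    then have "0 \<le> f y" "f y \<le> \<delta>" using \<delta> by auto
    then show ?case using \<delta> by (simp add: dist_real_def)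
  qed
qed

section \<open>Ratios of tangents and the limit of the mean hitting probability\<close>

lemma tan_abs_le:
  assumes "\<bar>z\<bar> \<le> L" "L \<le> \<rho>" shows "\<bar>sn z\<bar> * cs L \<le> sn L * cs z"
proof -
  \<comment> \<open>Monotonicity of the tangent, cross-multiplied: by the subtraction formula
    \<open>sn (L - \<bar>z\<bar>)\<close> is the difference of the two sides.\<close>
  have "sn (L - \<bar>z\<bar>) \<ge> 0" using assms by (intro sn_nonneg) auto
  then have "sn \<bar>z\<bar> * cs L \<le> sn L * cs \<bar>z\<bar>" by (simp add: sn_diff mult.commute)
  then show ?thesis using assms abs_sn[of z] by (auto simp: abs_if split: if_splits)
qed

text \<open>The inequality between tangents from the overview, multiplied out so that it keeps its
  meaning when \<open>cs w = 0\<close>, which happens on the sphere at a quarter of a great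
  circle.\<close>

abbreviation (input) crosses :: "real \<Rightarrow> real \<Rightarrow> real \<Rightarrow> bool" where
  "crosses L w c \<equiv> \<bar>sn w\<bar> * cs L \<le> sn L * \<bar>cs w\<bar> * \<bar>c\<bar>"

definition tan_ratio :: "real \<Rightarrow> real \<Rightarrow> real" where
  "tan_ratio L z = \<bar>sn z\<bar> * cs L / (sn L * cs z)"

lemma tan_ratio_range:
  assumes "\<bar>z\<bar> \<le> L" "0 < L" "L \<le> \<rho>" shows "0 \<le> tan_ratio L z" "tan_ratio L z \<le> 1"
proof -
  have "0 < sn L" "0 < cs L" "0 < cs z" using assms sn_pos cs_pos by auto
  then show "0 \<le> tan_ratio L z" "tan_ratio L z \<le> 1"
    using tan_abs_le[OF assms(1,3)] by (auto simp: tan_ratio_def divide_simps)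
qed

lemma tan_ratio_tendsto:
  fixes X :: "nat \<Rightarrow> real"
  assumes X: "X \<longlonglongrightarrow> 0" "\<And>n. 0 < X n"
  shows "(\<lambda>n. tan_ratio (X n) (X n * u)) \<longlonglongrightarrow> \<bar>u\<bar>"
proof (cases "u = 0")
  case True then show ?thesis by (simp add: tan_ratio_def)
next
  case False
  have f1: "filterlim X (at 0) sequentially"
    using X by (auto simp: filterlim_at intro!: always_eventually) (metis less_irrefl)
  have f2: "filterlim (\<lambda>n. X n * u) (at 0) sequentially"
    using X False by (auto simp: filterlim_at intro!: always_eventually tendsto_mult_left_zero)
      (metis less_irrefl)
  have s1: "(\<lambda>n. sn (X n) / X n) \<longlonglongrightarrow> 1" by (rule filterlim_compose[OF sn_lim f1])
  have s2: "(\<lambda>n. sn (X n * u) / (X n * u)) \<longlonglongrightarrow> 1" by (rule filterlim_compose[OF sn_lim f2])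
  have c: "isCont cs 0" using continuous_cs by (simp add: continuous_on_eq_continuous_at)
  have c1: "(\<lambda>n. cs (X n)) \<longlonglongrightarrow> 1" using isCont_tendsto_compose[OF c X(1)] by simp
  have c2: "(\<lambda>n. cs (X n * u)) \<longlonglongrightarrow> 1"
    using isCont_tendsto_compose[OF c, of "\<lambda>n. X n * u"] X by (auto intro!: tendsto_mult_left_zero)
  have "(\<lambda>n. \<bar>u\<bar> * \<bar>sn (X n * u) / (X n * u)\<bar> / (sn (X n) / X n) * (cs (X n) / cs (X n * u)))
      \<longlonglongrightarrow> \<bar>u\<bar> * \<bar>1\<bar> / 1 * (1 / 1)"
    by (intro tendsto_intros s1 s2 c1 c2) auto
  moreover have "\<bar>u\<bar> * \<bar>sn (X n * u) / (X n * u)\<bar> / (sn (X n) / X n) * (cs (X n) / cs (X n * u))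
      = tan_ratio (X n) (X n * u)" for n
    using X(2)[of n] False by (simp add: tan_ratio_def abs_mult abs_divide)
  ultimately show ?thesis by simp
qed

text \<open>
  With \<open>z = L u\<close> the needle hits the line through the origin iff \<open>tan_ratio L z \<le> \<bar>cos \<theta>\<bar>\<close> for its angle \<open>\<theta>\<close>,
  which has probability \<open>2 arccos (tan_ratio L z) / pi\<close>.
\<close>

definition hit_mean :: "real \<Rightarrow> real" where
  "hit_mean L = (LINT u:{-1..1}|lborel. arccos (tan_ratio L (L * u)) / pi)"

lemma continuous_arccos_tan_ratio:
  assumes "0 < L" "L \<le> \<rho>"
  shows "continuous_on {-1..1} (\<lambda>u. arccos (tan_ratio L (L * u)) / pi)"
proof -
  have b: "\<bar>L * u\<bar> \<le> L" if "u \<in> {-1..1}" for u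
    using that assms by (auto simp: abs_mult)
  have r: "tan_ratio L (L * u) \<in> {-1..1}" if "u \<in> {-1..1}" for u
    using tan_ratio_range[OF b[OF that] assms] by auto
  have p: "cs (L * u) \<noteq> 0" if "u \<in> {-1..1}" for u
    using cs_pos[of "L * u"] b[OF that] assms by auto
  have "sn L \<noteq> 0" using sn_pos[OF assms] by auto
  have "continuous_on {-1..1} (\<lambda>u. sn (L * u))" "continuous_on {-1..1} (\<lambda>u. cs (L * u))"
    by (auto intro!: continuous_on_compose2[OF continuous_sn] continuous_on_compose2[OF continuous_cs]
          continuous_intros)
  then have "continuous_on {-1..1} (\<lambda>u. tan_ratio L (L * u))"
    unfolding tan_ratio_def using p \<open>sn L \<noteq> 0\<close> by (intro continuous_intros) auto
  then have "continuous_on {-1..1} (\<lambda>u. arccos (tan_ratio L (L * u)))"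
    using r by (intro continuous_on_compose2[OF continuous_on_arccos']) auto
  from continuous_on_divide[OF this continuous_on_const, of pi] show ?thesis by simp
qed

lemma mean_arccos: "(LINT u:{-1..1}|lborel. arccos \<bar>u\<bar> / pi) = 2 / pi"
proof -
  define f where "f = (\<lambda>u::real. arccos \<bar>u\<bar> / pi)"
  have c: "continuous_on {-1..1} f" unfolding f_def
    by (intro continuous_intros continuous_on_compose2[OF continuous_on_arccos']) auto
  have i: "set_integrable lborel {-1..1} f"
    by (rule borel_integrable_atLeastAtMost') fact
  have F: "((\<lambda>u. u * arccos u - sqrt (1 - u\<^sup>2)) has_real_derivative arccos u) (at u)"
    if "0 < u" "u < 1" for u :: real
  proof -
    have *: "1 - u\<^sup>2 > 0" using that power_strict_mono[of u 1 2] by simp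
    have "((\<lambda>u. u * arccos u - sqrt (1 - u\<^sup>2)) has_real_derivative
       (1 * arccos u + inverse (- sqrt (1 - u\<^sup>2)) * u - inverse (sqrt (1 - u\<^sup>2)) / 2 * (- 2 * u))) (at u)"
      using that * by (auto intro!: derivative_eq_intros simp: field_simps)
    then show ?thesis by simp
  qed
  \<comment> \<open>The derivative of \<open>arccos\<close> blows up at 1, so the antiderivative is
    differentiated in the open interval only and continuity takes care of the ends.\<close>
  have h: "((\<lambda>u. arccos u) has_integral (1 * arccos 1 - sqrt (1 - 1\<^sup>2)) - (0 * arccos 0 - sqrt (1 - 0\<^sup>2))) {0..1::real}"
    using F by (intro fundamental_theorem_of_calculus_interior)
      (auto intro!: continuous_intros simp: has_real_derivative_iff_has_vector_derivative)
  then have "((\<lambda>u. arccos u) has_integral 1) {0..1::real}" by simp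
  then have "((\<lambda>u. arccos u / pi) has_integral 1 / pi) {0..1::real}"
    by (rule has_integral_divide)
  then have p: "(f has_integral 1 / pi) {0..1}"
    by (rule has_integral_eq[rotated]) (auto simp: f_def)
  have n: "(f has_integral 1 / pi) {-1..0}"
    using has_integral_reflect_lemma_real[OF p] by (simp add: f_def)
  have "(f has_integral 1 / pi + 1 / pi) {-1..1}"
    by (rule has_integral_combine[OF _ _ n p]) auto
  then have "integral {-1..1} f = 1 / pi + 1 / pi" by (rule integral_unique)
  then show ?thesis
    using set_borel_integral_eq_integral(2)[OF i] unfolding f_def by simp
qed

lemma hit_mean_tendsto: "(hit_mean \<longlongrightarrow> 2 / pi) (at_right 0)"
  unfolding tendsto_at_iff_sequentially
proof (intro allI impI)
  fix X :: "nat \<Rightarrow> real"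
  assume X: "\<forall>i. X i \<in> {0<..} - {0}" "X \<longlonglongrightarrow> 0"
  then have pos: "0 < X n" for n by auto
  have ev: "\<forall>\<^sub>F n in sequentially. X n \<le> \<rho>"
    using order_tendstoD(2)[OF X(2) rho_pos] by (auto elim: eventually_mono)
  then obtain N where N: "\<And>n. n \<ge> N \<Longrightarrow> X n \<le> \<rho>" by (auto simp: eventually_sequentially)
  \<comment> \<open>A tail of the sequence: the bound on \<open>tan_ratio\<close>, and with it the
    dominating function, is available below \<open>\<rho>\<close> only.\<close>
  define Y where "Y n = X (n + N)" for n
  have Y: "0 < Y n" "Y n \<le> \<rho>" for n using pos N by (auto simp: Y_def)
  have Y0: "Y \<longlonglongrightarrow> 0" using LIMSEQ_ignore_initial_segment[OF X(2)] unfolding Y_def .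
  have b: "\<bar>Y n * u\<bar> \<le> Y n" if "u \<in> {-1..1}" for u n
    using that Y(1)[of n] by (auto simp: abs_mult)
  have "(\<lambda>n. LINT u|lborel. indicator {-1..1} u *\<^sub>R (arccos (tan_ratio (Y n) (Y n * u)) / pi))
      \<longlonglongrightarrow> (LINT u|lborel. indicator {-1..1} u *\<^sub>R (arccos \<bar>u\<bar> / pi))"
  proof (rule integral_dominated_convergence[where w = "\<lambda>u. indicator {-1..1} u *\<^sub>R 1"])
    show "(\<lambda>u::real. indicator {-1..1} u *\<^sub>R (arccos \<bar>u\<bar> / pi)) \<in> borel_measurable lborel"
      unfolding measurable_lborel2
      by (rule borel_measurable_continuous_on_indicator)
         (auto intro!: continuous_intros continuous_on_compose2[OF continuous_on_arccos'])
    show "(\<lambda>u. indicator {-1..1} u *\<^sub>R (arccos (tan_ratio (Y n) (Y n * u)) / pi)) \<in> borel_measurable lborel" for n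
      unfolding measurable_lborel2
      by (rule borel_measurable_continuous_on_indicator)
         (use continuous_arccos_tan_ratio[OF Y] in auto)
    show "integrable lborel (\<lambda>u::real. indicator {-1..1} u *\<^sub>R (1::real))" by simp
    show "AE u in lborel. norm (indicator {-1..1} u *\<^sub>R (arccos (tan_ratio (Y n) (Y n * u)) / pi))
         \<le> indicator {-1..1} u *\<^sub>R 1" for n
    proof (rule AE_I2)
      fix u :: real
      show "norm (indicator {-1..1} u *\<^sub>R (arccos (tan_ratio (Y n) (Y n * u)) / pi))
         \<le> indicator {-1..1} u *\<^sub>R 1"
      proof (cases "u \<in> {-1..1}")
        case True
        have "0 \<le> tan_ratio (Y n) (Y n * u)" "tan_ratio (Y n) (Y n * u) \<le> 1"
          by (rule tan_ratio_range[OF b[OF True] Y])+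
        then have "0 \<le> arccos (tan_ratio (Y n) (Y n * u))" "arccos (tan_ratio (Y n) (Y n * u)) \<le> pi"
          by (auto intro!: arccos_lbound arccos_ubound)
        then show ?thesis using True by (simp add: divide_simps)
      qed auto
    qed
    show "AE u in lborel. (\<lambda>n. indicator {-1..1} u *\<^sub>R (arccos (tan_ratio (Y n) (Y n * u)) / pi))
       \<longlonglongrightarrow> indicator {-1..1} u *\<^sub>R (arccos \<bar>u\<bar> / pi)"
    proof (rule AE_I2)
      fix u :: real
      show "(\<lambda>n. indicator {-1..1} u *\<^sub>R (arccos (tan_ratio (Y n) (Y n * u)) / pi))
       \<longlonglongrightarrow> indicator {-1..1} u *\<^sub>R (arccos \<bar>u\<bar> / pi)"
      proof (cases "u \<in> {-1..1}")
        case True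
        have "(\<lambda>n. arccos (tan_ratio (Y n) (Y n * u))) \<longlonglongrightarrow> arccos \<bar>u\<bar>"
        proof (rule continuous_on_tendsto_compose[OF continuous_on_arccos'])
          show "(\<lambda>n. tan_ratio (Y n) (Y n * u)) \<longlonglongrightarrow> \<bar>u\<bar>"
            by (rule tan_ratio_tendsto[OF Y0 Y(1)])
          show "\<bar>u\<bar> \<in> {-1..1}" using True by auto
          show "\<forall>\<^sub>F n in sequentially. tan_ratio (Y n) (Y n * u) \<in> {-1..1}"
            using tan_ratio_range[OF b[OF True] Y] by (auto intro!: always_eventually)
              (smt (verit))
        qed
        then show ?thesis by (auto intro!: tendsto_intros)
      qed auto
    qed
  qed
  then have "(\<lambda>n. hit_mean (Y n)) \<longlonglongrightarrow> 2 / pi"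
    using mean_arccos by (simp add: hit_mean_def set_lebesgue_integral_def)
  then have "(\<lambda>n. hit_mean (X n)) \<longlonglongrightarrow> 2 / pi"
    unfolding Y_def by (rule LIMSEQ_offset)
  then show "(hit_mean \<circ> X) \<longlonglongrightarrow> 2 / pi" by (simp add: o_def)
qed

end

section \<open>Polar frames, geodesics and gratings\<close>

context trig
begin

text \<open>
  \<open>F w s \<theta>\<close> is the point with polar coordinates \<open>(s, \<theta>)\<close> about the point \<open>F 0 w 0\<close> of the geodesic
  \<open>\<lambda>u. F 0 u 0\<close>, whose direction is \<open>\<theta> = 0\<close>.  The second clause is the law of cosines, in a form that is
  not void for \<open>\<kappa> = 0\<close>; it determines the metric, so that no other property of the models is needed.
\<close>

definition frame :: "'a set \<Rightarrow> ('a \<Rightarrow> 'a \<Rightarrow> real) \<Rightarrow> (real \<Rightarrow> real \<Rightarrow> real \<Rightarrow> 'a) \<Rightarrow> bool" where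
  "frame M d F \<longleftrightarrow>
     (\<forall>w s \<theta>. F w s \<theta> \<in> M) \<and>
     (\<forall>w s t \<alpha> \<beta>. md (d (F w s \<alpha>) (F w t \<beta>)) = md (s - t) + sn s * sn t * (1 - cos (\<alpha> - \<beta>))) \<and>
     (\<forall>w. \<forall>q\<in>M. \<exists>\<theta>. q = F w (d (F w 0 0) q) \<theta>) \<and>
     (\<forall>w s. F w s 0 = F 0 (w + s) 0) \<and>
     (\<forall>q\<in>M. \<forall>s. continuous_on UNIV (\<lambda>(w, \<theta>). md (d q (F w s \<theta>))))"

end

text \<open>A surface of constant curvature, reduced to two properties. \<open>md_dist_le\<close>
  makes \<open>md\<close> faithful to distances up to \<open>\<rho>\<close>, which is not automatic
  on the sphere. \<open>ex_frame\<close> expresses homogeneity: polar coordinates exist along every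
  short segment.\<close>

locale cc_space = trig \<kappa> \<rho> sn cs md + Metric_space M d
  for \<kappa> \<rho> :: real and sn cs md :: "real \<Rightarrow> real" and M :: "'a set" and d +
  assumes md_dist_le:
      "x \<in> M \<Longrightarrow> y \<in> M \<Longrightarrow> 0 \<le> u \<Longrightarrow> u \<le> \<rho> \<Longrightarrow> md (d x y) \<le> md u \<longleftrightarrow> d x y \<le> u"
    and ex_frame:
      "p \<in> M \<Longrightarrow> q \<in> M \<Longrightarrow> p \<noteq> q \<Longrightarrow> d p q \<le> \<rho> \<Longrightarrow>
        \<exists>F. frame M d F \<and> F 0 0 0 = p \<and> F 0 (d p q) 0 = q"
begin

lemma md_dist_0: assumes "x \<in> M" "y \<in> M" "md (d x y) = 0" shows "x = y"
  using md_dist_le[OF assms(1,2), of 0] assms rho_pos nonneg[of x y] by auto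

lemma dist_eqI: assumes "x \<in> M" "y \<in> M" "md (d x y) = md u" "\<bar>u\<bar> \<le> \<rho>" shows "d x y = \<bar>u\<bar>"
proof -
  have "d x y \<le> \<bar>u\<bar>" using md_dist_le[OF assms(1,2), of "\<bar>u\<bar>"] assms by (simp add: md_abs)
  moreover have "\<bar>u\<bar> \<le> d x y"
    using md_le_iff[of "\<bar>u\<bar>" "d x y"] calculation assms nonneg[of x y] by (simp add: md_abs)
  ultimately show ?thesis by simp
qed

section \<open>Frames: consequences of the law of cosines\<close>

context
  fixes F assumes F: "frame M d F"
begin

lemma frame_in [simp]: "F w s \<theta> \<in> M"
  using F by (simp add: frame_def)

lemma law: "md (d (F w s \<alpha>) (F w t \<beta>)) = md (s - t) + sn s * sn t * (1 - cos (\<alpha> - \<beta>))"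
  using F by (simp add: frame_def)

lemma frame_shift: "F w s 0 = F 0 (w + s) 0"
  using F by (simp add: frame_def)

text \<open>Polar coordinates fix the angle only up to full turns, and not at all where
  \<open>sn s = 0\<close>, that is at the centre and on the sphere also at its antipode. In both
  cases the angular term of the law vanishes.\<close>

lemma frame_angle_eqI: assumes "cos (\<alpha> - \<beta>) = 1 \<or> sn s = 0" shows "F w s \<alpha> = F w s \<beta>"
  by (rule md_dist_0) (use assms in \<open>auto simp: law\<close>)

lemma frame_center: "F w 0 \<theta> = F 0 w 0"
  using frame_angle_eqI[of \<theta> 0 0 w] frame_shift[of w 0] by simp

text \<open>Going backwards is going forwards in the opposite direction: the law gives
  \<open>md (2 * s) - 2 * (sn s)^2\<close>, which is 0 by \<open>md_double\<close>.\<close>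

lemma frame_opposite: assumes "cos (\<alpha> - \<beta>) = -1" shows "F w (- s) \<alpha> = F w s \<beta>"
  by (rule md_dist_0) (use assms md_double[of s] in \<open>auto simp: law power2_eq_square\<close>)

lemma frame_radial: "\<bar>s - t\<bar> \<le> \<rho> \<Longrightarrow> d (F w s \<theta>) (F w t \<theta>) = \<bar>s - t\<bar>"
  by (rule dist_eqI) (auto simp: law)

lemma frame_radius: "\<bar>s\<bar> \<le> \<rho> \<Longrightarrow> d (F w 0 \<beta>) (F w s \<theta>) = \<bar>s\<bar>"
  using frame_radial[of 0 s w \<theta>] by (simp add: frame_center)

lemma frame_surj: "q \<in> M \<Longrightarrow> \<exists>\<theta>. q = F w (d (F w 0 0) q) \<theta>"
  using F by (simp add: frame_def)

lemma geodesic_frame: "geodesic_on M d J (\<lambda>u. F w u \<theta>)"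
  unfolding geodesic_on_def
proof (intro conjI ballI exI[of _ "\<rho> / 2"] impI)
  fix t u v assume "\<bar>u - t\<bar> < \<rho> / 2" "\<bar>v - t\<bar> < \<rho> / 2"
  then show "d (F w u \<theta>) (F w v \<theta>) = \<bar>u - v\<bar>" by (intro frame_radial) linarith
qed (use rho_pos in auto)

end

section \<open>Uniqueness of geodesics\<close>

lemma extension_unique:
  assumes in_M: "a \<in> M" "m \<in> M" "b \<in> M" "b' \<in> M"
    and st: "0 < s" "0 < t" "s + t \<le> \<rho>"
    and dist: "d m a = s" "d m b = t" "d m b' = t" "d a b = s + t" "d a b' = s + t"
  shows "b = b'"
proof -
  have "m \<noteq> a" "d m a \<le> \<rho>" using dist st in_M by auto
  then obtain F where F: "frame M d F" "F 0 0 0 = m" "F 0 s 0 = a"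
    using ex_frame[of m a] in_M dist by auto
  have *: "\<exists>\<theta>. c = F 0 t \<theta> \<and> cos \<theta> = -1" if c: "c \<in> M" "d m c = t" "d a c = s + t" for c
  proof -
    obtain \<theta> where \<theta>: "c = F 0 t \<theta>" using frame_surj[OF F(1) c(1), of 0] F c by auto
    have "md (s + t) = md (s - t) + sn s * sn t * (1 - cos \<theta>)"
      using law[OF F(1), of 0 s 0 t \<theta>] c F \<theta> by simp
    \<comment> \<open>Equality in the triangle inequality: \<open>md (s + t)\<close> is the largest
      value that the law of cosines allows, attained only in the direction opposite to
      \<open>a\<close>.\<close>
    then have "sn s * sn t * (1 - cos \<theta> - 2) = 0"
      using md_add_minus_diff[of s t] by (simp add: algebra_simps)
    moreover have "sn s > 0" "sn t > 0" using st by (auto intro!: sn_pos)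
    ultimately show ?thesis using \<theta> by auto
  qed
  obtain \<theta> \<theta>' where 1: "b = F 0 t \<theta>" "cos \<theta> = -1" and 2: "b' = F 0 t \<theta>'" "cos \<theta>' = -1"
    using *[of b] *[of b'] in_M dist by auto
  have "sin \<theta> = 0" using 1 sin_cos_squared_add[of \<theta>] by simp
  then have "cos (\<theta> - \<theta>') = 1" using 1 2 by (simp add: cos_diff)
  then show ?thesis using frame_angle_eqI[OF F(1), of \<theta> \<theta>'] 1 2 by simp
qed

lemma geodesic_onD:
  assumes "geodesic_on M d J c" "t \<in> J"
  shows "\<exists>e>0. \<forall>u\<in>J. \<forall>v\<in>J. \<bar>u - t\<bar> < e \<longrightarrow> \<bar>v - t\<bar> < e \<longrightarrow> d (c u) (c v) = \<bar>u - v\<bar>"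
  using assms unfolding geodesic_on_def by blast

text \<open>Local agreement spreads along the interval by connectedness. The local step is that two
  points at which both curves agree determine them nearby, by
  \<open>extension_unique\<close>.\<close>

lemma geodesic_unique:
  assumes c1: "geodesic_on M d J c1" and c2: "geodesic_on M d J c2"
    and J: "is_interval J" "z1 \<in> J" "z2 \<in> J" "z1 \<noteq> z2"
    and t0: "t\<^sub>0 \<in> J" "0 < e" "\<And>u. u \<in> J \<Longrightarrow> \<bar>u - t\<^sub>0\<bar> < e \<Longrightarrow> c1 u = c2 u"
    and t: "t \<in> J"
  shows "c1 t = c2 t"
proof -
  define P where "P t \<longleftrightarrow> (\<exists>e>0. \<forall>u\<in>J. \<bar>u - t\<bar> < e \<longrightarrow> c1 u = c2 u)" for t
  have "P t"
  proof (rule connected_induction_simple[of J t\<^sub>0 t P])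
    show "connected J" using J(1) is_interval_connected by blast
    show "P t\<^sub>0" unfolding P_def using t0 by auto
    fix a assume a: "a \<in> J"
    obtain e1 where e1: "e1 > 0"
      "\<And>u v. u \<in> J \<Longrightarrow> v \<in> J \<Longrightarrow> \<bar>u - a\<bar> < e1 \<Longrightarrow> \<bar>v - a\<bar> < e1 \<Longrightarrow> d (c1 u) (c1 v) = \<bar>u - v\<bar>"
      using geodesic_onD[OF c1 a] by blast
    obtain e2 where e2: "e2 > 0"
      "\<And>u v. u \<in> J \<Longrightarrow> v \<in> J \<Longrightarrow> \<bar>u - a\<bar> < e2 \<Longrightarrow> \<bar>v - a\<bar> < e2 \<Longrightarrow> d (c2 u) (c2 v) = \<bar>u - v\<bar>"
      using geodesic_onD[OF c2 a] by blast
    note e = e1(1) e2(1)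
    \<comment> \<open>At most \<open>\<rho> / 2\<close>, so that any two parameters near
      \<open>a\<close> differ by at most \<open>\<rho>\<close>, as \<open>extension_unique\<close>
      requires.\<close>
    define \<epsilon> where "\<epsilon> = min (min e1 e2) (\<rho> / 2)"
    have \<epsilon>: "\<epsilon> > 0" "\<epsilon> \<le> e1" "\<epsilon> \<le> e2" "\<epsilon> \<le> \<rho> / 2" using e rho_pos by (auto simp: \<epsilon>_def)
    have inM: "c1 u \<in> M" "c2 u \<in> M" if "u \<in> J" for u
      using c1 c2 that by (auto simp: geodesic_on_def)
    show "\<exists>T. openin (top_of_set J) T \<and> a \<in> T \<and> (\<forall>x\<in>T. \<forall>y\<in>T. P x \<longrightarrow> P y)"
    proof (intro exI[of _ "J \<inter> ball a \<epsilon>"] conjI ballI impI)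
      fix x y assume x: "x \<in> J \<inter> ball a \<epsilon>" and y: "y \<in> J \<inter> ball a \<epsilon>" and Px: "P x"
      obtain \<delta> where \<delta>: "\<delta> > 0" "\<And>u. u \<in> J \<Longrightarrow> \<bar>u - x\<bar> < \<delta> \<Longrightarrow> c1 u = c2 u"
        using Px unfolding P_def by auto
      \<comment> \<open>A second point of \<open>J\<close> gives a direction in which to leave
        \<open>x\<close>, even if \<open>x\<close> is an end of \<open>J\<close>; convexity then
        yields \<open>x'\<close> in \<open>J\<close> as close to \<open>x\<close> as
        desired.\<close>
      obtain z where z: "z \<in> J" "z \<noteq> x" using J by metis
      define \<delta>' where "\<delta>' = min \<delta> (\<epsilon> - \<bar>x - a\<bar>)"
      have \<delta>': "\<delta>' > 0" using \<delta> x by (auto simp: \<delta>'_def dist_real_def abs_minus_commute)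
      define \<tau> where "\<tau> = min 1 (\<delta>' / (2 * \<bar>z - x\<bar>))"
      have \<tau>: "0 < \<tau>" "\<tau> \<le> 1" "\<tau> * \<bar>z - x\<bar> < \<delta>'"
        using \<delta>' z by (auto simp: \<tau>_def min_def field_simps)
      define x' where "x' = x + \<tau> * (z - x)"
      have x'J: "x' \<in> J"
        using convexD_alt[of J x z \<tau>] J(1) x z \<tau>
        by (simp add: is_interval_convex_1 x'_def algebra_simps)
      have "\<bar>x' - x\<bar> < \<delta>'" using \<tau> by (simp add: x'_def abs_mult)
      then have x': "\<bar>x' - x\<bar> < \<delta>" "\<bar>x' - a\<bar> < \<epsilon>" by (auto simp: \<delta>'_def)
      have "x' \<noteq> x" using \<tau> z by (simp add: x'_def)
      define x1 x2 where "x1 = min x x'" and "x2 = max x x'"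
      have x12: "x1 < x2" "x1 \<in> J" "x2 \<in> J" "\<bar>x1 - a\<bar> < \<epsilon>" "\<bar>x2 - a\<bar> < \<epsilon>" "\<bar>x1 - x\<bar> < \<delta>" "\<bar>x2 - x\<bar> < \<delta>"
        using \<open>x' \<noteq> x\<close> x x'J x' \<delta> by (auto simp: x1_def x2_def min_def max_def dist_real_def abs_minus_commute)
      have eq12: "c1 x1 = c2 x1" "c1 x2 = c2 x2" using \<delta> x12 by auto
      have *: "c1 u = c2 u" if u: "u \<in> J" "\<bar>u - a\<bar> < \<epsilon>" for u
      proof -
        have D: "d (c1 v) (c1 w) = \<bar>v - w\<bar>" "d (c2 v) (c2 w) = \<bar>v - w\<bar>"
          if "v \<in> {x1, x2, u}" "w \<in> {x1, x2, u}" for v w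
          using e1(2)[of v w] e2(2)[of v w] that u x12 \<epsilon> by auto
        \<comment> \<open>Outside the interval from \<open>x1\<close> to \<open>x2\<close> both
          curves extend the same segment; inside it, \<open>u\<close> is already close to
          \<open>x\<close>, where they agree by assumption.\<close>
        consider "u < x1" | "x1 \<le> u" "u \<le> x2" | "x2 < u" by linarith
        then show ?thesis
        proof cases
          case 1
          have "d (c1 x1) (c1 x2) = x2 - x1" "d (c1 x1) (c1 u) = x1 - u" "d (c1 x2) (c1 u) = x2 - u"
            "d (c2 x1) (c2 u) = x1 - u" "d (c2 x2) (c2 u) = x2 - u"
            using D[of x1 x2] D[of x1 u] D[of x2 u] 1 x12 by simp_all
          moreover have "x2 - u \<le> \<rho>" using u x12 \<epsilon> by linarith
          ultimately show ?thesis
            using extension_unique[of "c1 x2" "c1 x1" "c1 u" "c2 u" "x2 - x1" "x1 - u"] 1 u x12 inM eq12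
            by simp
        next
          case 2
          then have "\<bar>u - x\<bar> < \<delta>" using x12 by (auto simp: abs_if split: if_splits)
          then show ?thesis using \<delta> u by auto
        next
          case 3
          have "d (c1 x2) (c1 x1) = x2 - x1" "d (c1 x2) (c1 u) = u - x2" "d (c1 x1) (c1 u) = u - x1"
            "d (c2 x2) (c2 u) = u - x2" "d (c2 x1) (c2 u) = u - x1"
            using D[of x2 x1] D[of x2 u] D[of x1 u] 3 x12 by simp_all
          moreover have "u - x1 \<le> \<rho>" using u x12 \<epsilon> by linarith
          ultimately show ?thesis
            using extension_unique[of "c1 x1" "c1 x2" "c1 u" "c2 u" "x2 - x1" "u - x2"] 3 u x12 inM eq12
            by simp
        qed
      qed
      show "P y" unfolding P_def
      proof (intro exI[of _ "\<epsilon> - \<bar>y - a\<bar>"] conjI ballI impI)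
        show "0 < \<epsilon> - \<bar>y - a\<bar>" using y by (auto simp: dist_real_def abs_minus_commute)
        fix u assume "u \<in> J" "\<bar>u - y\<bar> < \<epsilon> - \<bar>y - a\<bar>"
        then show "c1 u = c2 u" by (intro *) auto
      qed
    qed (use a \<epsilon> in auto)
  qed (use t0 t in auto)
  then show ?thesis using t unfolding P_def by auto
qed

text \<open>One nearby point \<open>c k\<close> fixes the angle. The points before it are forced
  onto the same ray by their distance to \<open>c k\<close>, and everything else follows by
  uniqueness of geodesics.\<close>

lemma geodesic_eq_frame:
  assumes F: "frame M d F" and c: "geodesic_on M d J c"
    and J: "is_interval J" "0 < h" "{0..h} \<subseteq> J" and c0: "c 0 = F w 0 0"
  obtains \<theta> where "\<And>u. u \<in> J \<Longrightarrow> c u = F w u \<theta>"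
proof -
  have J0: "0 \<in> J" "h \<in> J" using J by auto
  then obtain e where e: "e > 0"
    "\<And>u v. u \<in> J \<Longrightarrow> v \<in> J \<Longrightarrow> \<bar>u\<bar> < e \<Longrightarrow> \<bar>v\<bar> < e \<Longrightarrow> d (c u) (c v) = \<bar>u - v\<bar>"
    using geodesic_onD[OF c J0(1)] by auto
  define k where "k = min (min (e / 2) h) \<rho>"
  have k: "0 < k" "k < e" "k \<le> h" "k \<le> \<rho>" using e J rho_pos by (auto simp: k_def)
  have inM: "c u \<in> M" if "u \<in> J" for u using c that by (auto simp: geodesic_on_def)
  have kJ: "u \<in> J" if "0 \<le> u" "u \<le> k" for u using J that k by auto
  have polar: "\<exists>\<theta>. c u = F w u \<theta>" if "0 \<le> u" "u \<le> k" for u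
    using frame_surj[OF F inM[OF kJ[OF that]], of w] e(2)[of 0 u] kJ[OF that] J0 k that c0 by auto
  then obtain \<theta> where \<theta>: "c k = F w k \<theta>" using k by (metis less_imp_le order_refl)
  have eq: "c u = F w u \<theta>" if u: "0 < u" "u < k" for u
  proof -
    obtain \<phi> where \<phi>: "c u = F w u \<phi>" using polar[of u] u by auto
    \<comment> \<open>The distance from \<open>c k\<close> to \<open>c u\<close> is already the
      radial one, so the angular term of the law must vanish.\<close>
    have "md (k - u) = md (k - u) + sn k * sn u * (1 - cos (\<theta> - \<phi>))"
      using e(2)[of k u] kJ[of u] kJ[of k] u k law[OF F, of w k \<theta> u \<phi>] \<theta> \<phi> by simp
    moreover have "sn k > 0" "sn u > 0" using u k by (auto intro!: sn_pos)
    ultimately show ?thesis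
      using frame_angle_eqI[OF F, of \<theta> \<phi> u w] \<phi> by auto
  qed
  \<comment> \<open>Agreement is known only for small positive parameters, so the neighbourhood is
    centred at \<open>k / 2\<close>; negative parameters are reached by uniqueness.\<close>
  have "c u = F w u \<theta>" if "u \<in> J" for u
    by (rule geodesic_unique[OF c geodesic_frame[OF F] J(1), of 0 h "k / 2" "k / 2"])
       (use J0 J k kJ[of "k / 2"] that eq in \<open>auto simp: abs_if split: if_splits\<close>)
  then show ?thesis using that by blast
qed

lemma complete_geodesic_frame:
  assumes c: "complete_geodesic M d c"
  obtains F where "frame M d F" "\<And>u. c u = F 0 u 0"
proof -
  obtain e where e: "e > 0"
    "\<And>u v. \<bar>u\<bar> < e \<Longrightarrow> \<bar>v\<bar> < e \<Longrightarrow> d (c u) (c v) = \<bar>u - v\<bar>"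
    using geodesic_onD[OF c, of 0] by auto
  define k where "k = min (e / 2) \<rho>"
  have k: "0 < k" "k < e" "k \<le> \<rho>" using e rho_pos by (auto simp: k_def)
  have inM: "c u \<in> M" for u using c by (auto simp: geodesic_on_def)
  have dk: "d (c 0) (c k) = k" using e(2)[of 0 k] k by auto
  obtain F where F: "frame M d F" "F 0 0 0 = c 0" "F 0 k 0 = c k"
    using ex_frame[of "c 0" "c k"] inM dk k mdist_zero[of "c k"] by (metis less_irrefl)
  obtain \<theta> where \<theta>: "\<And>u. c u = F 0 u \<theta>"
    by (rule geodesic_eq_frame[OF F(1) c, of 1 0]) (use F in auto)
  have "md 0 = md 0 + sn k * sn k * (1 - cos (\<theta> - 0))"
    using law[OF F(1), of 0 k \<theta> k 0] \<theta>[of k] F inM by simp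
  moreover have "sn k > 0" using k by (auto intro!: sn_pos)
  ultimately have "cos (\<theta> - 0) = 1" by auto
  then have "c u = F 0 u 0" for u using \<theta> frame_angle_eqI[OF F(1), of \<theta> 0 u 0] by simp
  then show ?thesis using F that by blast
qed

text \<open>The perpendicular to the equator \<open>F 0 _ 0\<close> at \<open>F 0 a 0\<close> is the set of points equidistant from any
  two points of the equator that are symmetric about \<open>F 0 a 0\<close>.\<close>

definition perpendicular :: "(real \<Rightarrow> real \<Rightarrow> real \<Rightarrow> 'a) \<Rightarrow> real \<Rightarrow> 'a set" where
  "perpendicular F a = {q \<in> M. \<forall>h. md (d q (F 0 (a + h) 0)) = md (d q (F 0 (a - h) 0))}"

section \<open>Perpendiculars and grating lines\<close>

context
  fixes F assumes F: "frame M d F"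
begin

text \<open>The two \<open>md\<close> values differ by \<open>2 * sn h\<close> times a quantity free
  of \<open>h\<close>, so a single \<open>h\<close> with \<open>sn h \<noteq> 0\<close> decides;
  \<open>\<rho>\<close> is one. Divided by cosines the relation is
  \<open>tn (a - b) = tn v * cos \<phi>\<close>, the law of a right-angled triangle.\<close>

lemma in_perpendicular_iff:
  "F b v \<phi> \<in> perpendicular F a \<longleftrightarrow> sn (a - b) * cs v = sn v * cs (a - b) * cos \<phi>"
proof -
  have *: "md (d (F b v \<phi>) (F 0 (a + h) 0)) = md (d (F b v \<phi>) (F 0 (a - h) 0)) \<longleftrightarrow>
      sn h * (sn (a - b) * cs v - sn v * cs (a - b) * cos \<phi>) = 0" for h
  proof -
    have F1: "F 0 (a + h) 0 = F b (a - b + h) 0" "F 0 (a - h) 0 = F b (a - b - h) 0"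
      using frame_shift[OF F, of b "a - b + h"] frame_shift[OF F, of b "a - b - h"] by simp_all
    have "md (d (F b v \<phi>) (F 0 (a + h) 0)) - md (d (F b v \<phi>) (F 0 (a - h) 0))
       = md (v - (a - b) - h) - md (v - (a - b) + h)
         + sn v * (sn (a - b + h) - sn (a - b - h)) * (1 - cos \<phi>)"
      unfolding F1 law[OF F] by (simp add: algebra_simps)
    also have "md (v - (a - b) - h) - md (v - (a - b) + h) = - (2 * sn (v - (a - b)) * sn h)"
      using md_add_minus_diff[of "v - (a - b)" h] by simp
    also have "sn (a - b + h) - sn (a - b - h) = 2 * cs (a - b) * sn h"
      by (simp add: sn_add[of "a - b" h] sn_diff[of "a - b" h])
    also have "sn (v - (a - b)) = sn v * cs (a - b) - cs v * sn (a - b)" by (rule sn_diff)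
    finally have "md (d (F b v \<phi>) (F 0 (a + h) 0)) - md (d (F b v \<phi>) (F 0 (a - h) 0))
      = 2 * (sn h * (sn (a - b) * cs v - sn v * cs (a - b) * cos \<phi>))"
      by (simp add: algebra_simps)
    then show ?thesis by auto
  qed
  have "sn \<rho> \<noteq> 0" using sn_pos[of \<rho>] rho_pos by auto
  then show ?thesis unfolding perpendicular_def using * frame_in[OF F] by auto
qed

text \<open>On the sphere a perpendicular meets the equator at antipodal points, so its foot is not
  unique. Any two feet satisfy \<open>sn (a - a') = 0\<close>, and in coordinates about
  \<open>a'\<close> both relations then reduce to \<open>sn v * cos \<phi> = 0\<close>.\<close>

lemma perpendicular_eq:
  assumes "F 0 a' 0 \<in> perpendicular F a" shows "perpendicular F a = perpendicular F a'"
proof -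
  have "F a (a' - a) 0 \<in> perpendicular F a" using assms frame_shift[OF F, of a "a' - a"] by simp
  then have "sn (a' - a) * cs 0 = 0" unfolding in_perpendicular_iff by simp
  then have s: "sn (a - a') = 0" using sn_minus[of "a' - a"] by simp
  then have c: "cs (a - a') \<noteq> 0" using cs_sq[of "a - a'"] by auto
  have "q \<in> perpendicular F a \<longleftrightarrow> q \<in> perpendicular F a'" if qM: "q \<in> M" for q
  proof -
    obtain v \<phi> where q: "q = F a' v \<phi>" using frame_surj[OF F qM, of a'] by blast
    show ?thesis unfolding q in_perpendicular_iff using s c by auto
  qed
  then show ?thesis unfolding perpendicular_def by blast
qed

text \<open>On the diagonal \<open>s = t = x\<close> the comparison triangle is isosceles with base
  \<open>D x\<close>, and a right comparison angle means
  \<open>(D x)^2 / x^2 \<longlongrightarrow> 2\<close>. The law gives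
  \<open>md (D x) = (sn x)^2 * (1 - cos \<theta>)\<close>, hence the limit
  \<open>2 * (1 - cos \<theta>)\<close>; comparing the two yields the claim.\<close>

lemma right_angle:
  assumes "has_angle d (\<lambda>u. F w u \<theta>) (\<lambda>u. F w u 0) (pi / 2)" shows "cos \<theta> = 0"
proof -
  define D where "D x = d (F w x \<theta>) (F w x 0)" for x
  have mdD: "md (D x) = (sn x)\<^sup>2 * (1 - cos \<theta>)" for x
    using law[OF F, of w x \<theta> x 0] by (simp add: D_def power2_eq_square)
  have ev: "\<forall>\<^sub>F x in at_right 0. 0 < x \<and> x < \<rho> / 2"
    using eventually_at_right_field[of "\<lambda>x. 0 < x \<and> x < \<rho> / 2" 0] rho_pos
    by (auto intro!: exI[of _ "\<rho> / 2"])
  have D: "0 \<le> D x" "D x \<le> 2 * x" if "0 < x" "x < \<rho> / 2" for x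
    using triangle[of "F w x \<theta>" "F w 0 0" "F w x 0"] frame_radius[OF F, of x w 0] that
      frame_in[OF F] commute[of "F w x \<theta>"] by (auto simp: D_def)
  have diagonal: "filterlim (\<lambda>x::real. (x, x)) (at_right 0 \<times>\<^sub>F at_right 0) (at_right 0)"
    by (intro filterlim_Pair filterlim_ident)
  have "((\<lambda>(s, t). comparison_angle d (F w 0 \<theta>) (F w s \<theta>) (F w t 0)) \<longlongrightarrow> pi / 2)
      (at_right 0 \<times>\<^sub>F at_right 0)"
    using assms unfolding has_angle_def by (rule conjunct2)
  then have "((\<lambda>x. comparison_angle d (F w 0 \<theta>) (F w x \<theta>) (F w x 0)) \<longlongrightarrow> pi / 2) (at_right 0)"
    using filterlim_compose[OF _ diagonal] by force
  then have "((\<lambda>x. cos (comparison_angle d (F w 0 \<theta>) (F w x \<theta>) (F w x 0))) \<longlongrightarrow> cos (pi / 2)) (at_right 0)"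
    by (rule tendsto_cos)
  moreover have "\<forall>\<^sub>F x in at_right 0. cos (comparison_angle d (F w 0 \<theta>) (F w x \<theta>) (F w x 0))
      = 1 - (D x)\<^sup>2 / x\<^sup>2 / 2"
    using ev
  proof eventually_elim
    case (elim x)
    have r: "d (F w 0 \<theta>) (F w x \<theta>) = x" "d (F w 0 \<theta>) (F w x 0) = x"
      using elim frame_radius[OF F, of x] by auto
    \<comment> \<open>Puts the argument of \<open>arccos\<close> into \<open>[-1, 1]\<close>, so
      that \<open>cos\<close> undoes it.\<close>
    have "(D x)\<^sup>2 \<le> (2 * x)\<^sup>2" using D[of x] elim by (intro power_mono) auto
    then have "(D x)\<^sup>2 / x\<^sup>2 \<le> 4" using elim by (simp add: field_simps)
    moreover have "(x\<^sup>2 + x\<^sup>2 - (D x)\<^sup>2) / (2 * x * x) = 1 - (D x)\<^sup>2 / x\<^sup>2 / 2"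
      using elim by (simp add: field_simps power2_eq_square)
    moreover have "0 \<le> (D x)\<^sup>2 / x\<^sup>2" by simp
    ultimately show ?case unfolding comparison_angle_def r D_def[symmetric]
      by (simp add: cos_arccos)
  qed
  ultimately have "((\<lambda>x. 1 - (D x)\<^sup>2 / x\<^sup>2 / 2) \<longlongrightarrow> 0) (at_right 0)"
    by (simp add: tendsto_cong)
  then have "((\<lambda>x. 2 * (1 - (1 - (D x)\<^sup>2 / x\<^sup>2 / 2))) \<longlongrightarrow> 2 * (1 - 0)) (at_right 0)"
    by (intro tendsto_intros)
  then have lim: "((\<lambda>x. (D x)\<^sup>2 / x\<^sup>2) \<longlongrightarrow> 2) (at_right 0)" by simp
  \<comment> \<open>\<open>md_lim\<close> is a limit at a punctured neighbourhood of 0, so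
    \<open>D x\<close> must avoid 0. If \<open>cos \<theta> = 1\<close>, then \<open>D\<close> would
    vanish identically, against the limit 2.\<close>
  have Dnz: "\<forall>\<^sub>F x in at_right 0. D x \<noteq> 0"
  proof (cases "cos \<theta> = 1")
    case True
    then have "D x = 0" for x
      using md_dist_0[of "F w x \<theta>" "F w x 0"] mdD[of x] frame_in[OF F] by (simp add: D_def)
    then have "((\<lambda>x::real. 0) \<longlongrightarrow> (2::real)) (at_right (0::real))" using lim by simp
    then have False by (simp add: tendsto_const_iff)
    then show ?thesis ..
  next
    case False
    show ?thesis using ev
    proof eventually_elim
      case (elim x)
      then have "sn x > 0" using rho_pos by (intro sn_pos) auto
      then have "md (D x) \<noteq> 0" using False by (simp add: mdD)
      then show ?case by auto
    qed
  qed
  have "(D \<longlongrightarrow> 0) (at_right 0)"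
  proof (rule tendsto_sandwich[of "\<lambda>_. 0" _ _ "\<lambda>x. 2 * x"])
    show "((\<lambda>x::real. 2 * x) \<longlongrightarrow> 0) (at_right 0)" by (auto intro!: tendsto_eq_intros)
  qed (use ev D in \<open>auto elim!: eventually_mono\<close>)
  then have "filterlim D (at 0) (at_right 0)" using Dnz by (simp add: filterlim_at)
  then have "((\<lambda>x. md (D x) / (D x)\<^sup>2) \<longlongrightarrow> 1 / 2) (at_right 0)"
    by (rule filterlim_compose[OF md_lim])
  then have "((\<lambda>x. md (D x) / (D x)\<^sup>2 * ((D x)\<^sup>2 / x\<^sup>2)) \<longlongrightarrow> 1 / 2 * 2) (at_right 0)"
    by (rule tendsto_mult[OF _ lim])
  moreover have "\<forall>\<^sub>F x in at_right 0. md (D x) / (D x)\<^sup>2 * ((D x)\<^sup>2 / x\<^sup>2) = (sn x / x)\<^sup>2 * (1 - cos \<theta>)"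
    using Dnz by eventually_elim (simp add: mdD power_divide)
  ultimately have "((\<lambda>x. (sn x / x)\<^sup>2 * (1 - cos \<theta>)) \<longlongrightarrow> 1) (at_right 0)"
    by (simp add: tendsto_cong)
  moreover have "((\<lambda>x. sn x / x) \<longlongrightarrow> 1) (at_right 0)"
    by (rule filterlim_mono[OF sn_lim order_refl at_le]) simp
  then have "((\<lambda>x. (sn x / x)\<^sup>2 * (1 - cos \<theta>)) \<longlongrightarrow> 1\<^sup>2 * (1 - cos \<theta>)) (at_right 0)"
    by (intro tendsto_mult tendsto_power tendsto_const)
  ultimately have "1 = 1\<^sup>2 * (1 - cos \<theta>)"
    by (intro tendsto_unique[OF trivial_limit_at_right_real])
  then show ?thesis by simp
qed

lemma grating_line_perpendicular:
  assumes "grating_line M d (\<lambda>u. F 0 u 0) l"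
  obtains a where "l = perpendicular F a"
proof -
  obtain c s t where c: "complete_geodesic M d c" and l: "l = range c"
    and ang: "has_angle d (\<lambda>u. c (s + u)) (\<lambda>u. F 0 (t + u) 0) (pi / 2)"
    using assms unfolding grating_line_def meets_orthogonally_def by blast
  have c': "complete_geodesic M d (\<lambda>u. c (s + u))"
    unfolding geodesic_on_def
  proof (intro conjI ballI)
    show "range (\<lambda>u. c (s + u)) \<subseteq> M" using c by (auto simp: geodesic_on_def)
    fix t :: real
    obtain e where "e > 0" and e: "\<And>u v. \<bar>u - (s + t)\<bar> < e \<Longrightarrow> \<bar>v - (s + t)\<bar> < e \<Longrightarrow> d (c u) (c v) = \<bar>u - v\<bar>"
      using geodesic_onD[OF c, of "s + t"] by auto
    then show "\<exists>e>0. \<forall>u\<in>UNIV. \<forall>v\<in>UNIV. \<bar>u - t\<bar> < e \<longrightarrow> \<bar>v - t\<bar> < e \<longrightarrow> d (c (s + u)) (c (s + v)) = \<bar>u - v\<bar>"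
      using e[of "s + _" "s + _"] by (intro exI[of _ e]) auto
  qed
  have "c (s + 0) = F t 0 0" using ang frame_shift[OF F, of t 0] by (simp add: has_angle_def)
  then obtain \<theta> where \<theta>: "\<And>u. c (s + u) = F t u \<theta>"
    using geodesic_eq_frame[OF F c', of 1 t] by auto
  have cos0: "cos \<theta> = 0"
    by (rule right_angle[of t]) (use ang \<theta> frame_shift[OF F, of t] in simp)
  have "c y \<in> range (\<lambda>u. F t u \<theta>)" for y
    using \<theta>[of "y - s"] by auto
  then have "range c = range (\<lambda>u. F t u \<theta>)"
    using \<theta> by (metis (no_types, lifting) image_subsetI rangeI subset_antisym)
  also have "\<dots> = perpendicular F t"
  proof (intro equalityI subsetI)
    fix q assume "q \<in> range (\<lambda>u. F t u \<theta>)"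
    then obtain u where "q = F t u \<theta>" by auto
    then show "q \<in> perpendicular F t" using cos0 by (simp add: in_perpendicular_iff)
  next
    fix q assume q: "q \<in> perpendicular F t"
    then have "q \<in> M" by (simp add: perpendicular_def)
    then obtain v \<phi> where v: "q = F t v \<phi>" using frame_surj[OF F, of q t] by blast
    \<comment> \<open>With the pole of the coordinates at the foot, the term
      \<open>sn (a - b)\<close> disappears and only the pole, its antipode and the right angles
      remain.\<close>
    then have "sn v = 0 \<or> cos \<phi> = 0" using q by (simp add: in_perpendicular_iff)
    then show "q \<in> range (\<lambda>u. F t u \<theta>)"
    proof
      assume "sn v = 0" then show ?thesis using v frame_angle_eqI[OF F, of \<phi> \<theta> v t] by auto
    next
      assume "cos \<phi> = 0"
      then have "(sin \<phi>)\<^sup>2 = 1" "(sin \<theta>)\<^sup>2 = 1"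
        using cos0 sin_cos_squared_add[of \<phi>] sin_cos_squared_add[of \<theta>] by auto
      then have "cos (\<theta> - \<phi>) = 1 \<or> cos (\<theta> - \<phi>) = -1" using cos0
        by (auto simp: cos_diff power2_eq_1_iff)
      then show ?thesis
      proof
        assume "cos (\<theta> - \<phi>) = 1"
        then show ?thesis using v frame_angle_eqI[OF F, of \<theta> \<phi> v t] by (metis rangeI)
      next
        assume "cos (\<theta> - \<phi>) = -1"
        then show ?thesis using v frame_opposite[OF F, of \<theta> \<phi> t v] by (metis rangeI)
      qed
    qed
  qed
  finally show ?thesis using l that by blast
qed

text \<open>With the pole at the midpoint, crossing at parameter \<open>u\<close> reads
  \<open>tn (a - b) = tn u * cos \<theta>\<close>. Monotonicity of the tangent bounds the right-hand
  side for \<open>\<bar>u\<bar> \<le> L\<close>, and the intermediate value theorem shows that every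
  value within the bound is taken.\<close>

lemma needle_crosses_iff:
  assumes "0 < L" "L \<le> \<rho>"
  shows "(\<exists>u\<in>{-L..L}. F b u \<theta> \<in> perpendicular F a) \<longleftrightarrow>
     crosses L (a - b) (cos \<theta>)"
proof
  assume "\<exists>u\<in>{-L..L}. F b u \<theta> \<in> perpendicular F a"
  then obtain u where u: "\<bar>u\<bar> \<le> L" "sn (a - b) * cs u = sn u * cs (a - b) * cos \<theta>"
    unfolding in_perpendicular_iff by (metis abs_le_iff atLeastAtMost_iff minus_le_iff)
  have pos: "cs u > 0" "cs L > 0" using assms u by (auto intro!: cs_pos)
  have "\<bar>sn (a - b)\<bar> * cs u = \<bar>sn u\<bar> * \<bar>cs (a - b)\<bar> * \<bar>cos \<theta>\<bar>"
    using arg_cong[OF u(2), of abs] pos by (simp add: abs_mult)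
  then have "\<bar>sn (a - b)\<bar> * cs L * cs u = (\<bar>sn u\<bar> * cs L) * (\<bar>cs (a - b)\<bar> * \<bar>cos \<theta>\<bar>)"
    by (simp add: mult_ac)
  also have "\<dots> \<le> (sn L * cs u) * (\<bar>cs (a - b)\<bar> * \<bar>cos \<theta>\<bar>)"
    using tan_abs_le[OF u(1) assms(2)] by (intro mult_right_mono) auto
  finally have "\<bar>sn (a - b)\<bar> * cs L * cs u \<le> sn L * \<bar>cs (a - b)\<bar> * \<bar>cos \<theta>\<bar> * cs u"
    by (simp add: mult_ac)
  then show "crosses L (a - b) (cos \<theta>)"
    using pos by simp
next
  assume le: "crosses L (a - b) (cos \<theta>)"
  define f where "f u = sn u * (cs (a - b) * cos \<theta>) - sn (a - b) * cs u" for u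
  have pos: "sn L > 0" "cs L > 0" using assms by (auto intro!: sn_pos cs_pos)
  have cont: "continuous_on S f" for S
    unfolding f_def
    by (intro continuous_intros continuous_on_subset[OF continuous_sn] continuous_on_subset[OF continuous_cs]) auto
  have le': "\<bar>sn (a - b) * cs L\<bar> \<le> \<bar>sn L * (cs (a - b) * cos \<theta>)\<bar>"
    using le pos by (simp add: abs_mult mult_ac)
  have "\<exists>u\<in>{-L..L}. f u = 0"
  proof (cases "sn L * (cs (a - b) * cos \<theta>) \<ge> 0")
    case True
    then have "f (- L) \<le> 0" "0 \<le> f L" using le' by (auto simp: f_def)
    then show ?thesis using IVT'[of f "- L" 0 L] cont assms by auto
  next
    case False
    then have "f L \<le> 0" "0 \<le> f (- L)" using le' by (auto simp: f_def)
    then show ?thesis using IVT2'[of f L 0 "- L"] cont assms by auto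
  qed
  then obtain u where "u \<in> {-L..L}" "f u = 0" by blast
  then show "\<exists>u\<in>{-L..L}. F b u \<theta> \<in> perpendicular F a"
    by (intro bexI[of _ u]) (simp_all add: in_perpendicular_iff f_def mult.assoc)
qed

text \<open>The curve is parametrized from its midpoint, so \<open>geodesic_eq_frame\<close>
  determines the half behind the midpoint together with the half ending in the tip.\<close>

lemma needle_frame:
  assumes "0 < L" "L \<le> \<rho>"
  shows "needle M d L (F 0 b 0) q N \<longleftrightarrow>
    (\<exists>\<theta>. q = F b L \<theta> \<and> N = (\<lambda>u. F b u \<theta>) ` {-L..L})"
proof
  assume "needle M d L (F 0 b 0) q N"
  then obtain c where c: "geodesic_on M d {-L..L} c" "c 0 = F b 0 0" "c L = q" "N = c ` {-L..L}"
    unfolding needle_def frame_center[OF F] by blast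
  obtain \<theta> where "\<And>u. u \<in> {-L..L} \<Longrightarrow> c u = F b u \<theta>"
    by (rule geodesic_eq_frame[OF F c(1), of L b])
       (use assms c is_interval_cc[of "-L" L] in auto)
  then show "\<exists>\<theta>. q = F b L \<theta> \<and> N = (\<lambda>u. F b u \<theta>) ` {-L..L}"
    using c assms by (intro exI[of _ \<theta>]) auto
next
  assume "\<exists>\<theta>. q = F b L \<theta> \<and> N = (\<lambda>u. F b u \<theta>) ` {-L..L}"
  then obtain \<theta> where \<theta>: "q = F b L \<theta>" "N = (\<lambda>u. F b u \<theta>) ` {-L..L}" by blast
  then show "needle M d L (F 0 b 0) q N" unfolding needle_def
    by (intro exI[of _ "\<lambda>u. F b u \<theta>"]) (auto simp: geodesic_frame[OF F] frame_center[OF F, of b \<theta>])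
qed

lemma needle_hits_grating_iff:
  assumes L: "0 < L" "L \<le> \<rho>"
    and G: "grating M d (\<lambda>u. F 0 u 0) L G" and t0: "F 0 t\<^sub>0 0 \<in> \<Union>G"
  shows "(\<exists>N. needle M d L (F 0 (t\<^sub>0 + z) 0) q N \<and> (\<exists>l\<in>G. N \<inter> l \<noteq> {})) \<longleftrightarrow>
    (\<exists>\<theta>. q = F (t\<^sub>0 + z) L \<theta> \<and> (\<exists>m::int. crosses L (2 * of_int m * L - z) (cos \<theta>)))"
proof -
  have pts: "\<Union>G \<inter> range (\<lambda>u. F 0 u 0) = {F 0 (t\<^sub>0 + 2 * of_int m * L) 0 | m :: int. True}"
    using G t0 by (simp add: grating_def)
  \<comment> \<open>\<open>grating\<close> prescribes only where the union of the lines meets the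
    equator. Since a perpendicular is determined by any of its points on the equator,
    \<open>G\<close> itself can be recovered from this.\<close>
  have line: "\<exists>m::int. l = perpendicular F (t\<^sub>0 + 2 * of_int m * L)" if "l \<in> G" for l
  proof -
    have "grating_line M d (\<lambda>u. F 0 u 0) l" using G that by (simp add: grating_def)
    then obtain a where a: "l = perpendicular F a" by (rule grating_line_perpendicular)
    have "F a 0 0 \<in> l" unfolding a in_perpendicular_iff by simp
    then have la: "F 0 a 0 \<in> l" by (simp add: frame_center[OF F])
    then have "F 0 a 0 \<in> \<Union>G \<inter> range (\<lambda>u. F 0 u 0)" using that by auto
    then obtain m :: int where "F 0 a 0 = F 0 (t\<^sub>0 + 2 * of_int m * L) 0" using pts by auto
    \<comment> \<open>Only the points coincide, not the parameters \<open>a\<close> and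
      \<open>t\<^sub>0 + 2 * of_int m * L\<close>, because an equator may close up;
      \<open>perpendicular_eq\<close> absorbs the difference.\<close>
    then show ?thesis using la perpendicular_eq a by metis
  qed
  have line': "perpendicular F (t\<^sub>0 + 2 * of_int m * L) \<in> G" for m :: int
  proof -
    have "F 0 (t\<^sub>0 + 2 * of_int m * L) 0 \<in> \<Union>G" using pts by blast
    then obtain l where l: "l \<in> G" "F 0 (t\<^sub>0 + 2 * of_int m * L) 0 \<in> l" by auto
    then obtain a where "l = perpendicular F a" using line by blast
    then show ?thesis using l perpendicular_eq by metis
  qed
  have G_eq: "G = range (\<lambda>m::int. perpendicular F (t\<^sub>0 + 2 * of_int m * L))"
    using line line' by blast
  have cross: "(\<exists>u\<in>{-L..L}. F (t\<^sub>0 + z) u \<theta> \<in> perpendicular F (t\<^sub>0 + 2 * of_int m * L)) \<longleftrightarrow>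
      crosses L (2 * of_int m * L - z) (cos \<theta>)" for \<theta> and m :: int
    using needle_crosses_iff[OF L, of "t\<^sub>0 + z" \<theta> "t\<^sub>0 + 2 * of_int m * L"] by simp
  show ?thesis
    unfolding needle_frame[OF L] G_eq cross[symmetric] by blast
qed

end

end

section \<open>Arc length\<close>

text \<open>Since \<open>md x\<close> behaves like \<open>x^2 / 2\<close>, quadratic asymptotics of
  \<open>md\<close> of a distance become linear asymptotics of the distance. This yields the speed
  of curves given by a formula for \<open>md\<close>.\<close>

lemma (in trig) md_asymptotics:
  assumes f: "(f \<longlongrightarrow> 0) \<F>" and lim: "((\<lambda>y. md (f y) / (g y)\<^sup>2) \<longlongrightarrow> a\<^sup>2 / 2) \<F>" and a: "0 \<le> a"
  shows "((\<lambda>y. \<bar>f y\<bar> / \<bar>g y\<bar>) \<longlongrightarrow> a) \<F>"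
proof -
  \<comment> \<open>The quotient \<open>md x / x^2\<close> extended continuously to 0, so that
    points with \<open>f y = 0\<close> are covered.\<close>
  define \<mu> where "\<mu> x = (if x = 0 then 1 / 2 else md x / x\<^sup>2)" for x
  have "isCont \<mu> 0"
  proof -
    have "((\<lambda>x. md x / x\<^sup>2) \<longlongrightarrow> \<mu> 0) (at 0)" using md_lim by (simp add: \<mu>_def)
    then show ?thesis unfolding isCont_def
      by (rule Lim_transform_eventually) (auto simp: \<mu>_def eventually_at intro!: exI[of _ 1])
  qed
  from isCont_tendsto_compose[OF this f] have "((\<lambda>y. \<mu> (f y)) \<longlongrightarrow> 1 / 2) \<F>" by (simp add: \<mu>_def)
  from tendsto_divide[OF lim this] have "((\<lambda>y. md (f y) / (g y)\<^sup>2 / \<mu> (f y)) \<longlongrightarrow> a\<^sup>2) \<F>" by simp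
  moreover have pos: "\<forall>\<^sub>F y in \<F>. \<mu> (f y) > 0"
    using order_tendstoD(1)[OF \<open>((\<lambda>y. \<mu> (f y)) \<longlongrightarrow> 1 / 2) \<F>\<close>, of 0] by simp
  then have "\<forall>\<^sub>F y in \<F>. md (f y) / (g y)\<^sup>2 / \<mu> (f y) = (\<bar>f y\<bar> / \<bar>g y\<bar>)\<^sup>2"
  proof eventually_elim
    case (elim y)
    have "md (f y) = \<mu> (f y) * (f y)\<^sup>2" by (simp add: \<mu>_def)
    then show ?case using elim by (simp add: power_divide)
  qed
  ultimately have "((\<lambda>y. (\<bar>f y\<bar> / \<bar>g y\<bar>)\<^sup>2) \<longlongrightarrow> a\<^sup>2) \<F>" by (simp add: tendsto_cong)
  then have "((\<lambda>y. sqrt ((\<bar>f y\<bar> / \<bar>g y\<bar>)\<^sup>2)) \<longlongrightarrow> sqrt (a\<^sup>2)) \<F>" by (rule tendsto_real_sqrt)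
  then show ?thesis using a by simp
qed

section \<open>Lebesgue measure of periodic sets\<close>

lemma periodic_int:
  fixes l :: real
  assumes "\<And>x. x + l \<in> B \<longleftrightarrow> x \<in> B" shows "x + of_int m * l \<in> B \<longleftrightarrow> x \<in> B"
proof (induction m rule: int_induct[of _ 0])
  case (step1 i)
  then show ?case using assms[of "x + of_int i * l"] by (simp add: algebra_simps)
next
  case (step2 i)
  then show ?case using assms[of "x + of_int (i - 1) * l"] by (simp add: algebra_simps)
qed simp

lemma emeasure_lborel_translate:
  fixes c :: real
  assumes "X \<in> sets borel" shows "emeasure lborel {x. c + x \<in> X} = emeasure lborel X"
proof -
  have "emeasure lborel X = emeasure (distr lborel borel ((+) c)) X" by (simp add: lborel_distr_plus)
  also have "\<dots> = emeasure lborel {x. c + x \<in> X}" using assms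
    by (subst emeasure_distr) (auto intro!: arg_cong[where f = "emeasure lborel"])
  finally show ?thesis ..
qed

text \<open>Rotation invariance of the circle, stated on the line: whole periods reduce the shift to
  some \<open>b\<close> with \<open>0 \<le> b < l\<close>, and the part of the window beyond
  \<open>l\<close> is moved back to \<open>{0..<b}\<close>.\<close>

lemma emeasure_lborel_periodic:
  fixes l a :: real
  assumes B: "B \<in> sets borel" and l: "0 < l" and per: "\<And>x. x + l \<in> B \<longleftrightarrow> x \<in> B"
  shows "emeasure lborel {x\<in>{0..l}. a + x \<in> B} = emeasure lborel (B \<inter> {0..l})"
proof -
  have [measurable]: "B \<in> sets borel" by fact
  define m where "m = \<lfloor>a / l\<rfloor>"
  define b where "b = a - of_int m * l"
  have "of_int m \<le> a / l" "a / l < of_int m + 1" unfolding m_def by linarith+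
  then have b: "0 \<le> b" "b < l" using l by (auto simp: b_def field_simps)
  \<comment> \<open>Half-open windows can be cut and reassembled without overlap; the closed end is
    a null set.\<close>
  have half_open: "emeasure lborel (X \<inter> {0..l}) = emeasure lborel (X \<inter> {0..<l})" if "X \<in> sets borel" for X
  proof (rule emeasure_eq_AE)
    show "AE x in lborel. (x \<in> X \<inter> {0..l}) = (x \<in> X \<inter> {0..<l})"
      using AE_lborel_singleton[of l] by eventually_elim auto
  qed (use that in auto)
  have shift: "emeasure lborel (B \<inter> {u..<v}) = emeasure lborel (B \<inter> {u + of_int k * l..<v + of_int k * l})"
    for u v and k :: int
  proof -
    have "emeasure lborel (B \<inter> {u + of_int k * l..<v + of_int k * l})
       = emeasure lborel {x. of_int k * l + x \<in> B \<inter> {u + of_int k * l..<v + of_int k * l}}"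
      by (rule emeasure_lborel_translate[symmetric]) auto
    also have "{x. of_int k * l + x \<in> B \<inter> {u + of_int k * l..<v + of_int k * l}} = B \<inter> {u..<v}"
      using periodic_int[OF per, of _ k] by (auto simp: add.commute)
    finally show ?thesis ..
  qed
  have ab: "a = b + of_int m * l" by (simp add: b_def)
  have "{x\<in>{0..l}. a + x \<in> B} = {x. a + x \<in> B} \<inter> {0..l}" by auto
  also have "emeasure lborel \<dots> = emeasure lborel ({x. a + x \<in> B} \<inter> {0..<l})"
    by (rule half_open) measurable
  also have "{x. a + x \<in> B} \<inter> {0..<l} = {x. a + x \<in> B \<inter> {a..<a + l}}" by auto
  also have "emeasure lborel \<dots> = emeasure lborel (B \<inter> {a..<a + l})"
    by (rule emeasure_lborel_translate) auto
  also have "B \<inter> {a..<a + l} = B \<inter> {b + of_int m * l..<b + l + of_int m * l}" by (simp add: ab algebra_simps)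
  also have "emeasure lborel \<dots> = emeasure lborel (B \<inter> {b..<b + l})" by (rule shift[symmetric])
  also have "B \<inter> {b..<b + l} = B \<inter> {b..<l} \<union> B \<inter> {l..<b + l}" using b by auto
  also have "emeasure lborel \<dots> = emeasure lborel (B \<inter> {b..<l}) + emeasure lborel (B \<inter> {l..<b + l})"
    by (rule plus_emeasure[symmetric]) auto
  also have "emeasure lborel (B \<inter> {l..<b + l}) = emeasure lborel (B \<inter> {0..<b})"
    using shift[of 0 b 1] by simp
  also have "emeasure lborel (B \<inter> {b..<l}) + emeasure lborel (B \<inter> {0..<b})
     = emeasure lborel (B \<inter> {b..<l} \<union> B \<inter> {0..<b})"
    by (rule plus_emeasure) auto
  also have "B \<inter> {b..<l} \<union> B \<inter> {0..<b} = B \<inter> {0..<l}" using b by auto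
  also have "emeasure lborel \<dots> = emeasure lborel (B \<inter> {0..l})" by (rule half_open[symmetric]) simp
  finally show ?thesis .
qed

lemma emeasure_lborel_periodic_reflect:
  fixes l a :: real
  assumes B: "B \<in> sets borel" and l: "0 < l" and per: "\<And>x. x + l \<in> B \<longleftrightarrow> x \<in> B"
  shows "emeasure lborel {x\<in>{0..l}. a - x \<in> B} = emeasure lborel (B \<inter> {0..l})"
proof -
  have [measurable]: "B \<in> sets borel" by fact
  have "emeasure lborel {x\<in>{0..l}. a - x \<in> B} = emeasure (distr lborel borel (\<lambda>x. - x)) {x\<in>{0..l}. a - x \<in> B}"
    by (simp add: lborel_distr_uminus)
  also have "\<dots> = emeasure lborel {x. - x \<in> {0..l} \<and> a + x \<in> B}"
    by (subst emeasure_distr) (auto intro!: arg_cong[where f = "emeasure lborel"])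
  \<comment> \<open>Reflection turns the window into \<open>{-l..0}\<close>; one period brings it
    back and changes \<open>a\<close> into \<open>a - l\<close>.\<close>
  also have "\<dots> = emeasure lborel {x. (- l) + x \<in> {x. - x \<in> {0..l} \<and> a + x \<in> B}}"
    by (rule emeasure_lborel_translate[symmetric]) simp
  also have "{x. (- l) + x \<in> {x. - x \<in> {0..l} \<and> a + x \<in> B}} = {x\<in>{0..l}. (a - l) + x \<in> B}"
    by (auto simp: algebra_simps)
  also have "emeasure lborel \<dots> = emeasure lborel (B \<inter> {0..l})"
    by (rule emeasure_lborel_periodic[OF assms])
  finally show ?thesis .
qed

section \<open>Arc length by inscribed polygons\<close>

lemma (in Metric_space) sum_dist_ge:
  assumes "\<And>i. i \<le> n \<Longrightarrow> x i \<in> M" shows "d (x 0) (x n) \<le> (\<Sum>i<n. d (x i) (x (Suc i)))"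
  using assms
proof (induction n)
  case (Suc n)
  have "d (x 0) (x (Suc n)) \<le> d (x 0) (x n) + d (x n) (x (Suc n))"
    using Suc.prems by (intro triangle) auto
  also have "d (x 0) (x n) \<le> (\<Sum>i<n. d (x i) (x (Suc i)))" using Suc by auto
  finally show ?case by simp
qed simp

lemma (in Metric_space) dist_le_arc_length:
  assumes "s \<le> t" shows "ennreal (d (c s) (c t)) \<le> arc_length d c s t"
proof -
  let ?\<tau> = "\<lambda>i::nat. if i = 0 then s else t"
  have "ennreal (d (c s) (c t)) = (\<Sum>i<1. ennreal (d (c (?\<tau> i)) (c (?\<tau> (Suc i)))))" by simp
  moreover have "mono_on {..1} ?\<tau>" using assms by (auto intro!: mono_onI)
  ultimately show ?thesis unfolding arc_length_def
    by (intro Sup_upper CollectI exI[of _ "1::nat"] exI[of _ ?\<tau>]) auto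
qed

lemma abs_equipartition_step: "\<bar>a + real i * h - (a + real (Suc i) * h)\<bar> = \<bar>h\<bar>"
  by (simp add: algebra_simps)

text \<open>Modelled on a circle run through at unit speed: a chord depends on the parameter
  difference only and is asymptotic to it. This replaces differentiability, which has no meaning in
  a bare metric space.\<close>

locale chord_curve = Metric_space M d for M :: "'a set" and d +
  fixes c :: "real \<Rightarrow> 'a" and f :: "real \<Rightarrow> real"
  assumes c_in [simp]: "c x \<in> M"
    and chord: "d (c x) (c y) = f \<bar>x - y\<bar>"
    and f_lim: "((\<lambda>x. f x / x) \<longlongrightarrow> 1) (at_right 0)"
begin

lemma f_0 [simp]: "f 0 = 0"
  using chord[of 0 0] by simp

text \<open>The quantity is the length of an inscribed polygon with \<open>n\<close> equal steps
  over a parameter interval of length \<open>x\<close>.\<close>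

lemma equipartition_lim: assumes "0 \<le> x" shows "(\<lambda>n. real n * f (x / real n)) \<longlonglongrightarrow> x"
proof (cases "x = 0")
  case False
  have "filterlim (\<lambda>n. x / real n) (at_right 0) sequentially"
    unfolding filterlim_at
  proof
    show "(\<lambda>n. x / real n) \<longlonglongrightarrow> 0" by (rule lim_const_over_n)
    show "\<forall>\<^sub>F n in sequentially. x / real n \<in> {0<..} \<and> x / real n \<noteq> 0"
      by (rule eventually_mono[OF eventually_gt_at_top[of 0]]) (use False assms in simp)
  qed
  from filterlim_compose[OF f_lim this]
  have "(\<lambda>n. x * (f (x / real n) / (x / real n))) \<longlonglongrightarrow> x * 1" by (intro tendsto_mult tendsto_const)
  moreover have "x * (f (x / real n) / (x / real n)) = real n * f (x / real n)" for n
    using False by (cases "n = 0") (auto simp: field_simps)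
  ultimately show ?thesis by simp
qed simp

text \<open>A chord is at most the length of an inscribed polygon with the same ends; let the number
  of equal steps grow.\<close>

lemma dist_le: "d (c x) (c y) \<le> \<bar>x - y\<bar>"
proof (rule LIMSEQ_le_const[OF equipartition_lim])
  have "d (c x) (c y) \<le> real n * f (\<bar>x - y\<bar> / real n)" if n: "n > 0" for n
  proof -
    define z where "z i = c (x + real i * ((y - x) / real n))" for i
    have "d (z i) (z (Suc i)) = f (\<bar>x - y\<bar> / real n)" for i
      unfolding z_def chord abs_equipartition_step by (simp add: abs_minus_commute)
    moreover have "d (z 0) (z n) \<le> (\<Sum>i<n. d (z i) (z (Suc i)))"
      by (rule sum_dist_ge) (simp add: z_def)
    ultimately show ?thesis using n by (simp add: z_def)
  qed
  then show "\<exists>N. \<forall>n\<ge>N. d (c x) (c y) \<le> real n * f (\<bar>x - y\<bar> / real n)"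
    by (intro exI[of _ 1]) auto
qed simp

lemma arc_length_eq: assumes "s \<le> t" shows "arc_length d c s t = ennreal (t - s)"
proof (rule antisym)
  show "arc_length d c s t \<le> ennreal (t - s)"
    unfolding arc_length_def
  proof (rule Sup_least, clarify)
    fix n :: nat and \<tau> :: "nat \<Rightarrow> real" assume \<tau>: "mono_on {..n} \<tau>"
    have "(\<Sum>i<n. d (c (\<tau> i)) (c (\<tau> (Suc i)))) \<le> (\<Sum>i<n. \<tau> (Suc i) - \<tau> i)"
    proof (rule sum_mono)
      fix i assume "i \<in> {..<n}"
      then have "\<tau> i \<le> \<tau> (Suc i)" by (intro mono_onD[OF \<tau>]) auto
      then show "d (c (\<tau> i)) (c (\<tau> (Suc i))) \<le> \<tau> (Suc i) - \<tau> i"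
        using dist_le[of "\<tau> i" "\<tau> (Suc i)"] by simp
    qed
    also have "\<dots> = \<tau> n - \<tau> 0" by (rule sum_lessThan_telescope)
    finally show "(\<Sum>i<n. ennreal (d (c (\<tau> i)) (c (\<tau> (Suc i))))) \<le> ennreal (\<tau> n - \<tau> 0)"
      by (simp add: ennreal_leI)
  qed
next
  have "(\<lambda>n. ennreal (real n * f ((t - s) / real n))) \<longlonglongrightarrow> ennreal (t - s)"
    by (intro tendsto_ennrealI equipartition_lim) (use assms in simp)
  then show "ennreal (t - s) \<le> arc_length d c s t"
  proof (rule LIMSEQ_le_const2, intro exI[of _ 1] allI impI)
    fix n :: nat assume n: "1 \<le> n"
    let ?\<tau> = "\<lambda>i. s + real i * ((t - s) / real n)"
    have "mono_on {..n} ?\<tau>" using assms by (intro mono_onI add_mono mult_right_mono) auto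
    moreover have "ennreal (real n * f ((t - s) / real n))
        = (\<Sum>i<n. ennreal (d (c (?\<tau> i)) (c (?\<tau> (Suc i)))))"
    proof -
      have "d (c (?\<tau> i)) (c (?\<tau> (Suc i))) = f ((t - s) / real n)" for i
        unfolding chord abs_equipartition_step using assms by simp
      moreover have "f ((t - s) / real n) \<ge> 0" using calculation[of 0] by (metis nonneg)
      ultimately show ?thesis by (simp add: ennreal_mult ennreal_of_nat_eq_real_of_nat)
    qed
    ultimately show "ennreal (real n * f ((t - s) / real n)) \<le> arc_length d c s t"
      unfolding arc_length_def using n by (intro Sup_upper CollectI exI[of _ n] exI[of _ ?\<tau>]) auto
  qed
qed

text \<open>For \<open>\<le>\<close>, an equipartition of the range of \<open>\<psi>\<close> is
  pulled back by the intermediate value theorem. Each chord is at most its parameter step, so the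
  polygon has length at most \<open>t\<close>, and the polygons converge to the increase of
  \<open>\<psi>\<close>. For \<open>\<ge>\<close>, the length of \<open>c \<circ> \<psi>\<close> is
  at most that increase, because chords are at most parameter differences.\<close>

lemma reparametrization_isometric:
  assumes \<psi>: "continuous_on {0..t} \<psi>" "strict_mono_on {0..t} \<psi>" and t: "0 \<le> t"
    and lip: "\<And>u v. 0 \<le> u \<Longrightarrow> u \<le> v \<Longrightarrow> v \<le> t \<Longrightarrow> d (c (\<psi> u)) (c (\<psi> v)) \<le> v - u"
    and len: "arc_length d (c \<circ> \<psi>) 0 t = ennreal t"
  shows "\<psi> t - \<psi> 0 = t"
proof (rule antisym)
  define \<Delta> where "\<Delta> = \<psi> t - \<psi> 0"
  have mono: "\<psi> u \<le> \<psi> v" if "0 \<le> u" "u \<le> v" "v \<le> t" for u v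
    using strict_mono_onD[OF \<psi>(2), of u v] that by (cases "u = v") auto
  have \<Delta>: "0 \<le> \<Delta>" using mono[of 0 t] t by (simp add: \<Delta>_def)
  show "\<psi> t - \<psi> 0 \<le> t" unfolding \<Delta>_def[symmetric]
  proof (rule LIMSEQ_le_const2[OF equipartition_lim[OF \<Delta>]], intro exI[of _ 1] allI impI)
    fix n :: nat assume n: "1 \<le> n"
    have "\<exists>x. 0 \<le> x \<and> x \<le> t \<and> \<psi> x = \<psi> 0 + real i * (\<Delta> / real n)" if i: "i \<le> n" for i
    proof (rule IVT')
      have "real i * (\<Delta> / real n) \<le> real n * (\<Delta> / real n)"
        using i \<Delta> by (intro mult_right_mono) auto
      then show "\<psi> 0 + real i * (\<Delta> / real n) \<le> \<psi> t" using n by (simp add: \<Delta>_def)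
    qed (use \<psi> t \<Delta> in auto)
    then obtain \<tau> where \<tau>: "\<And>i. i \<le> n \<Longrightarrow> 0 \<le> \<tau> i \<and> \<tau> i \<le> t \<and> \<psi> (\<tau> i) = \<psi> 0 + real i * (\<Delta> / real n)"
      by metis
    have \<tau>_mono: "\<tau> i \<le> \<tau> (Suc i)" if "i < n" for i
    proof (rule ccontr)
      assume "\<not> ?thesis"
      then have "\<psi> (\<tau> (Suc i)) < \<psi> (\<tau> i)"
        using \<tau>[of i] \<tau>[of "Suc i"] that by (intro strict_mono_onD[OF \<psi>(2)]) auto
      then have "real (Suc i) * (\<Delta> / real n) < real i * (\<Delta> / real n)"
        using \<tau>[of i] \<tau>[of "Suc i"] that by auto
      moreover have "real i * (\<Delta> / real n) \<le> real (Suc i) * (\<Delta> / real n)"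
        using \<Delta> by (intro mult_right_mono) auto
      ultimately show False by linarith
    qed
    have "real n * f (\<Delta> / real n) = (\<Sum>i<n. d (c (\<psi> (\<tau> i))) (c (\<psi> (\<tau> (Suc i)))))"
    proof -
      have "d (c (\<psi> (\<tau> i))) (c (\<psi> (\<tau> (Suc i)))) = f (\<Delta> / real n)" if "i < n" for i
      proof -
        have \<psi>\<tau>: "\<psi> (\<tau> j) = \<psi> 0 + real j * (\<Delta> / real n)" if "j \<le> n" for j
          using \<tau>[OF that] by blast
        show ?thesis
          unfolding chord \<psi>\<tau>[OF Suc_leI[OF that]] \<psi>\<tau>[OF less_imp_le[OF that]] abs_equipartition_step
          using \<Delta> by simp
      qed
      then show ?thesis by simp
    qed
    also have "\<dots> \<le> (\<Sum>i<n. \<tau> (Suc i) - \<tau> i)"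
      using \<tau> \<tau>_mono by (intro sum_mono lip) auto
    also have "\<dots> = \<tau> n - \<tau> 0" by (rule sum_lessThan_telescope)
    also have "\<dots> \<le> t" using \<tau>[of n] \<tau>[of 0] by auto
    finally show "real n * f (\<Delta> / real n) \<le> t" .
  qed
  have "arc_length d (c \<circ> \<psi>) 0 t \<le> ennreal \<Delta>"
    unfolding arc_length_def
  proof (rule Sup_least, clarify)
    fix n :: nat and \<tau> :: "nat \<Rightarrow> real"
    assume \<tau>: "mono_on {..n} \<tau>" "\<tau> 0 = 0" "t = \<tau> n"
    have "(\<Sum>i<n. d (c (\<psi> (\<tau> i))) (c (\<psi> (\<tau> (Suc i))))) \<le> (\<Sum>i<n. \<psi> (\<tau> (Suc i)) - \<psi> (\<tau> i))"
    proof (rule sum_mono)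
      fix i assume i: "i \<in> {..<n}"
      have "\<tau> 0 \<le> \<tau> i" "\<tau> i \<le> \<tau> (Suc i)" "\<tau> (Suc i) \<le> \<tau> n"
        using i by (auto intro!: mono_onD[OF \<tau>(1)])
      then have "\<psi> (\<tau> i) \<le> \<psi> (\<tau> (Suc i))" using \<tau> by (intro mono) auto
      then show "d (c (\<psi> (\<tau> i))) (c (\<psi> (\<tau> (Suc i)))) \<le> \<psi> (\<tau> (Suc i)) - \<psi> (\<tau> i)"
        using dist_le[of "\<psi> (\<tau> i)" "\<psi> (\<tau> (Suc i))"] by simp
    qed
    also have "\<dots> = \<psi> (\<tau> n) - \<psi> (\<tau> 0)" by (rule sum_lessThan_telescope)
    finally show "(\<Sum>i<n. ennreal (d ((c \<circ> \<psi>) (\<tau> i)) ((c \<circ> \<psi>) (\<tau> (Suc i))))) \<le> ennreal \<Delta>"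
      using \<tau> by (simp add: \<Delta>_def ennreal_leI)
  qed
  then show "t \<le> \<psi> t - \<psi> 0" using len \<Delta> by (simp add: \<Delta>_def)
qed

end

section \<open>The uniform distribution on a circle\<close>

lemma sin_over_tendsto: "((\<lambda>x::real. sin x / x) \<longlongrightarrow> 1) (at 0)"
  using DERIV_sin[of "0::real"] by (simp add: DERIV_def)

lemma exp_Im_eq_if_norm_1:
  assumes "cis a = exp z" shows "cos a = cos (Im z)" "sin a = sin (Im z)"
proof -
  have "exp (Re z) = norm (exp z)" by (rule norm_exp_eq_Re[symmetric])
  also have "\<dots> = 1" by (simp flip: assms)
  finally have "exp z = cis (Im z)" by (simp add: exp_eq_polar)
  then have "cis a = cis (Im z)" using assms by simp
  then show "cos a = cos (Im z)" "sin a = sin (Im z)" by (simp_all add: complex_eq_iff)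
qed

text \<open>The same factor \<open>1 - cos (a - b)\<close> governs chords of a geodesic circle
  (\<open>circle_law\<close>), so continuity there amounts to continuity of \<open>cis\<close> of
  the angle.\<close>

lemma norm_cis_diff: "(norm (cis a - cis b))\<^sup>2 = 2 * (1 - cos (a - b))"
proof -
  have "(norm (cis a - cis b))\<^sup>2 = (cos a - cos b)\<^sup>2 + (sin a - sin b)\<^sup>2"
    by (simp add: cmod_power2)
  also have "\<dots> = ((cos a)\<^sup>2 + (sin a)\<^sup>2) + ((cos b)\<^sup>2 + (sin b)\<^sup>2) - 2 * (cos a * cos b + sin a * sin b)"
    by (simp add: power2_eq_square algebra_simps)
  finally show ?thesis by (simp add: cos_diff)
qed

context cc_space
begin

lemma dist_tendsto_0:
  assumes lim: "((\<lambda>y. md (d (p y) (q y))) \<longlongrightarrow> 0) \<F>" and "\<And>y. p y \<in> M" "\<And>y. q y \<in> M"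
  shows "((\<lambda>y. d (p y) (q y)) \<longlongrightarrow> 0) \<F>"
  by (rule tendsto_0_if_md_tendsto_0[OF lim]) (use assms(2,3) md_dist_le in \<open>auto intro!: always_eventually\<close>)

section \<open>Measurability of frames and distances\<close>

context
  fixes F assumes F: "frame M d F"
begin

text \<open>\<open>frame\<close> provides continuity only for \<open>md\<close> of distances;
  \<open>dist_tendsto_0\<close> upgrades it to the distance itself, so that preimages of open sets
  are open.\<close>

lemma frame_measurable: "(\<lambda>(w, \<theta>). F w s \<theta>) \<in> borel \<Otimes>\<^sub>M borel \<rightarrow>\<^sub>M borel_of_metric M d"
  unfolding borel_of_metric_def borel_prod
proof (rule measurable_measure_of)
  show "{U. openin mtopology U} \<subseteq> Pow M" using openin_subset by fastforce
  show "(\<lambda>(w, \<theta>). F w s \<theta>) \<in> space borel \<rightarrow> M" using frame_in[OF F] by auto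
  show "(\<lambda>(w, \<theta>). F w s \<theta>) -` U \<inter> space borel \<in> sets borel" if U: "U \<in> {U. openin mtopology U}" for U
  proof -
    have "open ((\<lambda>(w, \<theta>). F w s \<theta>) -` U)"
      unfolding open_subopen[of "(\<lambda>(w, \<theta>). F w s \<theta>) -` U"]
    proof safe
      fix w \<theta> assume "F w s \<theta> \<in> U"
      then obtain r where r: "r > 0" "mball (F w s \<theta>) r \<subseteq> U"
        using U by (auto simp: openin_mtopology)
      have "continuous_on UNIV (\<lambda>(w', \<theta>'). md (d (F w s \<theta>) (F w' s \<theta>')))"
        using F by (simp add: frame_def)
      then have "isCont (\<lambda>(w', \<theta>'). md (d (F w s \<theta>) (F w' s \<theta>'))) (w, \<theta>)"
        by (simp add: continuous_on_eq_continuous_at)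
      then have "((\<lambda>x. md (d (F w s \<theta>) (F (fst x) s (snd x)))) \<longlongrightarrow> 0) (at (w, \<theta>))"
        using mdist_zero[OF frame_in[OF F]] by (simp add: isCont_def case_prod_unfold)
      then have "((\<lambda>x. d (F w s \<theta>) (F (fst x) s (snd x))) \<longlongrightarrow> 0) (at (w, \<theta>))"
        by (rule dist_tendsto_0) (simp_all add: frame_in[OF F])
      from order_tendstoD(2)[OF this r(1)]
      have "\<forall>\<^sub>F x in at (w, \<theta>). F (fst x) s (snd x) \<in> U"
        by (rule eventually_mono) (use r(2) frame_in[OF F] in auto)
      then have "\<forall>\<^sub>F x in nhds (w, \<theta>). F (fst x) s (snd x) \<in> U"
        using \<open>F w s \<theta> \<in> U\<close> by (auto simp: eventually_at_filter elim!: eventually_mono)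
      then show "\<exists>T. open T \<and> (w, \<theta>) \<in> T \<and> T \<subseteq> (\<lambda>(w, \<theta>). F w s \<theta>) -` U"
        unfolding eventually_nhds by fastforce
    qed
    then show ?thesis by simp
  qed
qed

lemma space_borel_of_metric [simp]: "space (borel_of_metric M d) = M"
  unfolding borel_of_metric_def by (rule space_measure_of) (use openin_subset in fastforce)

lemma dist_measurable: assumes "p \<in> M" shows "d p \<in> borel_measurable (borel_of_metric M d)"
proof (rule borel_measurableI_less)
  fix y
  have "{x \<in> M. d p x < y} = mball p y" using assms by (auto simp: mball_def)
  then have "openin mtopology {x \<in> M. d p x < y}" by simp
  then show "{x \<in> space (borel_of_metric M d). d p x < y} \<in> sets (borel_of_metric M d)"
    unfolding space_borel_of_metric unfolding borel_of_metric_def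
    by (subst sets_measure_of) (use openin_subset in fastforce)+
qed

text \<open>
  Jointly measurable although no countable base of \<open>M\<close> is at hand: the distance is continuous in \<open>z\<close>, hence
  a limit of functions that are piecewise constant in \<open>z\<close>.
\<close>

lemma dist_equator_measurable:
  "(\<lambda>(z, q). d (F 0 (b + z) 0) q) \<in> borel_measurable (borel \<Otimes>\<^sub>M borel_of_metric M d)"
proof (rule borel_measurable_LIMSEQ_real)
  let ?N = "(borel :: real measure) \<Otimes>\<^sub>M borel_of_metric M d"
  define f where "f n = (\<lambda>(z, q). d (F 0 (b + of_int \<lfloor>real n * z\<rfloor> / real n) 0) q)" for n :: nat
  show "f n \<in> borel_measurable ?N" for n
  proof -
    have 1: "(\<lambda>x. d (F 0 (b + of_int i / real n) 0) (snd x)) \<in> borel_measurable ?N" for i :: int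
      by (rule measurable_compose[OF measurable_snd dist_measurable]) (simp add: frame_in[OF F])
    have 2: "(\<lambda>x. \<lfloor>real n * fst x\<rfloor>) \<in> ?N \<rightarrow>\<^sub>M count_space UNIV"
      by measurable
    from measurable_compose_countable[OF 1 2] show ?thesis
      by (simp add: f_def case_prod_unfold)
  qed
  fix x assume "x \<in> space ?N"
  then obtain z q where x: "x = (z, q)" "q \<in> M" by (auto simp: space_pair_measure)
  have "(\<lambda>n. f n x) \<longlonglongrightarrow> d (F 0 (b + z) 0) q"
  proof (rule LIM_zero_cancel, rule Lim_null_comparison)
    have "\<forall>\<^sub>F n in sequentially. 1 / real n < \<rho>"
      using order_tendstoD(2)[OF lim_const_over_n[of 1] rho_pos] .
    with eventually_gt_at_top[of 0]
    show "\<forall>\<^sub>F n in sequentially. norm (f n x - d (F 0 (b + z) 0) q) \<le> 1 / real n"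
    proof eventually_elim
      case (elim n)
      define y where "y = of_int \<lfloor>real n * z\<rfloor> / real n"
      have "\<bar>of_int \<lfloor>real n * z\<rfloor> - real n * z\<bar> \<le> 1" by linarith
      moreover have "y - z = (of_int \<lfloor>real n * z\<rfloor> - real n * z) / real n"
        using elim by (simp add: y_def field_simps)
      ultimately have yz: "\<bar>y - z\<bar> \<le> 1 / real n" using elim by (simp add: divide_right_mono)
      then have "d (F 0 (b + y) 0) (F 0 (b + z) 0) \<le> 1 / real n"
        using frame_radial[OF F, of "b + y" "b + z" 0 0] elim by simp
      then have "\<bar>d (F 0 (b + y) 0) q - d (F 0 (b + z) 0) q\<bar> \<le> 1 / real n"
        using triangle[of "F 0 (b + y) 0" "F 0 (b + z) 0" q] triangle[of "F 0 (b + z) 0" "F 0 (b + y) 0" q]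
          commute[of "F 0 (b + y) 0" "F 0 (b + z) 0"] x(2) frame_in[OF F] by auto
      then show ?case by (simp add: f_def x y_def)
    qed
  qed (rule lim_const_over_n)
  then show "(\<lambda>n. f n x) \<longlonglongrightarrow> (case x of (z, q) \<Rightarrow> d (F 0 (b + z) 0) q)" by (simp add: x)
qed

section \<open>Arc-length parametrizations of a geodesic circle\<close>

context
  fixes L :: real assumes L: "0 < L" "2 * L \<le> \<rho>"
begin

lemma sn_L_pos: "0 < sn L"
  using L by (intro sn_pos) auto

lemma circle_eq: "geodesic_circle M d (F w 0 0) L = range (F w L)"
proof (intro equalityI subsetI)
  fix q assume "q \<in> geodesic_circle M d (F w 0 0) L"
  then show "q \<in> range (F w L)" using frame_surj[OF F, of q w] by (auto simp: geodesic_circle_def)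
next
  fix q assume "q \<in> range (F w L)"
  then show "q \<in> geodesic_circle M d (F w 0 0) L"
    using frame_radius[OF F, of L w 0] frame_in[OF F] L by (auto simp: geodesic_circle_def)
qed

text \<open>Here \<open>2 * L \<le> \<rho>\<close> enters: all chords of the circle stay in the
  range where \<open>md\<close> determines the distance.\<close>

lemma circle_dist_le: "d (F w L \<alpha>) (F w L \<beta>) \<le> \<rho>"
  using triangle[of "F w L \<alpha>" "F w 0 0" "F w L \<beta>"] frame_in[OF F] commute[of "F w L \<alpha>" "F w 0 0"]
    frame_radius[OF F, of L w 0] L by simp

lemma circle_law: "md (d (F w L \<alpha>) (F w L \<beta>)) = (sn L)\<^sup>2 * (1 - cos (\<alpha> - \<beta>))"
  using law[OF F, of w L \<alpha> L \<beta>] by (simp add: power2_eq_square)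

lemma circle_eq_iff: "F w L \<alpha> = F w L \<beta> \<longleftrightarrow> cos (\<alpha> - \<beta>) = 1"
proof
  assume "F w L \<alpha> = F w L \<beta>"
  then have "(sn L)\<^sup>2 * (1 - cos (\<alpha> - \<beta>)) = 0"
    using circle_law[of w \<alpha> \<beta>] frame_in[OF F] by simp
  then show "cos (\<alpha> - \<beta>) = 1" using sn_L_pos by simp
qed (use frame_angle_eqI[OF F] in blast)

text \<open>The angle is \<open>x / sn L\<close> because the circle of radius \<open>L\<close> has
  length \<open>2 * pi * sn L\<close>; \<open>\<sigma>\<close> is the orientation and
  \<open>\<theta>\<^sub>0\<close> the start. The chord function has \<open>md\<close> equal to
  \<open>2 * (sn L)^2 * (sin (x / (2 * sn L)))^2\<close>, so \<open>md_asymptotics\<close> gives the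
  unit speed.\<close>

lemma chord_curve_circle:
  assumes "\<bar>\<sigma>\<bar> = 1"
  shows "chord_curve M d (\<lambda>x. F w L (\<theta>\<^sub>0 + \<sigma> * x / sn L)) (\<lambda>x. d (F w L 0) (F w L (x / sn L)))"
proof
  fix x y
  show "F w L (\<theta>\<^sub>0 + \<sigma> * x / sn L) \<in> M" by (rule frame_in[OF F])
  have "\<sigma> = 1 \<or> \<sigma> = -1" using assms by linarith
  then have "cos (\<sigma> * (x - y) / sn L) = cos (\<bar>x - y\<bar> / sn L)"
    by (cases "x \<le> y") (auto simp: minus_divide_left[symmetric] simp del: minus_divide_left
        intro: arg_cong[where f = cos] simp: diff_divide_distrib cos_diff)
  then have "md (d (F w L (\<theta>\<^sub>0 + \<sigma> * x / sn L)) (F w L (\<theta>\<^sub>0 + \<sigma> * y / sn L)))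
      = md (d (F w L 0) (F w L (\<bar>x - y\<bar> / sn L)))"
    by (simp add: circle_law right_diff_distrib diff_divide_distrib)
  then have "d (F w L (\<theta>\<^sub>0 + \<sigma> * x / sn L)) (F w L (\<theta>\<^sub>0 + \<sigma> * y / sn L))
      = \<bar>d (F w L 0) (F w L (\<bar>x - y\<bar> / sn L))\<bar>"
    by (intro dist_eqI) (use frame_in[OF F] circle_dist_le in auto)
  then show "d (F w L (\<theta>\<^sub>0 + \<sigma> * x / sn L)) (F w L (\<theta>\<^sub>0 + \<sigma> * y / sn L))
      = d (F w L 0) (F w L (\<bar>x - y\<bar> / sn L))" by simp
next
  define f where "f x = d (F w L 0) (F w L (x / sn L))" for x
  have mdf: "md (f x) = 2 * (sn L)\<^sup>2 * (sin (x / (2 * sn L)))\<^sup>2" for x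
    using cos_double_sin[of "x / (2 * sn L)"] by (simp add: f_def circle_law)
  have "isCont (\<lambda>x. 2 * (sn L)\<^sup>2 * (sin (x / (2 * sn L)))\<^sup>2) 0"
    using sn_L_pos by (intro continuous_intros) auto
  then have "((\<lambda>x. md (f x)) \<longlongrightarrow> 0) (at 0)" by (simp add: isCont_def mdf)
  then have f0: "(f \<longlongrightarrow> 0) (at 0)" unfolding f_def
    by (rule dist_tendsto_0) (simp_all add: frame_in[OF F])
  have "filterlim (\<lambda>x. x / (2 * sn L)) (at 0) (at 0)"
    using sn_L_pos by (auto simp: filterlim_at eventually_at intro!: tendsto_eq_intros exI[of _ 1])
  from filterlim_compose[OF sin_over_tendsto this]
  have "((\<lambda>x. (sin (x / (2 * sn L)) / (x / (2 * sn L)))\<^sup>2 / 2) \<longlongrightarrow> 1\<^sup>2 / 2) (at 0)"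
    by (intro tendsto_intros) auto
  moreover have "(sin (x / (2 * sn L)) / (x / (2 * sn L)))\<^sup>2 / 2 = md (f x) / x\<^sup>2" for x
    using sn_L_pos by (simp add: mdf power_divide power_mult_distrib)
  ultimately have "((\<lambda>x. \<bar>f x\<bar> / \<bar>x\<bar>) \<longlongrightarrow> 1) (at 0)"
    by (intro md_asymptotics f0) auto
  then have "((\<lambda>x. \<bar>f x\<bar> / \<bar>x\<bar>) \<longlongrightarrow> 1) (at_right 0)"
    by (rule filterlim_mono[OF _ order_refl at_le]) simp
  then show "((\<lambda>x. f x / x) \<longlongrightarrow> 1) (at_right 0)"
    by (rule Lim_transform_eventually) (auto simp: eventually_at_right_field f_def intro!: exI[of _ 1])
qed

lemma arc_length_parametrization_circle:
  "arc_length_parametrization d (range (F w L)) (2 * pi * sn L) (\<lambda>x. F w L (x / sn L))"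
proof -
  interpret chord_curve M d "\<lambda>x. F w L (0 + 1 * x / sn L)" "\<lambda>x. d (F w L 0) (F w L (x / sn L))"
    by (rule chord_curve_circle) simp
  let ?c = "\<lambda>x. F w L (x / sn L)"
  show ?thesis
    unfolding arc_length_parametrization_def
  proof (intro conjI allI impI)
    show "?c ` {0..2 * pi * sn L} = range (F w L)"
    proof (intro equalityI subsetI)
      fix q assume "q \<in> range (F w L)"
      then obtain \<theta> where q: "q = F w L \<theta>" by auto
      obtain t where t: "0 \<le> t" "t < 2 * pi" "sin \<theta> = sin t" "cos \<theta> = cos t"
        using sincos_total_2pi[of "cos \<theta>" "sin \<theta>"] by (metis sin_cos_squared_add2 add.commute)
      then have "cos (\<theta> - t) = 1" by (simp add: cos_diff flip: power2_eq_square)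
      then have "q = ?c (t * sn L)" using q sn_L_pos circle_eq_iff by simp
      moreover have "t * sn L \<in> {0..2 * pi * sn L}" using t sn_L_pos by (auto intro: mult_right_mono)
      ultimately show "q \<in> ?c ` {0..2 * pi * sn L}" by blast
    qed auto
    show "inj_on ?c {0..<2 * pi * sn L}"
    proof (rule inj_onI)
      fix x y assume xy: "x \<in> {0..<2 * pi * sn L}" "y \<in> {0..<2 * pi * sn L}" "?c x = ?c y"
      then have "cos (x / sn L - y / sn L) = 1" by (simp add: circle_eq_iff)
      then obtain n :: int where n: "x / sn L - y / sn L = of_int n * 2 * pi" by (auto simp: cos_one_2pi_int)
      have "\<bar>x / sn L - y / sn L\<bar> < 2 * pi" using xy sn_L_pos
        by (auto simp: abs_less_iff field_simps) 
      then have "\<bar>of_int n\<bar> * (2 * pi) < 1 * (2 * pi)" by (simp add: n abs_mult)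
      then have "\<bar>of_int n\<bar> < (1::real)" by (subst (asm) mult_less_cancel_right_pos) auto
      then have "n = 0" by linarith
      then show "x = y" using n sn_L_pos by (simp add: field_simps)
    qed
    show "?c (2 * pi * sn L) = ?c 0" using sn_L_pos circle_eq_iff by simp
    show "arc_length d ?c s t = ennreal (t - s)" if "0 \<le> s \<and> s \<le> t \<and> t \<le> 2 * pi * sn L" for s t
      using arc_length_eq[of s t] that by simp
  qed (use sn_L_pos in simp)
qed

text \<open>A continuous angle is lifted from the circle to the line. Injectivity makes it monotone,
  the arc-length condition gives it slope \<open>1\<close> or \<open>-1\<close> in units of length,
  and closing up without an earlier return leaves exactly one turn.\<close>

lemma arc_length_parametrization_circle_unique:
  assumes c: "arc_length_parametrization d (range (F w L)) l c"
  obtains \<theta>\<^sub>0 \<sigma> where "\<sigma> = 1 \<or> \<sigma> = -1" "l = 2 * pi * sn L"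
    "\<And>\<tau>. \<tau> \<in> {0..l} \<Longrightarrow> c \<tau> = F w L (\<theta>\<^sub>0 + \<sigma> * \<tau> / sn L)"
proof -
  have l: "l > 0" and im: "c ` {0..l} = range (F w L)" and inj: "inj_on c {0..<l}" and closed: "c l = c 0"
    and len: "\<And>s t. 0 \<le> s \<Longrightarrow> s \<le> t \<Longrightarrow> t \<le> l \<Longrightarrow> arc_length d c s t = ennreal (t - s)"
    using c by (auto simp: arc_length_parametrization_def)
  have cM: "c x \<in> M" if "x \<in> {0..l}" for x
  proof -
    have "c x \<in> range (F w L)" using im that by blast
    then show ?thesis using frame_in[OF F] by auto
  qed
  have lip1: "d (c s) (c t) \<le> t - s" if "0 \<le> s" "s \<le> t" "t \<le> l" for s t
    using dist_le_arc_length[of s t c] len[OF that] that by simp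
  have lip: "d (c s) (c t) \<le> \<bar>s - t\<bar>" if "s \<in> {0..l}" "t \<in> {0..l}" for s t
    using lip1[of s t] lip1[of t s] that commute[of "c s" "c t"] by (cases "s \<le> t") auto
  have "\<forall>x\<in>{0..l}. \<exists>\<theta>. c x = F w L \<theta>" using im by blast
  \<comment> \<open>An arbitrary choice of angles, possibly discontinuous; only
    \<open>cis (g x)\<close> can be shown to be continuous.\<close>
  then obtain g where g: "\<And>x. x \<in> {0..l} \<Longrightarrow> c x = F w L (g x)" by metis
  have "continuous_on {0..l} (\<lambda>x. cis (g x))"
    unfolding continuous_on_def
  proof
    fix x assume x: "x \<in> {0..l}"
    have "((\<lambda>y. d (c y) (c x)) \<longlongrightarrow> 0) (at x within {0..l})"
    proof (rule Lim_null_comparison)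
      show "\<forall>\<^sub>F y in at x within {0..l}. norm (d (c y) (c x)) \<le> \<bar>y - x\<bar>"
        using lip x nonneg by (auto simp: eventually_at intro!: exI[of _ 1])
      show "((\<lambda>y. \<bar>y - x\<bar>) \<longlongrightarrow> 0) (at x within {0..l})"
        by (auto intro!: tendsto_eq_intros)
    qed
    moreover have "isCont md 0" using continuous_md by (simp add: continuous_on_eq_continuous_at)
    ultimately have "((\<lambda>y. md (d (c y) (c x))) \<longlongrightarrow> md 0) (at x within {0..l})"
      by (intro isCont_tendsto_compose[of _ md])
    then have "((\<lambda>y. sqrt (2 / (sn L)\<^sup>2 * md (d (c y) (c x)))) \<longlongrightarrow> sqrt (2 / (sn L)\<^sup>2 * md 0)) (at x within {0..l})"
      by (intro tendsto_intros)
    then have lim: "((\<lambda>y. sqrt (2 / (sn L)\<^sup>2 * md (d (c y) (c x)))) \<longlongrightarrow> 0) (at x within {0..l})" by simp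
    have "dist (cis (g y)) (cis (g x)) = sqrt (2 / (sn L)\<^sup>2 * md (d (c y) (c x)))" if "y \<in> {0..l}" for y
    proof -
      have "2 / (sn L)\<^sup>2 * md (d (c y) (c x)) = (norm (cis (g y) - cis (g x)))\<^sup>2"
        using sn_L_pos by (simp add: g[OF that] g[OF x] circle_law norm_cis_diff)
      then show ?thesis by (simp add: dist_norm)
    qed
    then have "\<forall>\<^sub>F y in at x within {0..l}.
        sqrt (2 / (sn L)\<^sup>2 * md (d (c y) (c x))) = dist (cis (g y)) (cis (g x))"
      by (auto simp: eventually_at intro!: exI[of _ 1])
    from Lim_transform_eventually[OF lim this]
    show "((\<lambda>x. cis (g x)) \<longlongrightarrow> cis (g x)) (at x within {0..l})" by (simp flip: tendsto_dist_iff)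
  qed
  \<comment> \<open>A continuous logarithm on the contractible interval; its imaginary part is the
    continuous angle.\<close>
  then obtain h where h: "continuous_on {0..l} h" "\<And>x. x \<in> {0..l} \<Longrightarrow> cis (g x) = exp (h x)"
    by (rule continuous_logarithm_on_contractible) (auto intro!: convex_imp_contractible)
  define \<phi> where "\<phi> x = sn L * Im (h x)" for x
  have cont: "continuous_on {0..l} \<phi>" unfolding \<phi>_def by (intro continuous_intros h)
  have c_eq: "c x = F w L (\<phi> x / sn L)" if "x \<in> {0..l}" for x
  proof -
    have "cos (g x - Im (h x)) = 1"
      using exp_Im_eq_if_norm_1[OF h(2)[OF that]] by (simp add: cos_diff flip: power2_eq_square)
    then show ?thesis using g[OF that] sn_L_pos circle_eq_iff by (simp add: \<phi>_def)
  qed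
  \<comment> \<open>The end \<open>l\<close> is left out because \<open>c\<close> returns to its
    start there.\<close>
  have "inj_on \<phi> {0..<l}"
    using inj c_eq by (auto simp: inj_on_def)
  moreover have "continuous_on {0..<l} \<phi>" by (rule continuous_on_subset[OF cont]) auto
  ultimately have "strict_mono_on {0..<l} \<phi> \<or> strict_antimono_on {0..<l} \<phi>"
    using injective_eq_monotone_map[of "{0..<l}" \<phi>] by (simp add: is_interval_co)
  then obtain \<sigma> :: real where \<sigma>: "\<sigma> = 1 \<or> \<sigma> = -1" "strict_mono_on {0..<l} (\<lambda>x. \<sigma> * \<phi> x)"
  proof
    assume "strict_mono_on {0..<l} \<phi>" then show thesis using that[of 1] by simp
  next
    assume "strict_antimono_on {0..<l} \<phi>"
    then show thesis using that[of "-1"] by (auto simp: monotone_on_def)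
  qed
  have \<sigma>\<sigma>: "\<sigma> * (\<sigma> * x) = x" for x using \<sigma>(1) by auto
  define \<psi> where "\<psi> x = \<sigma> * \<phi> x" for x
  have cont\<psi>: "continuous_on {0..l} \<psi>" unfolding \<psi>_def by (intro continuous_intros cont)
  interpret chord_curve M d "\<lambda>x. F w L (0 + \<sigma> * x / sn L)" "\<lambda>x. d (F w L 0) (F w L (x / sn L))"
    by (rule chord_curve_circle) (use \<sigma> in auto)
  have c_eq': "F w L (0 + \<sigma> * \<psi> x / sn L) = c x" if "x \<in> {0..l}" for x
    unfolding \<psi>_def \<sigma>\<sigma> using c_eq[OF that] by simp
  have "\<psi> t - t = \<psi> 0" if t: "t \<in> {0..<l}" for t
  proof -
    have "\<psi> t - \<psi> 0 = t"
    proof (rule reparametrization_isometric)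
      show "continuous_on {0..t} \<psi>" by (rule continuous_on_subset[OF cont\<psi>]) (use t in auto)
      show "strict_mono_on {0..t} \<psi>" using \<sigma>(2) t unfolding \<psi>_def
        by (auto simp: strict_mono_on_def)
      show "d (F w L (0 + \<sigma> * \<psi> u / sn L)) (F w L (0 + \<sigma> * \<psi> v / sn L)) \<le> v - u"
        if "0 \<le> u" "u \<le> v" "v \<le> t" for u v
        using lip1[of u v] c_eq'[of u] c_eq'[of v] that t by auto
      \<comment> \<open>\<open>c\<close> and its lifted form agree on \<open>{0..l}\<close> only, so
        the sums are compared at partition points, which monotonicity keeps in that range.\<close>
      have "arc_length d ((\<lambda>x. F w L (0 + \<sigma> * x / sn L)) \<circ> \<psi>) 0 t = arc_length d c 0 t"
        unfolding arc_length_def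
      proof (rule arg_cong[where f = Sup], rule Collect_cong, intro ex_cong1 rev_conj_cong refl)
        fix v and n :: nat and \<tau> :: "nat \<Rightarrow> real" assume \<tau>: "mono_on {..n} \<tau> \<and> \<tau> 0 = 0 \<and> \<tau> n = t"
        have r: "\<tau> i \<in> {0..l}" if "i \<le> n" for i
        proof -
          have "\<tau> 0 \<le> \<tau> i" "\<tau> i \<le> \<tau> n"
            using that by (auto intro!: mono_onD[OF conjunct1[OF \<tau>]])
          then show ?thesis using \<tau> t by auto
        qed
        have "(\<Sum>i<n. ennreal (d (((\<lambda>x. F w L (0 + \<sigma> * x / sn L)) \<circ> \<psi>) (\<tau> i))
             (((\<lambda>x. F w L (0 + \<sigma> * x / sn L)) \<circ> \<psi>) (\<tau> (Suc i)))))
           = (\<Sum>i<n. ennreal (d (c (\<tau> i)) (c (\<tau> (Suc i)))))"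
          using r c_eq' by (intro sum.cong refl) auto
        then show "(v = (\<Sum>i<n. ennreal (d (((\<lambda>x. F w L (0 + \<sigma> * x / sn L)) \<circ> \<psi>) (\<tau> i))
             (((\<lambda>x. F w L (0 + \<sigma> * x / sn L)) \<circ> \<psi>) (\<tau> (Suc i))))))
           = (v = (\<Sum>i<n. ennreal (d (c (\<tau> i)) (c (\<tau> (Suc i))))))" by simp
      qed
      also have "\<dots> = ennreal t" using len[of 0 t] t by simp
      finally show "arc_length d ((\<lambda>x. F w L (0 + \<sigma> * x / sn L)) \<circ> \<psi>) 0 t = ennreal t" .
    qed (use t in auto)
    then show ?thesis by simp
  qed
  \<comment> \<open>Continuity recovers the excluded end \<open>l\<close>.\<close>
  moreover have "continuous_on (closure {0..<l}) (\<lambda>t. \<psi> t - t)"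
    using l by (auto intro!: continuous_intros cont\<psi>)
  ultimately have "\<psi> t - t = \<psi> 0" if "t \<in> {0..l}" for t
    using continuous_constant_on_closure[of "{0..<l}" "\<lambda>t. \<psi> t - t" "\<psi> 0" t] that l by auto
  then have \<psi>_eq: "\<psi> t = \<psi> 0 + t" if "t \<in> {0..l}" for t using that by (smt (verit))
  define \<theta>\<^sub>0 where "\<theta>\<^sub>0 = \<sigma> * \<psi> 0 / sn L"
  have form: "c t = F w L (\<theta>\<^sub>0 + \<sigma> * t / sn L)" if "t \<in> {0..l}" for t
    using c_eq'[OF that] \<psi>_eq[OF that] by (simp add: \<theta>\<^sub>0_def distrib_left add_divide_distrib)
  have back_iff: "c t = c 0 \<longleftrightarrow> cos (t / sn L) = 1" if "t \<in> {0..l}" for t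
    using form[OF that] form[of 0] l \<sigma>(1) by (auto simp: circle_eq_iff)
  have "cos (l / sn L) = 1" using back_iff[of l] closed l by simp
  then obtain n :: int where n: "l / sn L = of_int n * 2 * pi" by (auto simp: cos_one_2pi_int)
  then have l_n: "l = of_int n * (2 * pi * sn L)" using sn_L_pos by (simp add: field_simps)
  have "n > 0"
  proof -
    have "0 < of_int n * (2 * pi * sn L)" using l l_n by simp
    then show ?thesis using sn_L_pos pi_gt_zero by (auto simp: zero_less_mult_iff mult_less_0_iff)
  qed
  \<comment> \<open>With two turns or more the curve would be back at \<open>c 0\<close> after the
    first, before \<open>l\<close>, against injectivity.\<close>
  moreover have "\<not> n \<ge> 2"
  proof
    assume "n \<ge> 2"
    then have "2 * (2 * pi * sn L) \<le> l" unfolding l_n using sn_L_pos by (intro mult_right_mono) auto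
    then have less: "2 * pi * sn L < l" using sn_L_pos pi_gt_zero
      by (smt (verit) mult_pos_pos)
    have nn: "0 < 2 * pi * sn L" using sn_L_pos by simp
    have "c (2 * pi * sn L) = c 0" using back_iff[of "2 * pi * sn L"] less nn sn_L_pos by simp
    then have "2 * pi * sn L = 0" using inj_onD[OF inj, of "2 * pi * sn L" 0] less nn l by simp
    then show False using nn by simp
  qed
  ultimately have "n = 1" by simp
  then show thesis using that[OF \<sigma>(1) _ form] l_n by simp
qed

abbreviation (input) "arc_law \<equiv> uniform_measure (restrict_space lborel {0..2 * pi * sn L}) {0..2 * pi * sn L}"

lemma frame_circle_measurable:
  "(\<lambda>x. F w L (a + b * x)) \<in> borel \<rightarrow>\<^sub>M borel_of_metric M d"
  using measurable_compose[OF _ frame_measurable[of L], of "\<lambda>x. (w, a + b * x)" borel] by simp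

text \<open>The description picks a unique measure because two parametrizations differ by a rotation
  and possibly a reflection, and both preserve Lebesgue measure of periodic sets over a
  period.\<close>

lemma uniform_on_circle:
  "uniform_on_curve M d (range (F w L)) = distr arc_law (borel_of_metric M d) (\<lambda>x. F w L (x / sn L))"
  unfolding uniform_on_curve_def
proof (rule the_equality)
  show "\<exists>l c. arc_length_parametrization d (range (F w L)) l c \<and>
      distr arc_law (borel_of_metric M d) (\<lambda>x. F w L (x / sn L)) =
      distr (uniform_measure (restrict_space lborel {0..l}) {0..l}) (borel_of_metric M d) c"
    using arc_length_parametrization_circle by blast
next
  fix \<mu> assume "\<exists>l c. arc_length_parametrization d (range (F w L)) l c \<and>
      \<mu> = distr (uniform_measure (restrict_space lborel {0..l}) {0..l}) (borel_of_metric M d) c"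
  then obtain l c where c: "arc_length_parametrization d (range (F w L)) l c"
    and \<mu>: "\<mu> = distr (uniform_measure (restrict_space lborel {0..l}) {0..l}) (borel_of_metric M d) c" by blast
  obtain \<theta>\<^sub>0 \<sigma> where \<sigma>: "\<sigma> = 1 \<or> \<sigma> = -1" and l: "l = 2 * pi * sn L"
    and eq: "\<And>\<tau>. \<tau> \<in> {0..l} \<Longrightarrow> c \<tau> = F w L (\<theta>\<^sub>0 + \<sigma> * \<tau> / sn L)"
    using arc_length_parametrization_circle_unique[OF c] by metis
  have l0: "0 < l" using l sn_L_pos by simp
  let ?B = "borel_of_metric M d" and ?f = "\<lambda>\<tau>. F w L (\<theta>\<^sub>0 + \<sigma> * \<tau> / sn L)" and ?g = "\<lambda>\<tau>. F w L (\<tau> / sn L)"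
  have fm: "?f \<in> borel \<rightarrow>\<^sub>M ?B" and gm: "?g \<in> borel \<rightarrow>\<^sub>M ?B"
    using frame_circle_measurable[of w \<theta>\<^sub>0 "\<sigma> / sn L"] frame_circle_measurable[of w 0 "1 / sn L"] by simp_all
  have res: "h \<in> arc_law \<rightarrow>\<^sub>M ?B" if "h \<in> borel \<rightarrow>\<^sub>M ?B" for h
  proof -
    have "h \<in> restrict_space borel {0..2 * pi * sn L} \<rightarrow>\<^sub>M ?B" using that by (rule measurable_restrict_space1)
    moreover have "sets arc_law = sets (restrict_space borel {0..2 * pi * sn L})"
      by (simp add: sets_restrict_space)
    ultimately show ?thesis using measurable_cong_sets by blast
  qed
  have "\<mu> = distr arc_law ?B ?f" unfolding \<mu> l
    by (rule distr_cong) (use eq in \<open>auto simp: space_restrict_space l\<close>)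
  also have "\<dots> = distr arc_law ?B ?g"
  proof (rule measure_eqI)
    fix A assume "A \<in> sets (distr arc_law ?B ?f)"
    then have A: "A \<in> sets ?B" by simp
    \<comment> \<open>The event lifted to the line. It has period \<open>l\<close>, and the other
      parametrization reaches it through \<open>x \<mapsto> a + \<sigma> * x\<close>.\<close>
    define S where "S = ?g -` A"
    have S: "S \<in> sets borel" using measurable_sets[OF gm A] by (simp add: S_def)
    have per: "x + l \<in> S \<longleftrightarrow> x \<in> S" for x
    proof -
      have "?g (x + l) = ?g x" unfolding circle_eq_iff using sn_L_pos by (simp add: l add_divide_distrib)
      then show ?thesis by (simp add: S_def)
    qed
    define a where "a = \<theta>\<^sub>0 * sn L"
    have fS: "?f x \<in> A \<longleftrightarrow> a + \<sigma> * x \<in> S" for x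
      using sn_L_pos by (simp add: S_def a_def add_divide_distrib)
    have "emeasure lborel {x\<in>{0..l}. a + \<sigma> * x \<in> S} = emeasure lborel (S \<inter> {0..l})"
      using \<sigma> emeasure_lborel_periodic[OF S l0 per, of a] emeasure_lborel_periodic_reflect[OF S l0 per, of a]
      by auto
    moreover have "{0..l} \<inter> {x. a + \<sigma> * x \<in> S} = {x\<in>{0..l}. a + \<sigma> * x \<in> S}" by auto
    moreover have em: "emeasure (distr arc_law ?B h) A = emeasure lborel ({0..l} \<inter> h -` A) / emeasure lborel {0..l}"
      if "h \<in> borel \<rightarrow>\<^sub>M ?B" for h
    proof -
      have "h -` A \<in> sets borel" using measurable_sets[OF that A] by simp
      then have S: "{0..l} \<inter> h -` A \<in> sets (restrict_space lborel {0..l})"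
        by (subst sets_restrict_space_iff) auto
      have T: "{0..l} \<in> sets (restrict_space lborel {0..l})"
        by (subst sets_restrict_space_iff) auto
      have "emeasure (distr arc_law ?B h) A = emeasure arc_law ({0..l} \<inter> h -` A)"
        using A by (simp add: emeasure_distr[OF res[OF that]] space_restrict_space l Int_commute)
      also have "\<dots> = emeasure lborel ({0..l} \<inter> ({0..l} \<inter> h -` A)) / emeasure lborel {0..l}"
        unfolding l[symmetric] emeasure_uniform_measure[OF T S]
        by (subst (1 2) emeasure_restrict_space) auto
      finally show ?thesis by simp
    qed
    ultimately show "emeasure (distr arc_law ?B ?f) A = emeasure (distr arc_law ?B ?g) A"
      unfolding em[OF fm] em[OF gm] using fS by (simp add: S_def vimage_def Int_commute)
  qed simp
  finally show "\<mu> = distr arc_law ?B ?g" .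
qed

end

end

end

section \<open>The Buffon probability\<close>

text \<open>The strict inequality cuts out two open intervals about \<open>pi / 2\<close> and
  \<open>3 * pi / 2\<close>, while its complement wraps around 0. Here \<open>\<kappa>\<close> is a
  threshold for the cosine, not a curvature.\<close>

lemma abs_cos_less_iff:
  assumes \<kappa>: "0 \<le> \<kappa>" "\<kappa> \<le> 1" and x: "0 \<le> x" "x \<le> 2 * pi"
  defines "a \<equiv> arccos \<kappa>"
  shows "\<bar>cos x\<bar> < \<kappa> \<longleftrightarrow> x \<in> {a<..<pi - a} \<union> {pi + a<..<2 * pi - a}"
proof -
  have a: "0 \<le> a" "a \<le> pi" "cos a = \<kappa>" using \<kappa> by (auto simp: a_def arccos_lbound arccos_ubound)
  have half: "\<bar>cos y\<bar> < \<kappa> \<longleftrightarrow> a < y \<and> y < pi - a" if y: "0 \<le> y" "y \<le> pi" for y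
  proof -
    have "cos y < \<kappa> \<longleftrightarrow> a < y" using cos_mono_less_eq[of y a] a y by simp
    moreover have "- \<kappa> < cos y \<longleftrightarrow> y < pi - a" using cos_mono_less_eq[of "pi - a" y] a y by simp
    ultimately show ?thesis by (auto simp: abs_less_iff)
  qed
  show ?thesis
  proof (cases "x \<le> pi")
    case True
    then show ?thesis using half[of x] x a by auto
  next
    case False
    have "cos (x - pi) = - cos x" by (simp add: cos_diff)
    then show ?thesis using half[of "x - pi"] False x a by auto
  qed
qed

context cc_space
begin

context
  fixes F assumes F: "frame M d F"
begin

context
  fixes L :: real assumes L: "0 < L" "2 * L \<le> \<rho>"
begin

interpretation arc: prob_space "arc_law L"
proof (rule prob_space_uniform_measure)
  have "emeasure (restrict_space lborel {0..2 * pi * sn L}) {0..2 * pi * sn L} = ennreal (2 * pi * sn L)"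
    using sn_L_pos[OF F L] by (subst emeasure_restrict_space) auto
  then show "emeasure (restrict_space lborel {0..2 * pi * sn L}) {0..2 * pi * sn L} \<noteq> 0"
    "emeasure (restrict_space lborel {0..2 * pi * sn L}) {0..2 * pi * sn L} \<noteq> \<infinity>"
    using sn_L_pos[OF F L] by auto
qed

lemma sets_arc_law: "sets (arc_law L) = sets (restrict_space borel {0..2 * pi * sn L})"
  by (simp add: sets_restrict_space)

lemma emeasure_arc_law_cos:
  fixes k :: real
  assumes k: "0 \<le> k" "k \<le> 1"
  shows "emeasure (arc_law L) {\<tau> \<in> {0..2 * pi * sn L}. k \<le> \<bar>cos (\<tau> / sn L)\<bar>} = ennreal (2 * arccos k / pi)"
proof -
  define R where "R = sn L"
  have R: "R > 0" using sn_L_pos[OF F L] by (simp add: R_def)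
  define a where "a = arccos k"
  have a: "0 \<le> a" "2 * a \<le> pi" using arccos_le_pi2[of k] k by (auto simp: a_def arccos_lbound)
  define l where "l = 2 * pi * R"
  have l: "l > 0" using R by (simp add: l_def)
  define X where "X = {R * a<..<R * (pi - a)}"
  define Y where "Y = {R * (pi + a)<..<R * (2 * pi - a)}"
  define S where "S = {\<tau> \<in> {0..l}. k \<le> \<bar>cos (\<tau> / R)\<bar>}"
  have S: "S = {0..l} - (X \<union> Y)"
  proof -
    have "k \<le> \<bar>cos (\<tau> / R)\<bar> \<longleftrightarrow> \<tau> \<notin> X \<union> Y" if "\<tau> \<in> {0..l}" for \<tau>
      using abs_cos_less_iff[OF k, of "\<tau> / R"] that R
      by (auto simp: X_def Y_def a_def[symmetric] l_def field_simps not_less)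
    then show ?thesis unfolding S_def by auto
  qed
  have XY: "X \<union> Y \<subseteq> {0..l}"
  proof -
    have "R * (pi - a) \<le> l" "R * (2 * pi - a) \<le> l" "0 \<le> R * a" "0 \<le> R * (pi + a)"
      using R a by (auto simp: l_def algebra_simps)
    then show ?thesis by (auto simp: X_def Y_def)
  qed
  have eX: "emeasure lborel X = ennreal (R * (pi - 2 * a))" "emeasure lborel Y = ennreal (R * (pi - 2 * a))"
    using R a by (auto simp: X_def Y_def algebra_simps intro: mult_left_mono)
  have "X \<inter> Y = {}"
  proof -
    have "R * (pi - a) \<le> R * (pi + a)" using R a by (intro mult_left_mono) auto
    then show ?thesis by (auto simp: X_def Y_def)
  qed
  then have "emeasure lborel (X \<union> Y) = emeasure lborel X + emeasure lborel Y"
    by (intro plus_emeasure[symmetric]) (auto simp: X_def Y_def)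
  also have "\<dots> = ennreal (2 * R * (pi - 2 * a))"
    unfolding eX using R a by (subst ennreal_plus[symmetric]) auto
  finally have eXY: "emeasure lborel (X \<union> Y) = ennreal (2 * R * (pi - 2 * a))" .
  have "emeasure lborel S = emeasure lborel {0..l} - emeasure lborel (X \<union> Y)"
    unfolding S
  proof (rule emeasure_Diff[OF _ _ _ XY])
    show "emeasure lborel (X \<union> Y) \<noteq> \<infinity>" using eXY by simp
  qed (simp_all add: X_def Y_def)
  also have "\<dots> = ennreal (l - 2 * R * (pi - 2 * a))"
    unfolding eXY using l R a by (subst ennreal_minus[symmetric]) auto
  \<comment> \<open>An angular size of \<open>4 * a\<close> out of \<open>2 * pi\<close>: arcs of
    half-width \<open>a\<close> about the two directions of the equator.\<close>
  also have "l - 2 * R * (pi - 2 * a) = 4 * R * a" by (simp add: l_def algebra_simps)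
  finally have eS: "emeasure lborel S = ennreal (4 * R * a)" .
  have S_sets: "S \<in> sets (restrict_space lborel {0..l})" and T_sets: "{0..l} \<in> sets (restrict_space lborel {0..l})"
    unfolding S by (auto simp: sets_restrict_space_iff X_def Y_def)
  have "emeasure (arc_law L) S = emeasure lborel ({0..l} \<inter> S) / emeasure lborel {0..l}"
    unfolding R_def[symmetric] l_def[symmetric] emeasure_uniform_measure[OF T_sets S_sets]
    by (subst (1 2) emeasure_restrict_space) (use S XY in \<open>auto simp: X_def Y_def\<close>)
  also have "{0..l} \<inter> S = S" by (auto simp: S_def)
  also have "emeasure lborel S / emeasure lborel {0..l} = ennreal (4 * R * a / l)"
    using l R a by (simp add: eS divide_ennreal)
  also have "4 * R * a / l = 2 * a / pi" using R by (simp add: l_def field_simps)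
  finally show ?thesis by (simp add: S_def l_def R_def a_def)
qed

lemma tan_ratio_le_iff:
  assumes "\<bar>z\<bar> \<le> L"
  shows "tan_ratio L z \<le> y \<longleftrightarrow> \<bar>sn z\<bar> * cs L \<le> sn L * cs z * y"
  using assms L cs_pos[of z] sn_L_pos[OF F L] by (simp add: tan_ratio_def divide_le_eq mult_ac)

text \<open>The hypothesis \<open>near\<close> compares sines, but crossing is about tangents. As
  \<open>(cs x)^2\<close> is an affine function of \<open>(sn x)^2\<close>, the comparison passes to
  tangents, so a needle that crosses any line also crosses the one with
  \<open>m = 0\<close>.\<close>

lemma hit_condition_nearest:
  assumes z: "\<bar>z\<bar> \<le> L" and near: "\<And>m::int. \<bar>sn z\<bar> \<le> \<bar>sn (2 * of_int m * L - z)\<bar>"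
  shows "(\<exists>m::int. crosses L (2 * of_int m * L - z) (cos \<theta>))
    \<longleftrightarrow> tan_ratio L z \<le> \<bar>cos \<theta>\<bar>"
proof -
  have csz: "cs z > 0" "cs L > 0" using z L by (auto intro!: cs_pos)
  show ?thesis unfolding tan_ratio_le_iff[OF z]
  proof
    assume "\<exists>m::int. crosses L (2 * of_int m * L - z) (cos \<theta>)"
    then obtain m :: int where m: "crosses L (2 * of_int m * L - z) (cos \<theta>)" by blast
    define w where "w = 2 * of_int m * L - z"
    note m = m[folded w_def] and near = near[of m, folded w_def]
    have "(sn z)\<^sup>2 \<le> (sn w)\<^sup>2" using near by (simp add: abs_le_square_iff)
    \<comment> \<open>After inserting \<open>cs_sq\<close> the terms with \<open>\<kappa>\<close>
      are the same on both sides.\<close>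
    then have "(sn z * cs w)\<^sup>2 \<le> (sn w * cs z)\<^sup>2"
      by (simp add: power_mult_distrib cs_sq algebra_simps)
    then have le: "\<bar>sn z\<bar> * \<bar>cs w\<bar> \<le> \<bar>sn w\<bar> * cs z"
      using csz by (simp add: abs_le_square_iff[symmetric] abs_mult)
    show "\<bar>sn z\<bar> * cs L \<le> sn L * cs z * \<bar>cos \<theta>\<bar>"
    proof (cases "cs w = 0")
      case True
      then have "sn w = 0" using m csz by (simp add: mult_le_0_iff)
      then show ?thesis using near sn_L_pos[OF F L] csz by simp
    next
      case False
      have "\<bar>sn z\<bar> * cs L * \<bar>cs w\<bar> = (\<bar>sn z\<bar> * \<bar>cs w\<bar>) * cs L" by simp
      also have "\<dots> \<le> (\<bar>sn w\<bar> * cs z) * cs L" using le csz by (intro mult_right_mono) auto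
      also have "\<dots> = (\<bar>sn w\<bar> * cs L) * cs z" by simp
      also have "\<dots> \<le> (sn L * \<bar>cs w\<bar> * \<bar>cos \<theta>\<bar>) * cs z" using m csz by (intro mult_right_mono) auto
      also have "\<dots> = sn L * cs z * \<bar>cos \<theta>\<bar> * \<bar>cs w\<bar>" by simp
      finally show ?thesis using False by simp
    qed
  next
    assume "\<bar>sn z\<bar> * cs L \<le> sn L * cs z * \<bar>cos \<theta>\<bar>"
    then show "\<exists>m::int. crosses L (2 * of_int m * L - z) (cos \<theta>)"
      using csz by (intro exI[of _ 0]) simp
  qed
qed

section \<open>The law of the needle and the hitting event\<close>

abbreviation (input) "tip_space \<equiv> (borel :: real measure) \<Otimes>\<^sub>M borel_of_metric M d"

lemma needle_law_frame:
  "needle_law M d L (\<lambda>u. F 0 u 0) t\<^sub>0 = bind (uniform_measure lborel {-L..L})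
     (\<lambda>z. distr (arc_law L) tip_space (\<lambda>\<tau>. (z, F (t\<^sub>0 + z) L (\<tau> / sn L))))"
proof -
  have "distr (uniform_on_curve M d (geodesic_circle M d (F 0 (t\<^sub>0 + z) 0) L)) tip_space (\<lambda>q. (z, q))
     = distr (arc_law L) tip_space (\<lambda>\<tau>. (z, F (t\<^sub>0 + z) L (\<tau> / sn L)))" for z
  proof -
    have "(\<lambda>\<tau>. F (t\<^sub>0 + z) L (0 + 1 / sn L * \<tau>)) \<in> restrict_space borel {0..2 * pi * sn L} \<rightarrow>\<^sub>M borel_of_metric M d"
      by (rule measurable_restrict_space1[OF frame_circle_measurable[OF F L]])
    then have "(\<lambda>\<tau>. F (t\<^sub>0 + z) L (\<tau> / sn L)) \<in> arc_law L \<rightarrow>\<^sub>M borel_of_metric M d"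
      using measurable_cong_sets[OF sets_arc_law refl] by simp
    then have "distr (distr (arc_law L) (borel_of_metric M d) (\<lambda>\<tau>. F (t\<^sub>0 + z) L (\<tau> / sn L))) tip_space (\<lambda>q. (z, q))
      = distr (arc_law L) tip_space ((\<lambda>q. (z, q)) \<circ> (\<lambda>\<tau>. F (t\<^sub>0 + z) L (\<tau> / sn L)))"
      by (intro distr_distr) simp_all
    then show ?thesis
      unfolding frame_center[OF F, of "t\<^sub>0 + z" 0, symmetric] circle_eq[OF F L] uniform_on_circle[OF F L]
      by (simp add: o_def)
  qed
  then show ?thesis unfolding needle_law_def by simp
qed

lemma needle_kernel_measurable:
  "(\<lambda>z. distr (arc_law L) tip_space (\<lambda>\<tau>. (z, F (t\<^sub>0 + z) L (\<tau> / sn L))))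
     \<in> uniform_measure lborel {-L..L} \<rightarrow>\<^sub>M subprob_algebra tip_space"
proof (rule measurable_distr2)
  show "(\<lambda>_. arc_law L) \<in> uniform_measure lborel {-L..L} \<rightarrow>\<^sub>M subprob_algebra (arc_law L)"
    by (rule measurable_const) (simp add: space_subprob_algebra arc.subprob_space_axioms)
  have a: "(\<lambda>x. (t\<^sub>0 + fst x, snd x / sn L)) \<in> borel \<Otimes>\<^sub>M borel \<rightarrow>\<^sub>M (borel \<Otimes>\<^sub>M borel :: (real \<times> real) measure)"
    by measurable
  have b: "(\<lambda>x. F (t\<^sub>0 + fst x) L (snd x / sn L)) \<in> borel \<Otimes>\<^sub>M borel \<rightarrow>\<^sub>M borel_of_metric M d"
    using measurable_compose[OF a frame_measurable[OF F, of L]] by simp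
  have c: "(\<lambda>x. (fst x, F (t\<^sub>0 + fst x) L (snd x / sn L))) \<in> borel \<Otimes>\<^sub>M borel \<rightarrow>\<^sub>M tip_space"
    by (intro measurable_Pair b) simp
  have i: "(\<lambda>x. x) \<in> arc_law L \<rightarrow>\<^sub>M borel"
    unfolding measurable_cong_sets[OF sets_arc_law refl]
    by (rule measurable_restrict_space1) simp
  have e: "(\<lambda>x. (fst x, snd x)) \<in> uniform_measure lborel {-L..L} \<Otimes>\<^sub>M arc_law L \<rightarrow>\<^sub>M borel \<Otimes>\<^sub>M borel"
    by (intro measurable_Pair measurable_compose[OF measurable_snd i]) simp
  from measurable_compose[OF e c]
  show "(\<lambda>(z, \<tau>). (z, F (t\<^sub>0 + z) L (\<tau> / sn L)))
      \<in> uniform_measure lborel {-L..L} \<Otimes>\<^sub>M arc_law L \<rightarrow>\<^sub>M tip_space"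
    by (simp add: case_prod_unfold)
qed

text \<open>The cosine of the needle's angle is read off from the distance between the tip and one
  further point of the equator, \<open>\<rho>\<close> ahead of the midpoint. No measurable choice of
  an angle has to be made.\<close>

lemma tip_cosine:
  assumes "q = F b L \<theta>"
  shows "cos \<theta> = 1 - (md (d (F 0 (b + \<rho>) 0) q) - md (L - \<rho>)) / (sn L * sn \<rho>)"
proof -
  have "sn \<rho> > 0" using rho_pos by (intro sn_pos) auto
  moreover have "md (d (F 0 (b + \<rho>) 0) q) = md (L - \<rho>) + sn L * sn \<rho> * (1 - cos \<theta>)"
    using law[OF F, of b L \<theta> \<rho> 0] frame_shift[OF F, of b \<rho>]
      commute[of "F 0 (b + \<rho>) 0" q] by (simp add: assms)
  ultimately show ?thesis using sn_L_pos[OF F L] by (simp add: field_simps)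
qed

lemma hit_event_measurable:
  "{(z, q). q \<in> M \<and> (\<exists>\<theta>. q = F (t\<^sub>0 + z) L \<theta> \<and> (\<exists>m::int. crosses L (2 * of_int m * L - z) (cos \<theta>)))} \<in> sets tip_space"
proof -
  \<comment> \<open>The cosine from \<open>tip_cosine\<close> as a measurable function of midpoint
    and tip; it eliminates the quantifier over angles, and only a countable union over
    \<open>m\<close> is left.\<close>
  define X where "X = (\<lambda>(z, q). 1 - (md (d (F 0 (t\<^sub>0 + \<rho> + z) 0) q) - md (L - \<rho>)) / (sn L * sn \<rho>))"
  have [measurable]: "sn \<in> borel_measurable borel" "cs \<in> borel_measurable borel" "md \<in> borel_measurable borel"
    using continuous_sn continuous_cs continuous_md by (auto intro: borel_measurable_continuous_onI)
  have Dm[measurable]: "(\<lambda>x. d (F 0 (b + fst x) 0) (snd x)) \<in> borel_measurable tip_space" for b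
    using dist_equator_measurable[OF F, of b] by (simp add: case_prod_unfold)
  have [measurable]: "X \<in> borel_measurable tip_space"
    unfolding X_def case_prod_unfold by measurable
  have "{(z, q). q \<in> M \<and> (\<exists>\<theta>. q = F (t\<^sub>0 + z) L \<theta> \<and> (\<exists>m::int. crosses L (2 * of_int m * L - z) (cos \<theta>)))}
    = {x \<in> space tip_space. d (F 0 (t\<^sub>0 + fst x) 0) (snd x) = L \<and>
        (\<exists>m::int. crosses L (2 * of_int m * L - fst x) (X x))}"
    (is "?A = ?B")
  proof (intro equalityI subsetI)
    fix x assume "x \<in> ?A"
    then obtain z q \<theta> where x: "x = (z, q)" "q \<in> M" "q = F (t\<^sub>0 + z) L \<theta>"
      and m: "\<exists>m::int. crosses L (2 * of_int m * L - z) (cos \<theta>)" by auto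
    have "X x = cos \<theta>" using tip_cosine[OF x(3)] by (simp add: X_def x(1) add_ac)
    moreover have "d (F 0 (t\<^sub>0 + z) 0) q = L"
      using frame_radius[OF F, of L "t\<^sub>0 + z" 0 \<theta>] frame_center[OF F, of "t\<^sub>0 + z" 0] L x(3) by simp
    ultimately show "x \<in> ?B" using x m space_borel_of_metric[OF F] by (simp add: space_pair_measure)
  next
    fix x assume xB: "x \<in> ?B"
    obtain z q where x: "x = (z, q)" by (cases x)
    have q: "q \<in> M" "d (F 0 (t\<^sub>0 + z) 0) q = L"
      using xB x space_borel_of_metric[OF F] by (auto simp: space_pair_measure)
    then obtain \<theta> where \<theta>: "q = F (t\<^sub>0 + z) L \<theta>"
      using frame_surj[OF F q(1), of "t\<^sub>0 + z"] frame_center[OF F, of "t\<^sub>0 + z" 0] by auto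
    have "X x = cos \<theta>" using tip_cosine[OF \<theta>] by (simp add: X_def x add_ac)
    then show "x \<in> ?A" using xB q \<theta> by (auto simp: x)
  qed
  also have "\<dots> \<in> sets tip_space" by measurable
  finally show ?thesis .
qed

theorem buffon_probability_frame:
  assumes G: "grating M d (\<lambda>u. F 0 u 0) L G" and t0: "F 0 t\<^sub>0 0 \<in> \<Union>G"
    and near: "\<And>(m::int) z. \<bar>z\<bar> \<le> L \<Longrightarrow> \<bar>sn z\<bar> \<le> \<bar>sn (2 * of_int m * L - z)\<bar>"
  shows "buffon_probability M d L (\<lambda>u. F 0 u 0) G t\<^sub>0 = hit_mean L"
proof -
  let ?\<mu> = "needle_law M d L (\<lambda>u. F 0 u 0) t\<^sub>0"
  let ?K = "\<lambda>z. distr (arc_law L) tip_space (\<lambda>\<tau>. (z, F (t\<^sub>0 + z) L (\<tau> / sn L)))"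
  have L': "L \<le> \<rho>" using L by simp
  have sets_\<mu>: "sets ?\<mu> = sets tip_space"
    unfolding needle_law_frame by (rule sets_bind) simp_all
  define hit where "hit z q \<longleftrightarrow> (\<exists>\<theta>. q = F (t\<^sub>0 + z) L \<theta> \<and> (\<exists>m::int. crosses L (2 * of_int m * L - z) (cos \<theta>)))" for z q
  define H where "H = {(z, q). q \<in> M \<and> hit z q}"
  have H_sets: "H \<in> sets tip_space" unfolding H_def hit_def by (rule hit_event_measurable)
  have hits_iff: "hits M d L (\<lambda>u. F 0 u 0) G t\<^sub>0 (z, q) = 1 \<longleftrightarrow> hit z q" for z q
    unfolding hits_def hit_def needle_hits_grating_iff[OF F L(1) L' G t0, symmetric] by simp
  have H: "{\<omega> \<in> space ?\<mu>. hits M d L (\<lambda>u. F 0 u 0) G t\<^sub>0 \<omega> = 1} = H"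
    unfolding sets_eq_imp_space_eq[OF sets_\<mu>] using hits_iff space_borel_of_metric[OF F]
    by (auto simp: space_pair_measure H_def)
  \<comment> \<open>The indicator is built in so that the substitution \<open>z = L * u\<close> can
    be made over the whole line.\<close>
  define g where "g u = indicator {-1..1} u * (arccos (tan_ratio L (L * u)) / pi)" for u :: real
  have g_meas[measurable]: "g \<in> borel_measurable borel"
    using borel_measurable_continuous_on_indicator[OF _ continuous_arccos_tan_ratio[OF L(1) L']]
    by (simp add: g_def[abs_def])
  have range: "0 \<le> tan_ratio L z" "tan_ratio L z \<le> 1" if "\<bar>z\<bar> \<le> L" for z
    using tan_ratio_range[OF that L(1) L'] by auto
  have g_nonneg: "0 \<le> g u" for u
  proof (cases "u \<in> {-1..1}")
    case True
    then have "\<bar>L * u\<bar> \<le> L" using L by (auto simp: abs_mult)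
    then show ?thesis using range[of "L * u"] by (auto simp: g_def intro!: mult_nonneg_nonneg divide_nonneg_pos arccos_lbound)
  qed (simp add: g_def)
  have hit_mean_g: "hit_mean L = (LINT u|lborel. g u)"
    by (simp add: hit_mean_def set_lebesgue_integral_def g_def)
  have hit_mean_nonneg: "0 \<le> hit_mean L"
    unfolding hit_mean_g by (rule Bochner_Integration.integral_nonneg) (rule g_nonneg)
  have kernel: "emeasure (?K z) H = ennreal (2 * arccos (tan_ratio L z) / pi)" if z: "\<bar>z\<bar> \<le> L" for z
  proof -
    have "(\<lambda>\<tau>. F (t\<^sub>0 + z) L (0 + 1 / sn L * \<tau>)) \<in> restrict_space borel {0..2 * pi * sn L} \<rightarrow>\<^sub>M borel_of_metric M d"
      by (rule measurable_restrict_space1[OF frame_circle_measurable[OF F L]])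
    then have "(\<lambda>\<tau>. F (t\<^sub>0 + z) L (\<tau> / sn L)) \<in> arc_law L \<rightarrow>\<^sub>M borel_of_metric M d"
      using measurable_cong_sets[OF sets_arc_law refl] by simp
    then have "(\<lambda>\<tau>. (z, F (t\<^sub>0 + z) L (\<tau> / sn L))) \<in> arc_law L \<rightarrow>\<^sub>M tip_space"
      by (intro measurable_Pair) simp_all
    then have "emeasure (?K z) H = emeasure (arc_law L)
        ((\<lambda>\<tau>. (z, F (t\<^sub>0 + z) L (\<tau> / sn L))) -` H \<inter> space (arc_law L))"
      by (rule emeasure_distr[OF _ H_sets])
    also have "(\<lambda>\<tau>. (z, F (t\<^sub>0 + z) L (\<tau> / sn L))) -` H \<inter> space (arc_law L)
        = {\<tau> \<in> {0..2 * pi * sn L}. tan_ratio L z \<le> \<bar>cos (\<tau> / sn L)\<bar>}"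
    proof -
      have "(z, F (t\<^sub>0 + z) L \<alpha>) \<in> H \<longleftrightarrow> tan_ratio L z \<le> \<bar>cos \<alpha>\<bar>" for \<alpha>
      proof -
        have "(z, F (t\<^sub>0 + z) L \<alpha>) \<in> H \<longleftrightarrow> (\<exists>m::int. crosses L (2 * of_int m * L - z) (cos \<alpha>))"
        proof -
          have "cos \<theta> = cos \<alpha>" if "F (t\<^sub>0 + z) L \<alpha> = F (t\<^sub>0 + z) L \<theta>" for \<theta>
            using tip_cosine[OF that] tip_cosine[of "F (t\<^sub>0 + z) L \<alpha>" "t\<^sub>0 + z" \<alpha>] by simp
          then have "hit z (F (t\<^sub>0 + z) L \<alpha>) \<longleftrightarrow> (\<exists>m::int. crosses L (2 * of_int m * L - z) (cos \<alpha>))"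
            unfolding hit_def by metis
          then show ?thesis unfolding H_def using frame_in[OF F] by simp
        qed
        then show ?thesis using hit_condition_nearest[OF z near[OF z]] by simp
      qed
      then show ?thesis by (auto simp: space_restrict_space)
    qed
    also have "emeasure (arc_law L) \<dots> = ennreal (2 * arccos (tan_ratio L z) / pi)"
      by (rule emeasure_arc_law_cos) (use range[OF z] in auto)
    finally show ?thesis .
  qed
  have "emeasure ?\<mu> H = (\<integral>\<^sup>+z. emeasure (?K z) H \<partial>uniform_measure lborel {-L..L})"
    unfolding needle_law_frame by (rule emeasure_bind[OF _ needle_kernel_measurable H_sets]) simp
  also have "\<dots> = (\<integral>\<^sup>+z. ennreal (2 * g (z / L)) \<partial>uniform_measure lborel {-L..L})"
  proof (rule nn_integral_cong_AE)
    \<comment> \<open>The formula for the kernel is known for \<open>\<bar>z\<bar> \<le> L\<close>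
      only, which holds almost surely.\<close>
    have "AE z in uniform_measure lborel {-L..L}. z \<in> {-L..L}"
      using L by (intro AE_uniform_measureI) auto
    then show "AE z in uniform_measure lborel {-L..L}. emeasure (?K z) H = ennreal (2 * g (z / L))"
    proof eventually_elim
      case (elim z)
      then have "\<bar>z\<bar> \<le> L" "z / L \<in> {-1..1}" using L by (auto simp: field_simps)
      then show ?case using L by (simp add: kernel g_def)
    qed
  qed
  also have "\<dots> = (\<integral>\<^sup>+z. ennreal (2 * g (z / L)) * indicator {-L..L} z \<partial>lborel) / emeasure lborel {-L..L}"
    by (rule nn_integral_uniform_measure) simp_all
  also have "(\<integral>\<^sup>+z. ennreal (2 * g (z / L)) * indicator {-L..L} z \<partial>lborel) = (\<integral>\<^sup>+z. ennreal (2 * g (z / L)) \<partial>lborel)"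
    using L by (intro nn_integral_cong) (auto simp: g_def indicator_def field_simps)
  also have "\<dots> = ennreal \<bar>L\<bar> * (\<integral>\<^sup>+u. ennreal (2 * g ((0 + L * u) / L)) \<partial>lborel)"
    using L by (intro nn_integral_real_affine) auto
  also have "\<dots> = ennreal L * (\<integral>\<^sup>+u. ennreal (2 * g u) \<partial>lborel)"
    using L by simp
  also have "(\<integral>\<^sup>+u. ennreal (2 * g u) \<partial>lborel) = ennreal (2 * hit_mean L)"
  proof -
    have "set_integrable lborel {-1..1} (\<lambda>u. arccos (tan_ratio L (L * u)) / pi)"
      by (intro borel_integrable_atLeastAtMost' continuous_arccos_tan_ratio L L')
    then have i: "integrable lborel g" by (simp add: set_integrable_def g_def[abs_def])
    have "(\<integral>\<^sup>+u. ennreal (2 * g u) \<partial>lborel) = ennreal (LINT u|lborel. 2 * g u)"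
      using i g_nonneg by (intro nn_integral_eq_integral) auto
    also have "(LINT u|lborel. 2 * g u) = 2 * hit_mean L"
      by (simp add: hit_mean_g)
    finally show ?thesis .
  qed
  \<comment> \<open>\<open>hit_mean\<close> has \<open>1 / pi\<close> where the kernel has
    \<open>2 / pi\<close>: the length \<open>2 * L\<close> of the midpoint's interval cancels both
    the 2 and the \<open>L\<close> of the substitution.\<close>
  also have "ennreal L * ennreal (2 * hit_mean L) / emeasure lborel {-L..L} = ennreal (hit_mean L)"
    using L hit_mean_nonneg by (simp add: ennreal_mult[symmetric] divide_ennreal)
  finally have "emeasure ?\<mu> H = ennreal (hit_mean L)" .
  then show ?thesis unfolding buffon_probability_def H using hit_mean_nonneg by (simp add: measure_def)
qed

end

end

theorem buffon_probability_eq: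
  assumes "complete_geodesic M d E" "grating M d E L G" "E t\<^sub>0 \<in> \<Union>G" "0 < L" "2 * L \<le> \<rho>"
    and "\<And>(m::int) z. \<bar>z\<bar> \<le> L \<Longrightarrow> \<bar>sn z\<bar> \<le> \<bar>sn (2 * of_int m * L - z)\<bar>"
  shows "buffon_probability M d L E G t\<^sub>0 = hit_mean L"
proof -
  obtain F where F: "frame M d F" "\<And>u. E u = F 0 u 0"
    by (rule complete_geodesic_frame[OF assms(1)]) blast
  then have "E = (\<lambda>u. F 0 u 0)" by auto
  then show ?thesis using buffon_probability_frame[OF F(1), of L G t\<^sub>0] assms by simp
qed

end

section \<open>Recognizing the distance of a model\<close>

text \<open>A frame speaks only of membership and distances, so it is carried back along the inverse
  of the isometry clause by clause.\<close>

lemma (in trig) cc_space_isometric: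
  fixes M :: "'a set" and N :: "'b set"
  assumes "Metric_space M d"
    and f: "bij_betw f M N" "\<And>x y. x \<in> M \<Longrightarrow> y \<in> M \<Longrightarrow> e (f x) (f y) = d x y"
    and le: "\<And>x y u. x \<in> N \<Longrightarrow> y \<in> N \<Longrightarrow> 0 \<le> u \<Longrightarrow> u \<le> \<rho> \<Longrightarrow> md (e x y) \<le> md u \<longleftrightarrow> e x y \<le> u"
    and frames: "\<And>p q. p \<in> N \<Longrightarrow> q \<in> N \<Longrightarrow> p \<noteq> q \<Longrightarrow> e p q \<le> \<rho> \<Longrightarrow>
        \<exists>F. frame N e F \<and> F 0 0 0 = p \<and> F 0 (e p q) 0 = q"
  shows "cc_space \<kappa> \<rho> sn cs md M d"
proof -
  interpret Metric_space M d by fact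
  define f' where "f' = inv_into M f"
  have f': "f' y \<in> M" "f (f' y) = y" if "y \<in> N" for y
    using bij_betw_inv_into[OF f(1)] bij_betw_inv_into_right[OF f(1)] that
    by (auto simp: f'_def bij_betw_def)
  have ff: "f x \<in> N" "f' (f x) = x" if "x \<in> M" for x
    using f(1) bij_betw_inv_into_left[OF f(1)] that by (auto simp: f'_def bij_betw_def)
  have df': "d (f' x) (f' y) = e x y" if "x \<in> N" "y \<in> N" for x y
    using f(2)[of "f' x" "f' y"] f' that by simp
  show ?thesis
  proof
    fix p q assume pq: "p \<in> M" "q \<in> M" "p \<noteq> q" "d p q \<le> \<rho>"
    then have "f p \<noteq> f q" using ff by metis
    then obtain F where F: "frame N e F" "F 0 0 0 = f p" "F 0 (d p q) 0 = f q"
      using frames[of "f p" "f q"] ff f(2)[of p q] pq by auto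
    have FN: "F w s \<theta> \<in> N" for w s \<theta> using F(1) by (simp add: frame_def)
    have "frame M d (\<lambda>w s \<theta>. f' (F w s \<theta>))"
      unfolding frame_def
    proof (intro conjI allI ballI)
      show "f' (F w s \<theta>) \<in> M" for w s \<theta> using f' FN by blast
      show "md (d (f' (F w s \<alpha>)) (f' (F w t \<beta>))) = md (s - t) + sn s * sn t * (1 - cos (\<alpha> - \<beta>))"
        for w s t \<alpha> \<beta> using F(1) by (simp add: df'[OF FN FN] frame_def)
      show "f' (F w s 0) = f' (F 0 (w + s) 0)" for w s using F(1) by (simp add: frame_def)
      fix q assume q: "q \<in> M"
      have de: "d q (f' y) = e (f q) y" "d (f' y) q = e y (f q)" if "y \<in> N" for y
        using df'[OF ff(1)[OF q] that] df'[OF that ff(1)[OF q]] ff(2)[OF q] by simp_all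
      show "\<exists>\<theta>. q = f' (F w (d (f' (F w 0 0)) q) \<theta>)" for w
      proof -
        obtain \<theta> where "f q = F w (e (F w 0 0) (f q)) \<theta>" using F(1) ff(1)[OF q] unfolding frame_def by blast
        then show ?thesis using ff(2)[OF q] by (metis de(2)[OF FN])
      qed
      show "continuous_on UNIV (\<lambda>(w, \<theta>). md (d q (f' (F w s \<theta>))))" for s
        using F(1) ff(1)[OF q] by (simp add: de(1)[OF FN] frame_def)
    qed
    then show "\<exists>F. frame M d F \<and> F 0 0 0 = p \<and> F 0 (d p q) 0 = q"
      using F ff pq by (intro exI[of _ "\<lambda>w s \<theta>. f' (F w s \<theta>)"]) auto
  next
    fix x y u assume "x \<in> M" "y \<in> M" "0 \<le> u" "u \<le> \<rho>"
    then show "md (d x y) \<le> md u \<longleftrightarrow> d x y \<le> u" using le[of "f x" "f y" u] f(2)[of x y] ff by simp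
  qed
qed

text \<open>The triangle inequality through the pole, at the level of \<open>md\<close>: opposite
  directions are the worst case.\<close>

lemma (in trig) md_polar_le:
  assumes "0 \<le> sn s" "0 \<le> sn t"
  shows "md (s - t) + sn s * sn t * (1 - cos \<phi>) \<le> md (s + t)"
proof -
  have "sn s * sn t * (1 - cos \<phi>) \<le> sn s * sn t * 2"
    using assms cos_ge_minus_one[of \<phi>] by (intro mult_left_mono) auto
  then show ?thesis using md_add_minus_diff[of s t] by simp
qed

text \<open>
  Here \<open>D\<close> is an explicit candidate for the Riemannian distance.  Since \<open>2 md (D x y) = \<gamma> x y |x - y|\<^sup>2\<close> and
  \<open>2 md u \<sim> u\<^sup>2\<close>, the metric derivative of a \<open>C1\<close> curve with respect to \<open>D\<close> is its Riemannian speed.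
\<close>

locale conformal_model = trig +
  fixes S :: "'b::euclidean_space set" and g :: "'b \<Rightarrow> 'b \<Rightarrow> 'b \<Rightarrow> real"
    and D :: "'b \<Rightarrow> 'b \<Rightarrow> real" and \<gamma> :: "'b \<Rightarrow> 'b \<Rightarrow> real"
  assumes D_nonneg: "x \<in> S \<Longrightarrow> y \<in> S \<Longrightarrow> 0 \<le> D x y"
    and D_sym: "x \<in> S \<Longrightarrow> y \<in> S \<Longrightarrow> D x y = D y x"
    and D_triangle: "x \<in> S \<Longrightarrow> y \<in> S \<Longrightarrow> z \<in> S \<Longrightarrow> D x z \<le> D x y + D y z"
    and md_D_le: "x \<in> S \<Longrightarrow> y \<in> S \<Longrightarrow> 0 \<le> u \<Longrightarrow> u \<le> \<rho> \<Longrightarrow> md (D x y) \<le> md u \<longleftrightarrow> D x y \<le> u"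
    and md_D: "x \<in> S \<Longrightarrow> y \<in> S \<Longrightarrow> md (D x y) = \<gamma> x y * (norm (x - y))\<^sup>2 / 2"
    and \<gamma>_cont: "continuous_on (S \<times> S) (\<lambda>(x, y). \<gamma> x y)"
    and \<gamma>_nonneg: "x \<in> S \<Longrightarrow> 0 \<le> \<gamma> x x"
    and g_eq: "x \<in> S \<Longrightarrow> g x v v = \<gamma> x x * (norm v)\<^sup>2"
    and minimal_curve: "x \<in> S \<Longrightarrow> y \<in> S \<Longrightarrow> \<exists>c. c C1_differentiable_on {0..1} \<and> c ` {0..1} \<subseteq> S \<and>
        c 0 = x \<and> c 1 = y \<and> (\<forall>s\<in>{0..1}. \<forall>t\<in>{0..1}. D (c s) (c t) = \<bar>s - t\<bar> * D x y)"
begin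

lemma D_self: "x \<in> S \<Longrightarrow> D x x = 0"
  using md_D_le[of x x 0] md_D[of x x] D_nonneg[of x x] rho_pos by simp

context
  fixes c :: "real \<Rightarrow> 'b"
  assumes C1: "c C1_differentiable_on {0..1}" and cS: "c ` {0..1} \<subseteq> S"
begin

definition speed :: "real \<Rightarrow> real" where
  "speed t = sqrt (g (c t) (vector_derivative c (at t)) (vector_derivative c (at t)))"

lemma c_in: "t \<in> {0..1} \<Longrightarrow> c t \<in> S"
  using cS by auto

lemma c_derivative: "t \<in> {0..1} \<Longrightarrow> (c has_vector_derivative vector_derivative c (at t)) (at t)"
  using C1 unfolding C1_differentiable_on_eq by (simp add: vector_derivative_works)

lemma c_continuous: "continuous_on {0..1} c"
  using c_derivative by (intro continuous_at_imp_continuous_on ballI) (blast intro: has_vector_derivative_continuous)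

lemma speed_eq: "t \<in> {0..1} \<Longrightarrow> speed t = sqrt (\<gamma> (c t) (c t)) * norm (vector_derivative c (at t))"
  using c_in by (simp add: speed_def g_eq real_sqrt_mult)

lemma \<gamma>_c_tendsto:
  assumes t: "t \<in> {0..1}" shows "((\<lambda>y. \<gamma> (c t) (c y)) \<longlongrightarrow> \<gamma> (c t) (c t)) (at t within {0..1})"
proof -
  have "continuous_on {0..1} (\<lambda>y. (\<lambda>(x, y). \<gamma> x y) (c t, c y))"
    by (rule continuous_on_compose2[OF \<gamma>_cont]) (use t c_in c_continuous in \<open>auto intro!: continuous_intros\<close>)
  then show ?thesis using t by (simp add: continuous_on_def)
qed

lemma speed_continuous: "continuous_on {0..1} speed"
proof -
  have "continuous_on {0..1} (\<lambda>y. (\<lambda>(x, y). \<gamma> x y) (c y, c y))"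
    by (rule continuous_on_compose2[OF \<gamma>_cont]) (use c_in c_continuous in \<open>auto intro!: continuous_intros\<close>)
  moreover have "continuous_on {0..1} (\<lambda>t. vector_derivative c (at t))"
    using C1 by (simp add: C1_differentiable_on_eq)
  ultimately have "continuous_on {0..1} (\<lambda>t. sqrt (\<gamma> (c t) (c t)) * norm (vector_derivative c (at t)))"
    by (intro continuous_intros) auto
  then show ?thesis by (rule continuous_on_eq) (simp add: speed_eq)
qed

lemma metric_derivative:
  assumes t: "t \<in> {0..1}"
  shows "((\<lambda>y. D (c t) (c y) / \<bar>y - t\<bar>) \<longlongrightarrow> speed t) (at t within {0..1})"
proof -
  let ?F = "at t within {0..1}" and ?v = "vector_derivative c (at t)"
  have in01: "\<forall>\<^sub>F y in ?F. y \<in> {0..1}" by (auto simp: eventually_at intro!: exI[of _ 1])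
  have lc: "(c \<longlongrightarrow> c t) ?F" using c_continuous t by (simp add: continuous_on_def)
  have "((\<lambda>y. \<gamma> (c t) (c y) * (norm (c t - c y))\<^sup>2 / 2) \<longlongrightarrow> \<gamma> (c t) (c t) * (norm (c t - c t))\<^sup>2 / 2) ?F"
    by (intro tendsto_intros \<gamma>_c_tendsto t lc) auto
  then have "((\<lambda>y. \<gamma> (c t) (c y) * (norm (c t - c y))\<^sup>2 / 2) \<longlongrightarrow> 0) ?F" by simp
  then have l0: "((\<lambda>y. md (D (c t) (c y))) \<longlongrightarrow> 0) ?F"
    by (rule Lim_transform_eventually) (use in01 in eventually_elim, use md_D c_in t in auto)
  have D0: "((\<lambda>y. D (c t) (c y)) \<longlongrightarrow> 0) ?F"
    by (rule tendsto_0_if_md_tendsto_0[OF l0])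
      (use in01 in eventually_elim, use md_D_le D_nonneg c_in t in auto)
  have "((\<lambda>y. (1 / (y - t)) *\<^sub>R (c y - c t)) \<longlongrightarrow> ?v) (at t)"
  proof -
    have "((\<lambda>y. (c y - (c t + (y - t) *\<^sub>R ?v)) /\<^sub>R norm (y - t)) \<longlongrightarrow> 0) (at t)"
      using c_derivative[OF t] by (simp add: has_vector_derivative_def has_derivative_at2 inverse_eq_divide)
    then have "((\<lambda>y. norm ((c y - (c t + (y - t) *\<^sub>R ?v)) /\<^sub>R norm (y - t))) \<longlongrightarrow> 0) (at t)"
      by (rule tendsto_norm_zero)
    then have "((\<lambda>y. norm ((1 / (y - t)) *\<^sub>R (c y - c t) - ?v)) \<longlongrightarrow> 0) (at t)"
    proof (rule Lim_transform_eventually)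
      show "\<forall>\<^sub>F y in at t. norm ((c y - (c t + (y - t) *\<^sub>R ?v)) /\<^sub>R norm (y - t))
          = norm ((1 / (y - t)) *\<^sub>R (c y - c t) - ?v)"
        unfolding eventually_at
      proof (intro exI[of _ 1] conjI ballI impI)
        fix y :: real assume "y \<noteq> t \<and> dist y t < 1"
        then have "(1 / (y - t)) *\<^sub>R (c y - c t) - ?v = (1 / (y - t)) *\<^sub>R (c y - (c t + (y - t) *\<^sub>R ?v))"
          by (simp add: scaleR_diff_right scaleR_add_right)
        then show "norm ((c y - (c t + (y - t) *\<^sub>R ?v)) /\<^sub>R norm (y - t))
          = norm ((1 / (y - t)) *\<^sub>R (c y - c t) - ?v)"
          by (simp add: divide_inverse)
      qed simp
    qed
    then show ?thesis by (simp add: tendsto_norm_zero_iff LIM_zero_iff)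
  qed
  then have "((\<lambda>y. (1 / (y - t)) *\<^sub>R (c y - c t)) \<longlongrightarrow> ?v) ?F"
    by (rule filterlim_mono[OF _ order_refl at_le]) simp
  then have "((\<lambda>y. \<gamma> (c t) (c y) * (norm ((1 / (y - t)) *\<^sub>R (c y - c t)))\<^sup>2 / 2)
      \<longlongrightarrow> \<gamma> (c t) (c t) * (norm ?v)\<^sup>2 / 2) ?F"
    by (intro tendsto_intros \<gamma>_c_tendsto t) auto
  moreover have "\<gamma> (c t) (c t) * (norm ?v)\<^sup>2 / 2 = (speed t)\<^sup>2 / 2"
    using t c_in \<gamma>_nonneg by (simp add: speed_eq power_mult_distrib)
  moreover have "\<forall>\<^sub>F y in ?F. \<gamma> (c t) (c y) * (norm ((1 / (y - t)) *\<^sub>R (c y - c t)))\<^sup>2 / 2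
      = md (D (c t) (c y)) / (y - t)\<^sup>2"
    using in01
  proof eventually_elim
    case (elim y)
    have md_eq: "md (D (c t) (c y)) = \<gamma> (c t) (c y) * (norm (c y - c t))\<^sup>2 / 2"
      using md_D[of "c t" "c y"] c_in t elim by (simp add: norm_minus_commute)
    show ?case unfolding md_eq by (simp add: power_mult_distrib power_divide)
  qed
  ultimately have "((\<lambda>y. md (D (c t) (c y)) / (y - t)\<^sup>2) \<longlongrightarrow> (speed t)\<^sup>2 / 2) ?F"
    using Lim_transform_eventually by force
  from md_asymptotics[OF D0 this]
  have "((\<lambda>y. \<bar>D (c t) (c y)\<bar> / \<bar>y - t\<bar>) \<longlongrightarrow> speed t) ?F"
    using t c_in \<gamma>_nonneg by (simp add: speed_eq)
  then show ?thesis
    by (rule Lim_transform_eventually) (use in01 in eventually_elim, use D_nonneg c_in t in auto)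
qed

text \<open>The bound on the metric derivative is integrated by bisection: with a slack
  \<open>\<epsilon>\<close> the inequality is additive over adjacent intervals and holds on all
  short intervals around each point.\<close>

lemma D_le_length: "D (c 0) (c 1) \<le> riem_length g c"
proof (rule field_le_epsilon)
  fix \<epsilon> :: real assume \<epsilon>: "0 < \<epsilon>"
  \<comment> \<open>The guards make \<open>P\<close> trivial for intervals that leave
    \<open>[0, 1]\<close>, which the bisection principle also asks about near the ends.\<close>
  define P where "P a b \<longleftrightarrow> (0 \<le> a \<longrightarrow> b \<le> 1 \<longrightarrow> D (c a) (c b) \<le> integral {a..b} speed + \<epsilon> * (b - a))" for a b
  have "P 0 1"
  proof (rule Bolzano[of 0 1])
    fix a b e :: real
    assume 1: "P a b" and 2: "P b e" and ab: "a \<le> b" "b \<le> e"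
    show "P a e" unfolding P_def
    proof (intro impI)
      assume ae: "0 \<le> a" "e \<le> 1"
      have "speed integrable_on {a..e}"
        using ae by (intro integrable_continuous_real continuous_on_subset[OF speed_continuous]) auto
      then have "integral {a..b} speed + integral {b..e} speed = integral {a..e} speed"
        using ab by (intro Henstock_Kurzweil_Integration.integral_combine) auto
      moreover have "D (c a) (c e) \<le> D (c a) (c b) + D (c b) (c e)"
        using ae ab c_in by (intro D_triangle) auto
      ultimately show "D (c a) (c e) \<le> integral {a..e} speed + \<epsilon> * (e - a)"
        using 1 2 ab ae by (simp add: P_def algebra_simps)
    qed
  next
    fix t :: real assume t: "0 \<le> t" "t \<le> 1"
    have "\<forall>\<^sub>F y in at t within {0..1}. D (c t) (c y) / \<bar>y - t\<bar> < speed t + \<epsilon> / 2"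
      using order_tendstoD(2)[OF metric_derivative, of t "speed t + \<epsilon> / 2"] t \<epsilon> by auto
    then obtain \<delta>1 where \<delta>1: "\<delta>1 > 0"
      "\<And>y. y \<in> {0..1} \<Longrightarrow> y \<noteq> t \<Longrightarrow> \<bar>y - t\<bar> < \<delta>1 \<Longrightarrow> D (c t) (c y) / \<bar>y - t\<bar> < speed t + \<epsilon> / 2"
      by (auto simp: eventually_at dist_real_def)
    have near: "D (c t) (c y) \<le> (speed t + \<epsilon> / 2) * \<bar>y - t\<bar>" if "y \<in> {0..1}" "\<bar>y - t\<bar> < \<delta>1" for y
    proof (cases "y = t")
      case True
      then show ?thesis using D_self[OF c_in[of t]] t by simp
    next
      case False
      then show ?thesis using \<delta>1(2)[OF that(1) False that(2)] by (simp add: divide_less_eq)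
    qed
    \<comment> \<open>One half of \<open>\<epsilon>\<close> pays for the metric derivative, the
      other for the variation of the speed.\<close>
    obtain \<delta>2 where \<delta>2: "\<delta>2 > 0" "\<And>y. y \<in> {0..1} \<Longrightarrow> \<bar>y - t\<bar> < \<delta>2 \<Longrightarrow> \<bar>speed y - speed t\<bar> < \<epsilon> / 2"
      using speed_continuous t \<epsilon> unfolding continuous_on_iff dist_real_def
      by (metis atLeastAtMost_iff half_gt_zero)
    show "\<exists>\<delta>>0. \<forall>a b. a \<le> t \<and> t \<le> b \<and> b - a < \<delta> \<longrightarrow> P a b"
      unfolding P_def
    proof (intro exI[of _ "min \<delta>1 \<delta>2"] conjI allI impI)
      fix a b assume ab: "a \<le> t \<and> t \<le> b \<and> b - a < min \<delta>1 \<delta>2" "0 \<le> a" "b \<le> 1"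
      have "D (c a) (c b) \<le> D (c a) (c t) + D (c t) (c b)"
        using ab c_in by (intro D_triangle) auto
      also have "D (c a) (c t) = D (c t) (c a)" using ab c_in by (intro D_sym) auto
      also have "D (c t) (c a) + D (c t) (c b) \<le> (speed t + \<epsilon> / 2) * (b - a)"
      proof -
        have "D (c t) (c a) \<le> (speed t + \<epsilon> / 2) * (t - a)" "D (c t) (c b) \<le> (speed t + \<epsilon> / 2) * (b - t)"
          using near[of a] near[of b] ab by auto
        moreover have "(speed t + \<epsilon> / 2) * (t - a) + (speed t + \<epsilon> / 2) * (b - t) = (speed t + \<epsilon> / 2) * (b - a)"
          unfolding distrib_left[symmetric] by simp
        ultimately show ?thesis by linarith
      qed
      finally have 1: "D (c a) (c b) \<le> (speed t + \<epsilon> / 2) * (b - a)" .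
      have "(b - a) *\<^sub>R (speed t - \<epsilon> / 2) = integral {a..b} (\<lambda>_. speed t - \<epsilon> / 2)"
        using ab by simp
      also have "\<dots> \<le> integral {a..b} speed"
      proof (rule integral_le)
        show "speed integrable_on {a..b}"
          using ab by (intro integrable_continuous_real continuous_on_subset[OF speed_continuous]) auto
        fix y assume y: "y \<in> {a..b}"
        then have "\<bar>y - t\<bar> < \<delta>2" using ab by auto
        moreover have "y \<in> {0..1}" using ab y by auto
        ultimately have "\<bar>speed y - speed t\<bar> < \<epsilon> / 2" by (intro \<delta>2(2))
        then show "speed t - \<epsilon> / 2 \<le> speed y" by linarith
      qed auto
      finally have "(b - a) * (speed t - \<epsilon> / 2) \<le> integral {a..b} speed" by simp
      moreover have "(speed t + \<epsilon> / 2) * (b - a) = (b - a) * (speed t - \<epsilon> / 2) + \<epsilon> * (b - a)"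
        by (simp add: field_simps)
      ultimately show "D (c a) (c b) \<le> integral {a..b} speed + \<epsilon> * (b - a)"
        using 1 by linarith
    qed (use \<delta>1 \<delta>2 in auto)
  qed simp
  then show "D (c 0) (c 1) \<le> riem_length g c + \<epsilon>"
    by (simp add: P_def riem_length_def speed_def[abs_def])
qed

lemma length_eq_if_constant_speed:
  assumes "\<And>s t. s \<in> {0..1} \<Longrightarrow> t \<in> {0..1} \<Longrightarrow> D (c s) (c t) = \<bar>s - t\<bar> * a"
  shows "riem_length g c = a"
proof -
  have "speed t = a" if t: "t \<in> {0..1}" for t
  proof -
    have "((\<lambda>y. D (c t) (c y) / \<bar>y - t\<bar>) \<longlongrightarrow> a) (at t within {0..1})"
    proof (rule Lim_transform_eventually[OF tendsto_const])
      show "\<forall>\<^sub>F y in at t within {0..1}. a = D (c t) (c y) / \<bar>y - t\<bar>"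
        using assms t by (auto simp: eventually_at abs_minus_commute intro!: exI[of _ 1])
    qed
    moreover have "at t within {0..1} \<noteq> bot" 
      using t connected_imp_perfect[of "{0..1::real}" t] by (auto simp: trivial_limit_within)
    ultimately show ?thesis using tendsto_unique metric_derivative[OF t] by blast
  qed
  note speed_a = this
  have "integral {0..1} speed = integral {0..1::real} (\<lambda>_. a)"
    by (rule Henstock_Kurzweil_Integration.integral_cong) (rule speed_a)
  then show ?thesis by (simp add: riem_length_def speed_def[abs_def])
qed

end

theorem riem_dist_eq:
  assumes x: "x \<in> S" and y: "y \<in> S" shows "riem_dist S g x y = D x y"
proof -
  let ?C = "{riem_length g c | c. c C1_differentiable_on {0..1} \<and> path_image c \<subseteq> S \<and>
                                     pathstart c = x \<and> pathfinish c = y}"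
  have lower: "D x y \<le> a" if "a \<in> ?C" for a
    using that D_le_length by (auto simp: path_image_def pathstart_def pathfinish_def)
  obtain c where c: "c C1_differentiable_on {0..1}" "c ` {0..1} \<subseteq> S" "c 0 = x" "c 1 = y"
    "\<And>s t. s \<in> {0..1} \<Longrightarrow> t \<in> {0..1} \<Longrightarrow> D (c s) (c t) = \<bar>s - t\<bar> * D x y"
    using minimal_curve[OF x y] by blast
  have "D x y \<in> ?C"
    using length_eq_if_constant_speed[OF c(1,2) c(5)] c
    by (intro CollectI exI[of _ c]) (auto simp: path_image_def pathstart_def pathfinish_def)
  then have "Inf ?C = D x y" using lower by (intro cInf_eq_minimum) auto
  then show ?thesis using x y by (simp add: riem_dist_def)
qed

end

section \<open>The plane and the sphere\<close>

lemma polar_coordinates: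
  "\<exists>\<theta>. x = sqrt (x\<^sup>2 + y\<^sup>2) * cos \<theta> \<and> y = sqrt (x\<^sup>2 + y\<^sup>2) * sin \<theta>"
proof -
  have "Complex x y = rcis (cmod (Complex x y)) (Arg (Complex x y))" by (simp add: rcis_cmod_Arg)
  then show ?thesis by (intro exI[of _ "Arg (Complex x y)"]) (simp add: rcis_def complex_eq_iff cmod_def)
qed

section \<open>The Euclidean plane\<close>

lemma trig_plane: "trig 0 1 (\<lambda>x. x) (\<lambda>x. 1) (\<lambda>x. x\<^sup>2 / 2)"
proof
  show "((\<lambda>x. x / x) \<longlongrightarrow> (1::real)) (at 0)"
    by (rule Lim_transform_eventually[OF tendsto_const]) (auto simp: eventually_at intro!: exI[of _ 1])
qed (auto simp: power2_eq_square field_simps)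

lemma plane_frame:
  fixes p q :: "real^2"
  assumes "p \<noteq> q"
  shows "\<exists>F. trig.frame (\<lambda>x. x) (\<lambda>x. x\<^sup>2 / 2) UNIV dist F \<and> F 0 0 0 = p \<and> F 0 (dist p q) 0 = q"
proof -
  define v where "v = (1 / dist p q) *\<^sub>R (q - p)"
  define w :: "real^2" where "w = vector [- (v $ 2), v $ 1]"
  have "norm v = norm (q - p) / dist q p" by (simp add: v_def dist_commute)
  then have "norm v = 1" using assms by (simp add: dist_norm)
  then have vv: "v \<bullet> v = 1" by (simp add: dot_square_norm)
  then have v2: "v $ 1 * v $ 1 + v $ 2 * v $ 2 = 1" by (simp add: inner_vec_def sum_2)
  have ww: "w \<bullet> w = 1" and vw: "v \<bullet> w = 0" and wv: "w \<bullet> v = 0"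
    using v2 by (simp_all add: w_def inner_vec_def sum_2 algebra_simps)
  have norm_vw: "norm (x *\<^sub>R v + y *\<^sub>R w) = sqrt (x\<^sup>2 + y\<^sup>2)" for x y
    by (simp add: norm_eq_sqrt_inner inner_add_left inner_add_right vv ww vw wv power2_eq_square)
  have expand: "z = (z \<bullet> v) *\<^sub>R v + (z \<bullet> w) *\<^sub>R w" for z
  proof -
    have "z $ 1 = z $ 1 * (v $ 1 * v $ 1 + v $ 2 * v $ 2)" "z $ 2 = z $ 2 * (v $ 1 * v $ 1 + v $ 2 * v $ 2)"
      by (simp_all add: v2)
    then show ?thesis by (simp add: vec_eq_iff forall_2 inner_vec_def sum_2 w_def algebra_simps)
  qed
  define F where "F a s \<theta> = p + ((a + s * cos \<theta>) *\<^sub>R v + (s * sin \<theta>) *\<^sub>R w)" for a s \<theta>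
  have "trig.frame (\<lambda>x. x) (\<lambda>x. x\<^sup>2 / 2) UNIV dist F"
    unfolding trig.frame_def[OF trig_plane]
  proof (intro conjI allI ballI)
    fix a s t \<alpha> \<beta>
    have "F a s \<alpha> - F a t \<beta> = (s * cos \<alpha> - t * cos \<beta>) *\<^sub>R v + (s * sin \<alpha> - t * sin \<beta>) *\<^sub>R w"
      by (simp add: F_def algebra_simps)
    then have "(dist (F a s \<alpha>) (F a t \<beta>))\<^sup>2 = (s * cos \<alpha> - t * cos \<beta>)\<^sup>2 + (s * sin \<alpha> - t * sin \<beta>)\<^sup>2"
      by (simp add: dist_norm norm_vw)
    also have "\<dots> = s\<^sup>2 * ((cos \<alpha>)\<^sup>2 + (sin \<alpha>)\<^sup>2) + t\<^sup>2 * ((cos \<beta>)\<^sup>2 + (sin \<beta>)\<^sup>2)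
        - 2 * s * t * (cos \<alpha> * cos \<beta> + sin \<alpha> * sin \<beta>)"
      by algebra
    also have "\<dots> = s\<^sup>2 + t\<^sup>2 - 2 * s * t * cos (\<alpha> - \<beta>)" by (simp add: cos_diff)
    finally show "(dist (F a s \<alpha>) (F a t \<beta>))\<^sup>2 / 2 = (s - t)\<^sup>2 / 2 + s * t * (1 - cos (\<alpha> - \<beta>))"
      by (simp add: power2_eq_square field_simps)
  next
    fix a and y :: "real^2"
    define z where "z = y - (p + a *\<^sub>R v)"
    obtain \<theta> where \<theta>: "z \<bullet> v = sqrt ((z \<bullet> v)\<^sup>2 + (z \<bullet> w)\<^sup>2) * cos \<theta>"
        "z \<bullet> w = sqrt ((z \<bullet> v)\<^sup>2 + (z \<bullet> w)\<^sup>2) * sin \<theta>"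
      using polar_coordinates[of "z \<bullet> v" "z \<bullet> w"] by blast
    have nz: "norm z = sqrt ((z \<bullet> v)\<^sup>2 + (z \<bullet> w)\<^sup>2)"
      using norm_vw[of "z \<bullet> v" "z \<bullet> w"] expand[of z] by simp
    have "dist (F a 0 0) y = norm z" by (simp add: F_def z_def dist_norm norm_minus_commute)
    moreover have "y = p + a *\<^sub>R v + z" by (simp add: z_def)
    moreover have "z = (norm z * cos \<theta>) *\<^sub>R v + (norm z * sin \<theta>) *\<^sub>R w"
      using expand[of z] \<theta> nz by simp
    ultimately have "y = F a (dist (F a 0 0) y) \<theta>"
      by (simp add: F_def scaleR_add_left add.assoc)
    then show "\<exists>\<theta>. y = F a (dist (F a 0 0) y) \<theta>" by blast
  next
    show "continuous_on UNIV (\<lambda>(a, \<theta>). (dist y (F a s \<theta>))\<^sup>2 / 2)" for y s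
      unfolding F_def case_prod_unfold by (intro continuous_intros) auto
  qed (auto simp: F_def algebra_simps)
  moreover have "F 0 (dist p q) 0 = q" using assms by (simp add: F_def v_def)
  moreover have "F 0 0 0 = p" by (simp add: F_def)
  ultimately show ?thesis by blast
qed

section \<open>The round sphere\<close>

lemma trig_sphere:
  fixes r :: real assumes r: "0 < r"
  shows "trig (1 / r\<^sup>2) r (\<lambda>x. r * sin (x / r)) (\<lambda>x. cos (x / r)) (\<lambda>x. r\<^sup>2 * (1 - cos (x / r)))"
proof
  show "0 < r * sin (x / r)" if "0 < x" "x \<le> r" for x
  proof -
    \<comment> \<open>The choice of \<open>r\<close> for \<open>\<rho>\<close> corresponds to one
      radian, short of the quarter circle where \<open>cos\<close> vanishes.\<close>
    have "x / r \<le> 1" using that r by simp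
    then have "x / r < pi" using pi_gt3 by linarith
    then show ?thesis using that r by (simp add: sin_gt_zero)
  qed
  show "0 < cos (x / r)" if "\<bar>x\<bar> \<le> r" for x
  proof -
    have "\<bar>x / r\<bar> \<le> 1" using that r by (simp add: abs_divide)
    then have "- (pi / 2) < x / r" "x / r < pi / 2" using pi_gt3 by linarith+
    then show ?thesis by (rule cos_gt_zero_pi)
  qed
  show "((\<lambda>x. r * sin (x / r) / x) \<longlongrightarrow> 1) (at 0)"
  proof -
    have "filterlim (\<lambda>x. x / r) (at 0) (at 0)"
      using r by (auto simp: filterlim_at eventually_at intro!: tendsto_eq_intros exI[of _ 1])
    from filterlim_compose[OF sin_over_tendsto this]
    show ?thesis using r by (simp add: mult.commute)
  qed
qed (use r in \<open>auto simp: sin_add cos_add add_divide_distrib power2_eq_square algebra_simps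
       intro!: continuous_intros\<close>)

lemma inner_orthogonal_frame:
  fixes X Y W :: "'a::real_inner"
  assumes "X \<bullet> X = k" "Y \<bullet> Y = k" "W \<bullet> W = k" "X \<bullet> Y = 0" "X \<bullet> W = 0" "Y \<bullet> W = 0"
  shows "(a *\<^sub>R X + b *\<^sub>R (c *\<^sub>R Y + e *\<^sub>R W)) \<bullet> (a' *\<^sub>R X + b' *\<^sub>R (c' *\<^sub>R Y + e' *\<^sub>R W))
    = k * (a * a' + b * b' * (c * c' + e * e'))"
  using assms inner_commute[of Y X] inner_commute[of W X] inner_commute[of W Y]
  by (simp add: inner_add_left inner_add_right algebra_simps)

text \<open>The Lagrange identity makes the cross product of \<open>z\<close> and
  \<open>cross3 p v\<close> vanish, and their inner product vanishes too; since
  \<open>cross3 p v\<close> is nonzero, \<open>z\<close> is 0.\<close>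

lemma orthogonal_to_cross3_frame:
  fixes z p v :: "real^3"
  assumes "z \<bullet> p = 0" "z \<bullet> v = 0" "z \<bullet> cross3 p v = 0" "p \<bullet> v = 0" "p \<noteq> 0" "v \<noteq> 0"
  shows "z = 0"
proof -
  have "cross3 z (cross3 p v) = 0" using assms by (simp add: Lagrange)
  then have "norm z * norm (cross3 p v) = 0" using norm_cross_dot[of z "cross3 p v"] assms by simp
  moreover have "norm (cross3 p v) \<noteq> 0" using norm_cross_dot[of p v] assms by auto
  ultimately show ?thesis by simp
qed

context
  fixes r :: real assumes r: "0 < r"
begin

interpretation trig "1 / r\<^sup>2" r "\<lambda>x. r * sin (x / r)" "\<lambda>x. cos (x / r)" "\<lambda>x. r\<^sup>2 * (1 - cos (x / r))"
  by (rule trig_sphere[OF r])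

definition sphere_dist :: "real^3 \<Rightarrow> real^3 \<Rightarrow> real" where
  "sphere_dist x y = r * arccos (x \<bullet> y / r\<^sup>2)"

lemma sphere_inner_le:
  assumes "x \<in> sphere (0::real^3) r" "y \<in> sphere 0 r"
  shows "- 1 \<le> x \<bullet> y / r\<^sup>2" "x \<bullet> y / r\<^sup>2 \<le> 1"
  using Cauchy_Schwarz_ineq2[of x y] assms r by (auto simp: power2_eq_square abs_le_iff field_simps)

lemma sphere_dist_bounds:
  assumes "x \<in> sphere 0 r" "y \<in> sphere 0 r" shows "0 \<le> sphere_dist x y" "sphere_dist x y \<le> pi * r"
  using arccos_lbound[OF sphere_inner_le[OF assms]] arccos_ubound[OF sphere_inner_le[OF assms]] r
  by (simp_all add: sphere_dist_def)

lemma md_sphere_dist: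
  assumes "x \<in> sphere 0 r" "y \<in> sphere 0 r"
  shows "r\<^sup>2 * (1 - cos (sphere_dist x y / r)) = r\<^sup>2 - x \<bullet> y"
  using cos_arccos[OF sphere_inner_le[OF assms]] r by (simp add: sphere_dist_def right_diff_distrib)

lemma sphere_md_le_iff:
  assumes "0 \<le> u" "u \<le> pi * r" "0 \<le> v" "v \<le> pi * r"
  shows "r\<^sup>2 * (1 - cos (u / r)) \<le> r\<^sup>2 * (1 - cos (v / r)) \<longleftrightarrow> u \<le> v"
  using assms r cos_mono_le_eq[of "v / r" "u / r"] by (simp add: divide_le_eq divide_le_cancel)

lemma sphere_frame:
  assumes p: "p \<in> sphere 0 r" and v: "norm v = r" "p \<bullet> v = 0"
  shows "\<exists>F. frame (sphere 0 r) sphere_dist F \<and> (\<forall>s. F 0 s 0 = cos (s / r) *\<^sub>R p + sin (s / r) *\<^sub>R v)"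
proof -
  define w where "w = (1 / r) *\<^sub>R cross3 p v"
  have pp: "p \<bullet> p = r\<^sup>2" and vv: "v \<bullet> v = r\<^sup>2" using p v by (simp_all add: dot_square_norm)
  have vp: "v \<bullet> p = 0" using v by (simp add: inner_commute)
  have pw: "p \<bullet> w = 0" "w \<bullet> p = 0" and vw: "v \<bullet> w = 0" "w \<bullet> v = 0"
    by (simp_all add: w_def dot_cross_self inner_commute)
  have "(norm (cross3 p v))\<^sup>2 = (r * r)\<^sup>2" using norm_cross_dot[of p v] p v by simp
  then have "norm (cross3 p v) = r * r" using r by (simp add: power2_eq_iff_nonneg)
  then have ww: "w \<bullet> w = r\<^sup>2" using r by (simp add: w_def dot_square_norm power2_eq_square)
  \<comment> \<open>\<open>X a\<close> is the point of the great circle at arc length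
    \<open>a\<close> from \<open>p\<close>, and \<open>Y a\<close> the tangent there, scaled to
    length \<open>r\<close> like \<open>w\<close>.\<close>
  define X where "X a = cos (a / r) *\<^sub>R p + sin (a / r) *\<^sub>R v" for a
  define Y where "Y a = cos (a / r) *\<^sub>R v - sin (a / r) *\<^sub>R p" for a
  have cs1: "cos x * cos x * r\<^sup>2 + sin x * sin x * r\<^sup>2 = r\<^sup>2" for x :: real
    by (simp flip: distrib_right power2_eq_square)
  have XX: "X a \<bullet> X a = r\<^sup>2" and YY: "Y a \<bullet> Y a = r\<^sup>2" and XY: "X a \<bullet> Y a = 0"
    and Xw: "X a \<bullet> w = 0" and Yw: "Y a \<bullet> w = 0" for a
    using cs1[of "a / r"]
    by (simp_all add: X_def Y_def inner_add_left inner_add_right inner_diff_left inner_diff_right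
        pp vv vp v(2) pw vw algebra_simps)
  define F where "F a s \<theta> = cos (s / r) *\<^sub>R X a + sin (s / r) *\<^sub>R (cos \<theta> *\<^sub>R Y a + sin \<theta> *\<^sub>R w)" for a s \<theta>
  have FF: "F a s \<alpha> \<bullet> F a t \<beta> = r\<^sup>2 * (cos (s / r) * cos (t / r) + sin (s / r) * sin (t / r) * cos (\<alpha> - \<beta>))" for a s t \<alpha> \<beta>
    unfolding F_def inner_orthogonal_frame[OF XX YY ww XY Xw Yw] by (simp add: cos_diff)
  have F_in: "F a s \<theta> \<in> sphere 0 r" for a s \<theta>
  proof -
    have "F a s \<theta> \<bullet> F a s \<theta> = r\<^sup>2" unfolding FF by (simp flip: power2_eq_square)
    then show ?thesis using r by (simp add: norm_eq_sqrt_inner)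
  qed
  have F0: "F a s 0 = cos ((a + s) / r) *\<^sub>R p + sin ((a + s) / r) *\<^sub>R v" for a s
    by (simp add: F_def X_def Y_def add_divide_distrib cos_add sin_add algebra_simps)
  have "frame (sphere 0 r) sphere_dist F"
    unfolding frame_def
  proof (intro conjI allI ballI)
    show "r\<^sup>2 * (1 - cos (sphere_dist (F a s \<alpha>) (F a t \<beta>) / r)) =
       r\<^sup>2 * (1 - cos ((s - t) / r)) + r * sin (s / r) * (r * sin (t / r)) * (1 - cos (\<alpha> - \<beta>))" for a s t \<alpha> \<beta>
      unfolding md_sphere_dist[OF F_in F_in] FF
      by (simp add: diff_divide_distrib cos_diff power2_eq_square algebra_simps)
    show "F a s 0 = F 0 (a + s) 0" for a s by (simp add: F0)
    fix q :: "real^3" assume q: "q \<in> sphere 0 r"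
    show "continuous_on UNIV (\<lambda>(a, \<theta>). r\<^sup>2 * (1 - cos (sphere_dist q (F a s \<theta>) / r)))" for s
      unfolding md_sphere_dist[OF q F_in] unfolding F_def X_def Y_def case_prod_unfold
      using r by (intro continuous_intros) auto
    fix a
    define A B C where "A = q \<bullet> X a / r\<^sup>2" and "B = q \<bullet> Y a / r\<^sup>2" and "C = q \<bullet> w / r\<^sup>2"
    \<comment> \<open>The part of \<open>q\<close> orthogonal to \<open>X a\<close>,
      \<open>Y a\<close> and \<open>w\<close>; it vanishes for lack of a fourth dimension.\<close>
    define z where "z = q - (A *\<^sub>R X a + 1 *\<^sub>R (B *\<^sub>R Y a + C *\<^sub>R w))"
    have sym: "Y a \<bullet> X a = 0" "w \<bullet> X a = 0" "w \<bullet> Y a = 0"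
      using XY Xw Yw by (simp_all add: inner_commute)
    have zX: "z \<bullet> X a = 0" and zY: "z \<bullet> Y a = 0" and zw: "z \<bullet> w = 0"
      using r by (simp_all add: z_def inner_diff_left inner_add_left XX YY ww XY Xw Yw sym A_def B_def C_def)
    have "cos (a / r) * (z \<bullet> p) + sin (a / r) * (z \<bullet> v) = 0"
      "cos (a / r) * (z \<bullet> v) - sin (a / r) * (z \<bullet> p) = 0"
      using zX zY by (simp_all add: X_def Y_def inner_add_right inner_diff_right)
    moreover have "(cos (a / r))\<^sup>2 + (sin (a / r))\<^sup>2 = 1" by simp
    ultimately have "z \<bullet> p = 0" "z \<bullet> v = 0" by algebra+
    moreover have "z \<bullet> cross3 p v = 0" using zw r by (simp add: w_def)
    moreover have "p \<noteq> 0" "v \<noteq> 0" using p v r by auto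
    ultimately have "z = 0" using v(2) by (intro orthogonal_to_cross3_frame[of z p v])
    then have q_eq: "q = A *\<^sub>R X a + 1 *\<^sub>R (B *\<^sub>R Y a + C *\<^sub>R w)" by (simp add: z_def)
    have "q \<bullet> q = r\<^sup>2" using q by (simp add: dot_square_norm)
    then have "r\<^sup>2 * (A * A + 1 * 1 * (B * B + C * C)) = r\<^sup>2"
      using inner_orthogonal_frame[OF XX[of a] YY ww XY Xw Yw, where a = A and b = 1 and c = B and e = C
          and a' = A and b' = 1 and c' = B and e' = C, folded q_eq] by simp
    then have ABC: "B\<^sup>2 + C\<^sup>2 = 1 - A\<^sup>2" using r by (simp add: power2_eq_square)
    have "0 \<le> B\<^sup>2 + C\<^sup>2" by simp
    then have "A\<^sup>2 \<le> 1" unfolding ABC by simp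
    then have A: "\<bar>A\<bar> \<le> 1" by (simp only: abs_square_le_1)
    obtain \<theta> where \<theta>: "B = sqrt (1 - A\<^sup>2) * cos \<theta>" "C = sqrt (1 - A\<^sup>2) * sin \<theta>"
      using polar_coordinates[of B C] unfolding ABC by blast
    have "sphere_dist (F a 0 0) q = r * arccos A"
      by (simp add: sphere_dist_def F_def A_def inner_commute)
    then have "F a (sphere_dist (F a 0 0) q) \<theta> = A *\<^sub>R X a + sqrt (1 - A\<^sup>2) *\<^sub>R (cos \<theta> *\<^sub>R Y a + sin \<theta> *\<^sub>R w)"
      using A r by (simp add: F_def abs_le_iff sin_arccos)
    also have "\<dots> = q" by (simp add: q_eq \<theta> scaleR_add_right)
    finally show "\<exists>\<theta>. q = F a (sphere_dist (F a 0 0) q) \<theta>" by metis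
  qed (rule F_in)
  then show ?thesis using F0 by auto
qed

lemma sphere_direction:
  assumes p: "p \<in> sphere (0::real^3) r" and q: "q \<in> sphere 0 r"
  obtains v where "norm v = r" "p \<bullet> v = 0"
    "q = cos (sphere_dist p q / r) *\<^sub>R p + sin (sphere_dist p q / r) *\<^sub>R v"
proof -
  define h where "h = sphere_dist p q / r"
  have pp: "p \<bullet> p = r\<^sup>2" and qq: "q \<bullet> q = r\<^sup>2" using p q by (simp_all add: dot_square_norm)
  have pq: "p \<bullet> q = r\<^sup>2 * cos h" "q \<bullet> p = r\<^sup>2 * cos h"
    using md_sphere_dist[OF p q] by (simp_all add: h_def algebra_simps inner_commute)
  show thesis
  proof (cases "sin h = 0")
    case True
    then have c: "cos h * cos h = 1" using sin_cos_squared_add[of h] by (simp add: power2_eq_square)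
    have "(q - cos h *\<^sub>R p) \<bullet> (q - cos h *\<^sub>R p) = r\<^sup>2 - r\<^sup>2 * (cos h * cos h)"
      by (simp add: inner_diff_left inner_diff_right pp qq pq algebra_simps)
    then have "q = cos h *\<^sub>R p" using c by simp
    \<comment> \<open>Here \<open>q\<close> is \<open>p\<close> or its antipode and no direction is
      distinguished, so any orthogonal vector will do.\<close>
    obtain y where y: "y \<noteq> 0" "orthogonal p y"
      by (rule orthogonal_to_vector_exists[of p]) auto
    show thesis
    proof (rule that[of "(r / norm y) *\<^sub>R y", folded h_def])
      show "norm ((r / norm y) *\<^sub>R y) = r" using y r by simp
      show "p \<bullet> (r / norm y) *\<^sub>R y = 0" using y by (simp add: orthogonal_def)
      show "q = cos h *\<^sub>R p + sin h *\<^sub>R (r / norm y) *\<^sub>R y"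
        unfolding True by (simp add: \<open>q = cos h *\<^sub>R p\<close>[symmetric])
    qed
  next
    case False
    define v where "v = (1 / sin h) *\<^sub>R (q - cos h *\<^sub>R p)"
    have "v \<bullet> v = ((q - cos h *\<^sub>R p) \<bullet> (q - cos h *\<^sub>R p)) / (sin h)\<^sup>2"
      by (simp add: v_def power2_eq_square)
    also have "(q - cos h *\<^sub>R p) \<bullet> (q - cos h *\<^sub>R p) = r\<^sup>2 - r\<^sup>2 * (cos h)\<^sup>2"
      unfolding inner_diff_left inner_diff_right inner_scaleR_left inner_scaleR_right pp qq pq
      by (simp add: power2_eq_square algebra_simps)
    also have "r\<^sup>2 - r\<^sup>2 * (cos h)\<^sup>2 = r\<^sup>2 * (sin h)\<^sup>2" by (simp add: sin_squared_eq algebra_simps)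
    finally have "v \<bullet> v = r\<^sup>2" using False by simp
    then have "norm v = r" using r by (simp add: norm_eq_sqrt_inner)
    moreover have "p \<bullet> v = 0" by (simp add: v_def inner_diff_right pp pq)
    moreover have "q = cos h *\<^sub>R p + sin h *\<^sub>R v" using False by (simp add: v_def)
    ultimately show thesis using that by (simp add: h_def)
  qed
qed

lemma sphere_frame_through:
  assumes p: "p \<in> sphere (0::real^3) r" and q: "q \<in> sphere 0 r"
  obtains F v where "frame (sphere 0 r) sphere_dist F" "F 0 0 0 = p" "F 0 (sphere_dist p q) 0 = q"
    "\<And>s. F 0 s 0 = cos (s / r) *\<^sub>R p + sin (s / r) *\<^sub>R v"
proof -
  obtain v where v: "norm v = r" "p \<bullet> v = 0"
    "q = cos (sphere_dist p q / r) *\<^sub>R p + sin (sphere_dist p q / r) *\<^sub>R v"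
    by (rule sphere_direction[OF p q])
  obtain F where F: "frame (sphere 0 r) sphere_dist F"
    "\<And>s. F 0 s 0 = cos (s / r) *\<^sub>R p + sin (s / r) *\<^sub>R v"
    using sphere_frame[OF p v(1,2)] by blast
  then show thesis using that[OF F(1) _ _ F(2)] v(3) by simp
qed

lemma sphere_conformal:
  "conformal_model (1 / r\<^sup>2) r (\<lambda>x. r * sin (x / r)) (\<lambda>x. cos (x / r)) (\<lambda>x. r\<^sup>2 * (1 - cos (x / r)))
     (sphere (0::real^3) r) (\<lambda>p u v. u \<bullet> v) sphere_dist (\<lambda>_ _. 1)"
proof
  let ?S = "sphere (0::real^3) r"
  have rr: "r \<le> pi * r" using r pi_gt3 by simp
  show "0 \<le> sphere_dist x y" if "x \<in> ?S" "y \<in> ?S" for x y by (rule sphere_dist_bounds[OF that])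
  show "sphere_dist x y = sphere_dist y x" for x y by (simp add: sphere_dist_def inner_commute)
  show "r\<^sup>2 * (1 - cos (sphere_dist x y / r)) \<le> r\<^sup>2 * (1 - cos (u / r)) \<longleftrightarrow> sphere_dist x y \<le> u"
    if "x \<in> ?S" "y \<in> ?S" "0 \<le> u" "u \<le> r" for x y u
    using that sphere_dist_bounds[of x y] rr by (intro sphere_md_le_iff) auto
  show "r\<^sup>2 * (1 - cos (sphere_dist x y / r)) = 1 * (norm (x - y))\<^sup>2 / 2" if "x \<in> ?S" "y \<in> ?S" for x y
  proof -
    have "(norm (x - y))\<^sup>2 = x \<bullet> x + y \<bullet> y - 2 * (x \<bullet> y)"
      by (simp add: power2_norm_eq_inner inner_diff_left inner_diff_right inner_commute)
    also have "\<dots> = 2 * (r\<^sup>2 - x \<bullet> y)" using that by (simp add: dot_square_norm)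
    finally show ?thesis using md_sphere_dist[OF that] by simp
  qed
  show "u \<bullet> u = 1 * (norm u)\<^sup>2" for u :: "real^3" by (simp add: power2_norm_eq_inner)
  show "sphere_dist x z \<le> sphere_dist x y + sphere_dist y z" if xyz: "x \<in> ?S" "y \<in> ?S" "z \<in> ?S" for x y z
  proof -
    define s t where "s = sphere_dist y x" and "t = sphere_dist y z"
    obtain F v where F: "frame ?S sphere_dist F" "F 0 0 0 = y"
      by (rule sphere_frame_through[OF xyz(2) xyz(3)])
    obtain \<alpha> where \<alpha>: "x = F 0 s \<alpha>" using F xyz(1) unfolding frame_def s_def by metis
    obtain \<beta> where \<beta>: "z = F 0 t \<beta>" using F xyz(3) unfolding frame_def t_def by metis
    have st: "0 \<le> s" "s \<le> pi * r" "0 \<le> t" "t \<le> pi * r"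
      unfolding s_def t_def using sphere_dist_bounds xyz by auto
    have "0 \<le> r * sin (s / r)" "0 \<le> r * sin (t / r)"
      using st r by (auto intro!: mult_nonneg_nonneg sin_ge_zero simp: divide_le_eq)
    from md_polar_le[OF this, of "\<alpha> - \<beta>"]
    have le: "r\<^sup>2 * (1 - cos (sphere_dist x z / r)) \<le> r\<^sup>2 * (1 - cos ((s + t) / r))"
      using F(1) by (simp add: frame_def \<alpha> \<beta>)
    have "sphere_dist x z \<le> s + t"
    \<comment> \<open>Beyond half a great circle \<open>md\<close> is no longer monotone, but there
      the diameter \<open>pi * r\<close> already gives the bound.\<close>
    proof (cases "s + t \<le> pi * r")
      case True
      then show ?thesis using le sphere_md_le_iff[of "sphere_dist x z" "s + t"] st
          sphere_dist_bounds[OF xyz(1,3)] by simp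
    next
      case False
      then show ?thesis using sphere_dist_bounds[OF xyz(1,3)] by simp
    qed
    then show ?thesis by (simp add: s_def t_def sphere_dist_def inner_commute)
  qed
  show "\<exists>c. c C1_differentiable_on {0..1} \<and> c ` {0..1} \<subseteq> ?S \<and> c 0 = x \<and> c 1 = y \<and>
      (\<forall>s\<in>{0..1}. \<forall>t\<in>{0..1}. sphere_dist (c s) (c t) = \<bar>s - t\<bar> * sphere_dist x y)"
    if x: "x \<in> ?S" and y: "y \<in> ?S" for x y
  proof -
    define h where "h = sphere_dist x y"
    obtain F v where F: "frame ?S sphere_dist F" "F 0 0 0 = x" "F 0 h 0 = y"
      "\<And>s. F 0 s 0 = cos (s / r) *\<^sub>R x + sin (s / r) *\<^sub>R v"
      unfolding h_def using sphere_frame_through[OF x y] by blast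
    have h: "0 \<le> h" "h \<le> pi * r" using sphere_dist_bounds[OF x y] by (auto simp: h_def)
    have F_in: "F 0 s 0 \<in> ?S" for s using F(1) by (simp add: frame_def)
    let ?c = "\<lambda>t. F 0 (t * h) 0"
    have "?c C1_differentiable_on {0..1}"
      unfolding C1_differentiable_on_def F(4)
    proof (intro exI conjI ballI)
      fix t
      show "((\<lambda>t. cos (t * h / r) *\<^sub>R x + sin (t * h / r) *\<^sub>R v) has_vector_derivative
          (- sin (t * h / r) * (h / r)) *\<^sub>R x + (cos (t * h / r) * (h / r)) *\<^sub>R v) (at t)"
        using r by (auto intro!: derivative_eq_intros simp: has_real_derivative_iff_has_vector_derivative[symmetric])
      show "continuous_on {0..1} (\<lambda>t. (- sin (t * h / r) * (h / r)) *\<^sub>R x + (cos (t * h / r) * (h / r)) *\<^sub>R v)"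
        using r by (intro continuous_intros) auto
    qed
    moreover have "sphere_dist (?c s) (?c t) = \<bar>s - t\<bar> * h" if st: "s \<in> {0..1}" "t \<in> {0..1}" for s t
    proof -
      have "\<bar>s - t\<bar> * h \<le> 1 * h" using st h by (intro mult_right_mono) auto
      then have b: "0 \<le> \<bar>s - t\<bar> * h" "\<bar>s - t\<bar> * h \<le> pi * r" using h by auto
      have "r\<^sup>2 * (1 - cos (sphere_dist (?c s) (?c t) / r)) = r\<^sup>2 * (1 - cos ((s * h - t * h) / r))"
        using F(1) by (simp add: frame_def)
      also have "cos ((s * h - t * h) / r) = cos (\<bar>s - t\<bar> * h / r)"
      proof (cases "s \<le> t")
        case True
        then have "\<bar>s - t\<bar> * h / r = - ((s * h - t * h) / r)" using r by (simp add: field_simps)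
        then show ?thesis by (simp only: cos_minus)
      qed (simp add: left_diff_distrib)
      finally have "r\<^sup>2 * (1 - cos (sphere_dist (?c s) (?c t) / r)) = r\<^sup>2 * (1 - cos (\<bar>s - t\<bar> * h / r))" .
      then show ?thesis
        using sphere_md_le_iff[of "sphere_dist (?c s) (?c t)" "\<bar>s - t\<bar> * h"]
          sphere_md_le_iff[of "\<bar>s - t\<bar> * h" "sphere_dist (?c s) (?c t)"] b
          sphere_dist_bounds[OF F_in F_in] by (intro antisym) auto
    qed
    ultimately show ?thesis using F F_in by (intro exI[of _ ?c]) (auto simp: h_def)
  qed
qed (auto intro!: continuous_intros)

end

section \<open>The hyperbolic plane\<close>

text \<open>The automorphism of the disc that carries 0 to \<open>a\<close>; for real
  \<open>a\<close> it is a translation along the real diameter.\<close>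

definition mobius :: "complex \<Rightarrow> complex \<Rightarrow> complex" where
  "mobius a z = (z + a) / (1 + cnj a * z)"

text \<open>The hyperbolic distance \<open>d\<close> of curvature \<open>-1\<close> satisfies \<open>cosh d - 1 = disc_form z w\<close>.\<close>

definition disc_form :: "complex \<Rightarrow> complex \<Rightarrow> real" where
  "disc_form z w = 2 * (cmod (z - w))\<^sup>2 / ((1 - (cmod z)\<^sup>2) * (1 - (cmod w)\<^sup>2))"

lemma mobius_0_left [simp]: "mobius 0 z = z" and mobius_0_right [simp]: "mobius a 0 = a"
  by (simp_all add: mobius_def)

lemma mobius_denominator:
  assumes "cmod a < 1" "cmod z < 1" shows "1 + cnj a * z \<noteq> 0"
proof
  assume "1 + cnj a * z = 0"
  then have "cnj a * z = - 1" by (simp add: add_eq_0_iff)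
  then have "cmod a * cmod z = 1" by (metis complex_mod_cnj norm_minus_cancel norm_mult norm_one)
  moreover have "cmod a * cmod z < 1 * 1" by (rule mult_strict_mono') (use assms in auto)
  ultimately show False by simp
qed

lemma cmod_mobius:
  assumes "cmod a < 1" "cmod z < 1"
  shows "1 - (cmod (mobius a z))\<^sup>2 = (1 - (cmod a)\<^sup>2) * (1 - (cmod z)\<^sup>2) / (cmod (1 + cnj a * z))\<^sup>2"
proof -
  have "(cmod (1 + cnj a * z))\<^sup>2 - (cmod (z + a))\<^sup>2 = (1 - (cmod a)\<^sup>2) * (1 - (cmod z)\<^sup>2)"
    unfolding cmod_power2 by (simp add: power2_eq_square algebra_simps)
  then show ?thesis using mobius_denominator[OF assms]
    by (simp add: mobius_def norm_divide power_divide field_simps)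
qed

lemma mobius_in_disc: assumes "cmod a < 1" "cmod z < 1" shows "cmod (mobius a z) < 1"
proof -
  have "(cmod a)\<^sup>2 < 1" "(cmod z)\<^sup>2 < 1" using assms by (simp_all add: abs_square_less_1)
  then have "1 - (cmod (mobius a z))\<^sup>2 > 0"
    unfolding cmod_mobius[OF assms] using mobius_denominator[OF assms] by simp
  then show ?thesis by (simp add: abs_square_less_1)
qed

text \<open>The factors \<open>cmod (1 + cnj a * z)\<close> and \<open>1 - (cmod a)^2\<close> occur
  equally often in the squared difference and in the product of the two denominators, and
  cancel.\<close>

lemma disc_form_mobius:
  assumes a: "cmod a < 1" and z: "cmod z < 1" and w: "cmod w < 1"
  shows "disc_form (mobius a z) (mobius a w) = disc_form z w"
proof -
  have nz: "1 + cnj a * z \<noteq> 0" "1 + cnj a * w \<noteq> 0" using mobius_denominator assms by auto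
  have sq: "(cmod a)\<^sup>2 < 1" "(cmod z)\<^sup>2 < 1" "(cmod w)\<^sup>2 < 1" using assms by (simp_all add: abs_square_less_1)
  have aa: "a * cnj a = of_real ((cmod a)\<^sup>2)" by (rule complex_norm_square[symmetric])
  have "mobius a z - mobius a w = ((z + a) * (1 + cnj a * w) - (w + a) * (1 + cnj a * z)) / ((1 + cnj a * z) * (1 + cnj a * w))"
    unfolding mobius_def using nz by (rule diff_frac_eq)
  also have "(z + a) * (1 + cnj a * w) - (w + a) * (1 + cnj a * z) = (z - w) * (1 - a * cnj a)"
    by (simp add: algebra_simps)
  also have "1 - a * cnj a = of_real (1 - (cmod a)\<^sup>2)" unfolding aa by simp
  finally have "cmod (mobius a z - mobius a w)
      = cmod (z - w) * (1 - (cmod a)\<^sup>2) / (cmod (1 + cnj a * z) * cmod (1 + cnj a * w))"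
    using sq by (simp add: norm_mult norm_divide del: of_real_diff of_real_power)
  moreover have "2 * (n * A / (p * q))\<^sup>2 / ((A * Z / p\<^sup>2) * (A * W / q\<^sup>2)) = 2 * n\<^sup>2 / (Z * W)"
    if "A \<noteq> 0" "p \<noteq> 0" "q \<noteq> 0" "Z \<noteq> 0" "W \<noteq> 0" for n A p q Z W :: real
    using that by (simp add: field_simps power2_eq_square)
  ultimately show ?thesis
    unfolding disc_form_def cmod_mobius[OF a z] cmod_mobius[OF a w] using nz sq by simp
qed

lemma mobius_inverse:
  assumes "cmod a < 1" "cmod z < 1" shows "mobius a (mobius (- a) z) = z"
proof -
  have nz: "1 + cnj (- a) * z \<noteq> 0" using mobius_denominator[of "- a" z] assms by simp
  have "a * cnj a = of_real ((cmod a)\<^sup>2)" by (rule complex_norm_square[symmetric])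
  moreover have "(cmod a)\<^sup>2 \<noteq> 1" using assms by (simp add: power2_eq_1_iff) (smt (verit) norm_ge_zero)
  ultimately have n1: "1 - a * cnj a \<noteq> 0" by (metis eq_iff_diff_eq_0 of_real_eq_1_iff)
  define w where "w = 1 + cnj (- a) * z"
  have w: "w \<noteq> 0" unfolding w_def by (rule nz)
  have mw: "mobius (- a) z = (z - a) / w" by (simp add: mobius_def w_def)
  have "mobius a (mobius (- a) z) = ((z - a) / w + a) / (1 + cnj a * ((z - a) / w))"
    unfolding mw by (rule mobius_def)
  also have "(z - a) / w + a = (z - a + a * w) / w" using w by (simp add: field_simps)
  also have "1 + cnj a * ((z - a) / w) = (w + cnj a * (z - a)) / w" using w by (simp add: field_simps)
  also have "z - a + a * w = z * (1 - a * cnj a)" by (simp add: w_def algebra_simps)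
  also have "w + cnj a * (z - a) = 1 - a * cnj a" by (simp add: w_def algebra_simps)
  finally show ?thesis using n1 w by simp
qed

lemma disc_form_rotate:
  assumes "cmod u = 1" shows "disc_form (u * z) (u * w) = disc_form z w"
proof -
  have "u * z - u * w = u * (z - w)" by (simp add: algebra_simps)
  then have "cmod (u * z - u * w) = cmod (z - w)" using assms by (simp add: norm_mult)
  then show ?thesis using assms by (simp add: disc_form_def norm_mult)
qed

lemma cmod_tanh_cis_less: "cmod (of_real (tanh x) * cis \<alpha>) < 1"
  using tanh_real_bounds[of x] by (auto simp: norm_mult abs_less_iff)

text \<open>A point at hyperbolic distance \<open>2 * x\<close> from 0 has Euclidean modulus
  \<open>tanh x\<close>, so this is the hyperbolic law of cosines about the centre of the
  disc.\<close>

lemma disc_form_polar: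
  "disc_form (of_real (tanh x) * cis \<alpha>) (of_real (tanh y) * cis \<beta>)
    = cosh (2 * x - 2 * y) - 1 + sinh (2 * x) * sinh (2 * y) * (1 - cos (\<alpha> - \<beta>))"
proof -
  define s c s' c' where "s = sinh x" and "c = cosh x" and "s' = sinh y" and "c' = cosh y"
  have pos: "c > 0" "c' > 0" by (simp_all add: c_def c'_def)
  have cs: "c\<^sup>2 = s\<^sup>2 + 1" "c'\<^sup>2 = s'\<^sup>2 + 1" by (simp_all add: s_def c_def s'_def c'_def cosh_square_eq)
  then have s2: "s\<^sup>2 = c\<^sup>2 - 1" "s'\<^sup>2 = c'\<^sup>2 - 1" by simp_all
  have t: "tanh x = s / c" "tanh y = s' / c'" by (simp_all add: tanh_def s_def c_def s'_def c'_def)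
  have "(cmod (of_real (tanh x) * cis \<alpha> - of_real (tanh y) * cis \<beta>))\<^sup>2
      = (tanh x * cos \<alpha> - tanh y * cos \<beta>)\<^sup>2 + (tanh x * sin \<alpha> - tanh y * sin \<beta>)\<^sup>2"
    by (simp add: cmod_power2)
  also have "\<dots> = (tanh x)\<^sup>2 * ((cos \<alpha>)\<^sup>2 + (sin \<alpha>)\<^sup>2) + (tanh y)\<^sup>2 * ((cos \<beta>)\<^sup>2 + (sin \<beta>)\<^sup>2)
      - 2 * tanh x * tanh y * (cos \<alpha> * cos \<beta> + sin \<alpha> * sin \<beta>)"
    by algebra
  also have "\<dots> = (s / c)\<^sup>2 + (s' / c')\<^sup>2 - 2 * (s / c) * (s' / c') * cos (\<alpha> - \<beta>)"
    unfolding t by (simp add: cos_diff)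
  finally have num: "(cmod (of_real (tanh x) * cis \<alpha> - of_real (tanh y) * cis \<beta>))\<^sup>2
      = (s / c)\<^sup>2 + (s' / c')\<^sup>2 - 2 * (s / c) * (s' / c') * cos (\<alpha> - \<beta>)" .
  have den: "1 - (cmod (of_real (tanh x) * cis \<alpha>))\<^sup>2 = 1 / c\<^sup>2" "1 - (cmod (of_real (tanh y) * cis \<beta>))\<^sup>2 = 1 / c'\<^sup>2"
    using pos by (simp_all add: norm_mult t power_divide s2 diff_divide_distrib del: of_real_divide)
  have "disc_form (of_real (tanh x) * cis \<alpha>) (of_real (tanh y) * cis \<beta>)
      = 2 * (s\<^sup>2 * c'\<^sup>2 + s'\<^sup>2 * c\<^sup>2 - 2 * s * c * s' * c' * cos (\<alpha> - \<beta>))"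
    unfolding disc_form_def num den using pos by (simp add: power_divide field_simps power2_eq_square)
  moreover have "cosh (2 * x - 2 * y) - 1 = 2 * (s * c' - c * s')\<^sup>2"
  proof -
    have "cosh (2 * (x - y)) = 2 * (sinh (x - y))\<^sup>2 + 1"
      using cosh_double[of "x - y"] by (simp add: cosh_square_eq)
    moreover have "sinh (x - y) = s * c' - c * s'" by (simp add: sinh_diff s_def c_def s'_def c'_def)
    ultimately show ?thesis by (simp add: right_diff_distrib)
  qed
  moreover have "sinh (2 * x) * sinh (2 * y) = 4 * s * c * s' * c'"
    by (simp add: sinh_double s_def c_def s'_def c'_def)
  ultimately show ?thesis by (simp add: power2_eq_square algebra_simps)
qed

lemma disc_form_nonneg: assumes "cmod z < 1" "cmod w < 1" shows "0 \<le> disc_form z w"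
proof -
  have "(cmod z)\<^sup>2 < 1" "(cmod w)\<^sup>2 < 1" using assms by (simp_all add: abs_square_less_1)
  then show ?thesis by (simp add: disc_form_def)
qed

lemma disc_polar_coordinates:
  assumes "cmod z < 1" obtains x \<alpha> where "0 \<le> x" "z = of_real (tanh x) * cis \<alpha>"
proof -
  define x where "x = artanh (cmod z)"
  have pos: "(1 + cmod z) / (1 - cmod z) \<ge> 1" using assms by (simp add: field_simps)
  then have "0 \<le> x" by (simp add: x_def artanh_def)
  moreover have "tanh x = cmod z"
  proof -
    have "exp (2 * x) = (1 + cmod z) / (1 - cmod z)" using pos by (simp add: x_def artanh_def)
    then have e: "exp (- 2 * x) = (1 - cmod z) / (1 + cmod z)" by (simp add: exp_minus)
    show ?thesis unfolding tanh_real_altdef e using assms norm_ge_zero[of z] by (simp add: field_simps add_nonneg_eq_0_iff)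
  qed
  moreover have "z = of_real (cmod z) * cis (Arg z)" by (metis rcis_cmod_Arg rcis_def)
  ultimately show thesis using that by metis
qed

section \<open>The disc in \<open>real^2\<close> as the complex disc\<close>

definition to_complex :: "real^2 \<Rightarrow> complex" where "to_complex p = Complex (p $ 1) (p $ 2)"

definition of_complex :: "complex \<Rightarrow> real^2" where "of_complex z = vector [Re z, Im z]"

lemma to_of_complex [simp]: "to_complex (of_complex z) = z"
  by (simp add: to_complex_def of_complex_def)

lemma of_to_complex [simp]: "of_complex (to_complex p) = p"
  by (simp add: to_complex_def of_complex_def vec_eq_iff forall_2)

lemma norm_real2: "(norm (p :: real^2))\<^sup>2 = (p $ 1)\<^sup>2 + (p $ 2)\<^sup>2"
  unfolding power2_norm_eq_inner by (simp add: inner_vec_def sum_2 power2_eq_square)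

lemma cmod_to_complex [simp]: "cmod (to_complex p) = norm p"
proof -
  have "(cmod (to_complex p))\<^sup>2 = (norm p)\<^sup>2" by (simp add: to_complex_def cmod_power2 norm_real2)
  then show ?thesis by (simp add: power2_eq_iff_nonneg)
qed

lemma norm_of_complex [simp]: "norm (of_complex z) = cmod z"
  using cmod_to_complex[of "of_complex z"] by simp

lemma cmod_to_complex_diff [simp]: "cmod (to_complex p - to_complex q) = norm (p - q)"
proof -
  have "to_complex p - to_complex q = to_complex (p - q)" by (simp add: to_complex_def complex_eq_iff)
  then show ?thesis by simp
qed

lemma bounded_linear_of_complex: "bounded_linear of_complex"
  by (rule linear_conv_bounded_linear[THEN iffD1], rule linearI)
     (simp_all add: of_complex_def vec_eq_iff forall_2)

section \<open>Frames and distance of the hyperbolic plane\<close>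

lemma trig_hyperbolic:
  fixes k :: real assumes k: "0 < k"
  shows "trig (- 1 / k\<^sup>2) k (\<lambda>x. k * sinh (x / k)) (\<lambda>x. cosh (x / k)) (\<lambda>x. k\<^sup>2 * (cosh (x / k) - 1))"
proof
  show "((\<lambda>x. k * sinh (x / k) / x) \<longlongrightarrow> 1) (at 0)"
  proof -
    have sinh_over: "((\<lambda>x::real. sinh x / x) \<longlongrightarrow> 1) (at 0)"
      using has_field_derivative_sinh[OF DERIV_ident, of 0 UNIV] by (simp add: DERIV_def)
    have "filterlim (\<lambda>x. x / k) (at 0) (at 0)"
      using k by (auto simp: filterlim_at eventually_at intro!: tendsto_eq_intros exI[of _ 1])
    from filterlim_compose[OF sinh_over this]
    show ?thesis using k by (simp add: mult.commute)
  qed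
qed (use k in \<open>auto simp: sinh_add cosh_add add_divide_distrib power2_eq_square algebra_simps
       intro!: continuous_intros\<close>)

context
  fixes k :: real assumes k: "0 < k"
begin

interpretation trig "- 1 / k\<^sup>2" k "\<lambda>x. k * sinh (x / k)" "\<lambda>x. cosh (x / k)" "\<lambda>x. k\<^sup>2 * (cosh (x / k) - 1)"
  by (rule trig_hyperbolic[OF k])

definition hyp_dist :: "real^2 \<Rightarrow> real^2 \<Rightarrow> real" where
  "hyp_dist p q = k * arcosh (1 + disc_form (to_complex p) (to_complex q))"

lemma disc_form_ball_nonneg:
  "p \<in> ball 0 1 \<Longrightarrow> q \<in> ball 0 1 \<Longrightarrow> 0 \<le> disc_form (to_complex p) (to_complex q)"
  by (intro disc_form_nonneg) simp_all

lemma hyp_dist_nonneg: "p \<in> ball 0 1 \<Longrightarrow> q \<in> ball 0 1 \<Longrightarrow> 0 \<le> hyp_dist p q"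
  using disc_form_ball_nonneg[of p q] k by (simp add: hyp_dist_def)

lemma md_hyp_dist:
  assumes "p \<in> ball 0 1" "q \<in> ball 0 1"
  shows "k\<^sup>2 * (cosh (hyp_dist p q / k) - 1) = k\<^sup>2 * disc_form (to_complex p) (to_complex q)"
  using disc_form_ball_nonneg[OF assms] k by (simp add: hyp_dist_def)

lemma hyp_md_le_iff:
  assumes "0 \<le> u" "0 \<le> v"
  shows "k\<^sup>2 * (cosh (u / k) - 1) \<le> k\<^sup>2 * (cosh (v / k) - 1) \<longleftrightarrow> u \<le> v"
  using assms k by (simp add: cosh_real_nonneg_le_iff divide_le_cancel)

text \<open>Read from the inside: a polar point about 0, a translation by \<open>a\<close> along the
  real diameter, a rotation by \<open>u\<close>, and the Moebius map carrying 0 to \<open>p\<close>.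
  The last three preserve \<open>disc_form\<close>, so the law about 0 carries over, and the
  addition theorem of \<open>tanh\<close> shows that translations along the axis add up.\<close>

lemma hyp_frame:
  assumes p: "p \<in> ball (0::real^2) 1" and u: "cmod u = 1"
  defines "F \<equiv> \<lambda>a s \<theta>. of_complex (mobius (to_complex p)
      (u * mobius (of_real (tanh (a / (2 * k)))) (of_real (tanh (s / (2 * k))) * cis \<theta>)))"
  shows "frame (ball 0 1) hyp_dist F"
proof -
  define P where "P = to_complex p"
  have P: "cmod P < 1" using p by (simp add: P_def)
  have a1: "cmod (of_real (tanh (a / (2 * k)))) < 1" for a
    using cmod_tanh_cis_less[of "a / (2 * k)" 0] by simp
  define N where "N a z = mobius (of_real (tanh (a / (2 * k)))) z" for a z
  have N: "cmod (N a z) < 1" if "cmod z < 1" for a z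
    unfolding N_def by (rule mobius_in_disc[OF a1 that])
  have uN: "cmod (u * N a z) < 1" if "cmod z < 1" for a z using N[OF that] u by (simp add: norm_mult)
  define \<zeta> where "\<zeta> s \<theta> = of_real (tanh (s / (2 * k))) * cis \<theta>" for s \<theta>
  have \<zeta>: "cmod (\<zeta> s \<theta>) < 1" for s \<theta> unfolding \<zeta>_def by (rule cmod_tanh_cis_less)
  have F: "F a s \<theta> = of_complex (mobius P (u * N a (\<zeta> s \<theta>)))" for a s \<theta>
    by (simp add: F_def P_def N_def \<zeta>_def)
  have F_in: "F a s \<theta> \<in> ball 0 1" for a s \<theta>
    unfolding F by (simp add: mobius_in_disc[OF P uN[OF \<zeta>]])
  have law: "k\<^sup>2 * (cosh (hyp_dist (F a s \<alpha>) (F a t \<beta>) / k) - 1) =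
       k\<^sup>2 * (cosh ((s - t) / k) - 1) + k * sinh (s / k) * (k * sinh (t / k)) * (1 - cos (\<alpha> - \<beta>))" for a s t \<alpha> \<beta>
  proof -
    have "disc_form (to_complex (F a s \<alpha>)) (to_complex (F a t \<beta>)) = disc_form (\<zeta> s \<alpha>) (\<zeta> t \<beta>)"
      unfolding F by (simp add: disc_form_mobius P uN \<zeta> disc_form_rotate[OF u])
        (unfold N_def, rule disc_form_mobius[OF a1 \<zeta> \<zeta>])
    also have "\<dots> = cosh ((s - t) / k) - 1 + sinh (s / k) * sinh (t / k) * (1 - cos (\<alpha> - \<beta>))"
      unfolding \<zeta>_def disc_form_polar using k by (simp add: diff_divide_distrib)
    finally have df: "disc_form (to_complex (F a s \<alpha>)) (to_complex (F a t \<beta>))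
        = cosh ((s - t) / k) - 1 + sinh (s / k) * sinh (t / k) * (1 - cos (\<alpha> - \<beta>))" .
    show ?thesis unfolding md_hyp_dist[OF F_in F_in] df by (simp add: power2_eq_square algebra_simps)
  qed
  show ?thesis
    unfolding frame_def
  proof (intro conjI allI ballI)
    show "F a s 0 = F 0 (a + s) 0" for a s
    proof -
      have "N a (\<zeta> s 0) = of_real ((tanh (s / (2 * k)) + tanh (a / (2 * k))) / (1 + tanh (a / (2 * k)) * tanh (s / (2 * k))))"
        by (simp add: N_def \<zeta>_def mobius_def)
      also have "\<dots> = of_real (tanh (a / (2 * k) + s / (2 * k)))" by (simp add: tanh_add add.commute)
      also have "\<dots> = N 0 (\<zeta> (a + s) 0)" by (simp add: N_def \<zeta>_def add_divide_distrib)
      finally show ?thesis by (simp add: F)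
    qed
    fix q :: "real^2" assume q: "q \<in> ball 0 1"
    show "continuous_on UNIV (\<lambda>(a, \<theta>). k\<^sup>2 * (cosh (hyp_dist q (F a s \<theta>) / k) - 1))" for s
    proof -
      note mobius_continuous = continuous_on_divide continuous_on_add continuous_on_mult continuous_on_cnj
        continuous_on_const
      have z: "continuous_on UNIV (\<lambda>x::real \<times> real. \<zeta> s (snd x))"
        unfolding \<zeta>_def cis_conv_exp by (intro continuous_intros)
      have t: "continuous_on UNIV (\<lambda>x::real \<times> real. complex_of_real (tanh (fst x / (2 * k))))"
        using k by (intro continuous_intros) auto
      have 1: "continuous_on UNIV (\<lambda>x::real \<times> real. N (fst x) (\<zeta> s (snd x)))"
        unfolding N_def mobius_def
        by (intro mobius_continuous z t ballI) (rule mobius_denominator[OF a1 \<zeta>])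
      have 2: "continuous_on UNIV (\<lambda>x::real \<times> real. mobius P (u * N (fst x) (\<zeta> s (snd x))))"
        unfolding mobius_def[of P]
        by (intro mobius_continuous 1 ballI) (rule mobius_denominator[OF P uN[OF \<zeta>]])
      have "(norm q)\<^sup>2 < 1" "(cmod (mobius P (u * N a (\<zeta> s \<theta>))))\<^sup>2 < 1" for a \<theta>
        using q mobius_in_disc[OF P uN[OF \<zeta>], of a s \<theta>] by (simp_all add: abs_square_less_1)
      then have nz: "(1 - (cmod (to_complex q))\<^sup>2) * (1 - (cmod (mobius P (u * N a (\<zeta> s \<theta>))))\<^sup>2) \<noteq> 0" for a \<theta>
        by (metis cmod_to_complex diff_gt_0_iff_gt less_irrefl mult_pos_pos)
      show ?thesis
        unfolding md_hyp_dist[OF q F_in] unfolding F to_of_complex disc_form_def case_prod_unfold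
        by (intro continuous_on_mult continuous_on_divide continuous_on_const continuous_on_power continuous_on_norm
            continuous_on_diff 2 ballI) (rule nz)
    qed
    fix a
    define \<omega> where "\<omega> = mobius (- P) (to_complex q)"
    have \<omega>: "cmod \<omega> < 1" "mobius P \<omega> = to_complex q"
      unfolding \<omega>_def using P q by (auto intro!: mobius_in_disc mobius_inverse)
    \<comment> \<open>All motions are undone, so that polar coordinates about 0 become
      available.\<close>
    define \<eta> where "\<eta> = mobius (- of_real (tanh (a / (2 * k)))) (cnj u * \<omega>)"
    have c1: "cmod (cnj u * \<omega>) < 1" using \<omega> u by (simp add: norm_mult)
    have \<eta>: "cmod \<eta> < 1" "N a \<eta> = cnj u * \<omega>"
      unfolding \<eta>_def N_def using a1 c1 by (auto intro!: mobius_in_disc mobius_inverse)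
    obtain x \<theta> where x: "0 \<le> x" "\<eta> = of_real (tanh x) * cis \<theta>" by (rule disc_polar_coordinates[OF \<eta>(1)])
    have "\<eta> = \<zeta> (2 * k * x) \<theta>" using x k by (simp add: \<zeta>_def)
    moreover have "u * cnj u = 1" using u by (simp add: complex_norm_square[symmetric])
    then have "u * N a \<eta> = \<omega>" by (simp add: \<eta>(2) flip: mult.assoc)
    ultimately have q_eq: "q = F a (2 * k * x) \<theta>" using \<omega>(2) by (simp add: F)
    have "k\<^sup>2 * (cosh (hyp_dist (F a 0 0) q / k) - 1) = k\<^sup>2 * (cosh (2 * k * x / k) - 1)"
      using law[of a 0 0 "2 * k * x" \<theta>] by (simp add: q_eq)
    then have "hyp_dist (F a 0 0) q = 2 * k * x"
      using hyp_md_le_iff[of "hyp_dist (F a 0 0) q" "2 * k * x"] hyp_md_le_iff[of "2 * k * x" "hyp_dist (F a 0 0) q"]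
        x k hyp_dist_nonneg[OF F_in q] by (intro antisym) auto
    then show "\<exists>\<theta>. q = F a (hyp_dist (F a 0 0) q) \<theta>" using q_eq by auto
  qed (use F_in law in auto)
qed

lemma hyp_frame_through:
  assumes p: "p \<in> ball (0::real^2) 1" and q: "q \<in> ball 0 1"
  obtains F u where "frame (ball 0 1) hyp_dist F" "F 0 0 0 = p" "F 0 (hyp_dist p q) 0 = q"
    "\<And>s. F 0 s 0 = of_complex (mobius (to_complex p) (u * of_real (tanh (s / (2 * k)))))" "cmod u = 1"
proof -
  define \<omega> where "\<omega> = mobius (- to_complex p) (to_complex q)"
  have \<omega>: "cmod \<omega> < 1" "mobius (to_complex p) \<omega> = to_complex q"
    unfolding \<omega>_def using p q by (auto intro!: mobius_in_disc mobius_inverse)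
  obtain x \<alpha> where x: "0 \<le> x" "\<omega> = of_real (tanh x) * cis \<alpha>" by (rule disc_polar_coordinates[OF \<omega>(1)])
  define F where "F = (\<lambda>a s \<theta>. of_complex (mobius (to_complex p)
      (cis \<alpha> * mobius (of_real (tanh (a / (2 * k)))) (of_real (tanh (s / (2 * k))) * cis \<theta>))))"
  have fr: "frame (ball 0 1) hyp_dist F" unfolding F_def by (rule hyp_frame[OF p]) simp
  have F0: "F 0 s 0 = of_complex (mobius (to_complex p) (cis \<alpha> * of_real (tanh (s / (2 * k)))))" for s
    by (simp add: F_def)
  have q_eq: "q = F 0 (2 * k * x) 0" using \<omega>(2) x(2) k by (simp add: F0 mult.commute)
  have p_eq: "F 0 0 0 = p" by (simp add: F0)
  have "k\<^sup>2 * (cosh (hyp_dist (F 0 0 0) (F 0 (2 * k * x) 0) / k) - 1) = k\<^sup>2 * (cosh (2 * k * x / k) - 1)"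
    using fr unfolding frame_def by simp
  then have "k\<^sup>2 * (cosh (hyp_dist p q / k) - 1) = k\<^sup>2 * (cosh (2 * k * x / k) - 1)"
    unfolding p_eq q_eq[symmetric] .
  then have "hyp_dist p q = 2 * k * x"
    using hyp_md_le_iff[of "hyp_dist p q" "2 * k * x"] hyp_md_le_iff[of "2 * k * x" "hyp_dist p q"]
      x k hyp_dist_nonneg[OF p q] by (intro antisym) auto
  then show thesis using that[OF fr p_eq _ F0] q_eq by simp
qed

text \<open>The last argument is the conformal factor of the metric polarized to two points: it
  equals the factor on the diagonal and makes \<open>k^2 * disc_form\<close> equal to half of it
  times the squared Euclidean distance.\<close>

lemma hyp_conformal:
  "conformal_model (- 1 / k\<^sup>2) k (\<lambda>x. k * sinh (x / k)) (\<lambda>x. cosh (x / k)) (\<lambda>x. k\<^sup>2 * (cosh (x / k) - 1))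
     (ball (0::real^2) 1) (hyp_metric k) hyp_dist
     (\<lambda>p q. 4 * k\<^sup>2 / ((1 - (norm p)\<^sup>2) * (1 - (norm q)\<^sup>2)))"
proof
  let ?S = "ball (0::real^2) 1"
  show "0 \<le> hyp_dist x y" if "x \<in> ?S" "y \<in> ?S" for x y by (rule hyp_dist_nonneg[OF that])
  show "hyp_dist x y = hyp_dist y x" for x y by (simp add: hyp_dist_def disc_form_def norm_minus_commute mult.commute)
  show "k\<^sup>2 * (cosh (hyp_dist x y / k) - 1) \<le> k\<^sup>2 * (cosh (u / k) - 1) \<longleftrightarrow> hyp_dist x y \<le> u"
    if "x \<in> ?S" "y \<in> ?S" "0 \<le> u" "u \<le> k" for x y u
    using that hyp_dist_nonneg by (intro hyp_md_le_iff) auto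
  show "k\<^sup>2 * (cosh (hyp_dist x y / k) - 1) = 4 * k\<^sup>2 / ((1 - (norm x)\<^sup>2) * (1 - (norm y)\<^sup>2)) * (norm (x - y))\<^sup>2 / 2"
    if "x \<in> ?S" "y \<in> ?S" for x y
    unfolding md_hyp_dist[OF that] by (simp add: disc_form_def)
  have nz: "1 - (norm x)\<^sup>2 > 0" if "x \<in> ?S" for x using that by (simp add: abs_square_less_1)
  show "continuous_on (?S \<times> ?S) (\<lambda>(p, q). 4 * k\<^sup>2 / ((1 - (norm p)\<^sup>2) * (1 - (norm q)\<^sup>2)))"
    unfolding case_prod_unfold using nz by (intro continuous_intros) (force simp: mem_Times_iff)
  show "0 \<le> 4 * k\<^sup>2 / ((1 - (norm x)\<^sup>2) * (1 - (norm x)\<^sup>2))" for x :: "real^2" by simp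
  show "hyp_metric k x v v = 4 * k\<^sup>2 / ((1 - (norm x)\<^sup>2) * (1 - (norm x)\<^sup>2)) * (norm v)\<^sup>2" for x v
    unfolding hyp_metric_def norm_real2 by (simp add: power2_eq_square)
  show "hyp_dist x z \<le> hyp_dist x y + hyp_dist y z" if xyz: "x \<in> ?S" "y \<in> ?S" "z \<in> ?S" for x y z
  proof -
    define s t where "s = hyp_dist y x" and "t = hyp_dist y z"
    obtain F u where F: "frame ?S hyp_dist F" "F 0 0 0 = y"
      by (rule hyp_frame_through[OF xyz(2) xyz(3)])
    obtain \<alpha> where \<alpha>: "x = F 0 s \<alpha>" using F xyz(1) unfolding frame_def s_def by metis
    obtain \<beta> where \<beta>: "z = F 0 t \<beta>" using F xyz(3) unfolding frame_def t_def by metis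
    have st: "0 \<le> s" "0 \<le> t" unfolding s_def t_def using hyp_dist_nonneg xyz by auto
    then have "0 \<le> k * sinh (s / k)" "0 \<le> k * sinh (t / k)" using k by auto
    from md_polar_le[OF this, of "\<alpha> - \<beta>"]
    have "k\<^sup>2 * (cosh (hyp_dist x z / k) - 1) \<le> k\<^sup>2 * (cosh ((s + t) / k) - 1)"
      using F(1) by (simp add: frame_def \<alpha> \<beta>)
    then have "hyp_dist x z \<le> s + t"
      using hyp_md_le_iff[of "hyp_dist x z" "s + t"] hyp_dist_nonneg[OF xyz(1,3)] st by simp
    then show ?thesis by (simp add: s_def t_def hyp_dist_def disc_form_def norm_minus_commute mult.commute)
  qed
  show "\<exists>c. c C1_differentiable_on {0..1} \<and> c ` {0..1} \<subseteq> ?S \<and> c 0 = x \<and> c 1 = y \<and>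
      (\<forall>s\<in>{0..1}. \<forall>t\<in>{0..1}. hyp_dist (c s) (c t) = \<bar>s - t\<bar> * hyp_dist x y)"
    if x: "x \<in> ?S" and y: "y \<in> ?S" for x y
  proof -
    define h where "h = hyp_dist x y"
    obtain F u where F: "frame ?S hyp_dist F" "F 0 0 0 = x" "F 0 h 0 = y"
      "\<And>s. F 0 s 0 = of_complex (mobius (to_complex x) (u * of_real (tanh (s / (2 * k)))))" and u: "cmod u = 1"
      unfolding h_def using hyp_frame_through[OF x y] by blast
    have h: "0 \<le> h" using hyp_dist_nonneg[OF x y] by (simp add: h_def)
    have F_in: "F 0 s 0 \<in> ?S" for s using F(1) by (simp add: frame_def)
    let ?c = "\<lambda>t. F 0 (t * h) 0"
    define P where "P = to_complex x"
    define b where "b = h / (2 * k)"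
    define f where "f t = u * of_real (tanh (t * b))" for t
    have P: "cmod P < 1" using x by (simp add: P_def)
    have f1: "cmod (f t) < 1" for t using cmod_tanh_cis_less[of "t * b" 0] u by (simp add: f_def norm_mult)
    have nz: "1 + cnj P * f t \<noteq> 0" for t by (rule mobius_denominator[OF P f1])
    have c_eq: "?c = (\<lambda>t. of_complex (mobius P (f t)))" by (simp add: F(4) P_def f_def b_def)
    define f' where "f' t = u * of_real (b * (1 - (tanh (t * b))\<^sup>2))" for t
    define m' where "m' z = ((1 + cnj P * z) - (z + P) * cnj P) / ((1 + cnj P * z) * (1 + cnj P * z))" for z
    have "?c C1_differentiable_on {0..1}"
      unfolding C1_differentiable_on_def c_eq
    proof (intro exI conjI ballI)
      fix t :: real
      have "((\<lambda>t. tanh (t * b)) has_real_derivative b * (1 - (tanh (t * b))\<^sup>2)) (at t)"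
        by (auto intro!: derivative_eq_intros)
      then have "((\<lambda>t. complex_of_real (tanh (t * b))) has_vector_derivative of_real (b * (1 - (tanh (t * b))\<^sup>2))) (at t)"
        by (rule has_vector_derivative_of_real)
      then have f_deriv: "(f has_vector_derivative f' t) (at t)"
        unfolding f_def[abs_def] f'_def by (rule has_vector_derivative_mult_right)
      have "(mobius P has_field_derivative m' (f t)) (at (f t))"
        unfolding mobius_def[abs_def] m'_def using nz[of t]
        by (auto intro!: derivative_eq_intros simp: algebra_simps)
      from field_vector_diff_chain_at[OF f_deriv this]
      have "((\<lambda>t. mobius P (f t)) has_vector_derivative f' t * m' (f t)) (at t)" by (simp add: o_def)
      then show "((\<lambda>t. of_complex (mobius P (f t))) has_vector_derivative of_complex (f' t * m' (f t))) (at t)"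
        by (rule bounded_linear.has_vector_derivative[OF bounded_linear_of_complex])
    next
      have cf: "continuous_on {0..1} f" "continuous_on {0..1} f'"
        unfolding f_def f'_def by (intro continuous_intros; simp)+
      have "continuous_on {0..1} (\<lambda>t. f' t * m' (f t))"
        unfolding m'_def using nz by (intro continuous_intros cf) auto
      then show "continuous_on {0..1} (\<lambda>t. of_complex (f' t * m' (f t)))"
        by (rule bounded_linear.continuous_on[OF bounded_linear_of_complex])
    qed
    moreover have "hyp_dist (?c s) (?c t) = \<bar>s - t\<bar> * h" for s t
    proof -
      have b: "0 \<le> \<bar>s - t\<bar> * h" using h by simp
      have "\<bar>s * h - t * h\<bar> = \<bar>s - t\<bar> * h" using h by (simp add: abs_mult flip: left_diff_distrib)
      then have c: "cosh ((s * h - t * h) / k) = cosh (\<bar>s - t\<bar> * h / k)"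
        using cosh_real_abs[of "(s * h - t * h) / k"] k by (simp add: abs_divide)
      have "k\<^sup>2 * (cosh (hyp_dist (?c s) (?c t) / k) - 1) = k\<^sup>2 * (cosh ((s * h - t * h) / k) - 1)"
        using F(1) by (simp add: frame_def)
      then have "k\<^sup>2 * (cosh (hyp_dist (?c s) (?c t) / k) - 1) = k\<^sup>2 * (cosh (\<bar>s - t\<bar> * h / k) - 1)"
        unfolding c .
      then show ?thesis
        using hyp_md_le_iff[of "hyp_dist (?c s) (?c t)" "\<bar>s - t\<bar> * h"]
          hyp_md_le_iff[of "\<bar>s - t\<bar> * h" "hyp_dist (?c s) (?c t)"] b
          hyp_dist_nonneg[OF F_in F_in] by (intro antisym) auto
    qed
    ultimately show ?thesis using F F_in by (intro exI[of _ ?c]) (auto simp: h_def)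
  qed
qed

end

section \<open>The limit\<close>

lemma (in cc_space) buffon_probability_tendsto:
  assumes A: "A \<subseteq> {0<..}"
    and "\<And>L. L \<in> A \<Longrightarrow> complete_geodesic M d (E L)"
    and "\<And>L. L \<in> A \<Longrightarrow> grating M d (E L) L (G L)"
    and "\<And>L. L \<in> A \<Longrightarrow> E L (t\<^sub>0 L) \<in> \<Union>(G L)"
    and near: "\<And>L (m::int) z. L \<in> A \<Longrightarrow> \<bar>z\<bar> \<le> L \<Longrightarrow> \<bar>sn z\<bar> \<le> \<bar>sn (2 * of_int m * L - z)\<bar>"
  shows "((\<lambda>L. buffon_probability M d L (E L) (G L) (t\<^sub>0 L)) \<longlongrightarrow> 2 / pi) (at 0 within A)"
proof (rule Lim_transform_eventually)
  show "(hit_mean \<longlongrightarrow> 2 / pi) (at 0 within A)"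
    by (rule filterlim_mono[OF hit_mean_tendsto order_refl at_le[OF A]])
  show "\<forall>\<^sub>F L in at 0 within A. hit_mean L = buffon_probability M d L (E L) (G L) (t\<^sub>0 L)"
    unfolding eventually_at
  proof (intro exI[of _ "\<rho> / 2"] conjI ballI impI)
    fix L assume L: "L \<in> A" "L \<noteq> 0 \<and> dist L 0 < \<rho> / 2"
    then have "0 < L" "2 * L \<le> \<rho>" using A by (auto simp: dist_real_def)
    then show "hit_mean L = buffon_probability M d L (E L) (G L) (t\<^sub>0 L)"
      using assms L(1) by (intro buffon_probability_eq[symmetric]) auto
  qed (use rho_pos in simp)
qed

section \<open>The line through the origin is the nearest one\<close>

lemma abs_le_abs_even_multiple:
  fixes m :: int and z L :: real
  assumes "\<bar>z\<bar> \<le> L" shows "\<bar>z\<bar> \<le> \<bar>2 * of_int m * L - z\<bar>"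
proof (cases "m = 0")
  case False
  then have "1 \<le> \<bar>real_of_int m\<bar>" by linarith
  then have "1 * (2 * L) \<le> \<bar>real_of_int m\<bar> * (2 * L)" using assms by (intro mult_right_mono) auto
  also have "\<dots> = \<bar>2 * of_int m * L\<bar>" using assms by (simp add: abs_mult)
  finally show ?thesis using assms by linarith
qed simp

text \<open>This is where the admissible spacing on the sphere enters: the lines are
  \<open>pi / n\<close> apart in angle and fit evenly around the equator, so going around it never
  brings a line closer than the one at \<open>m = 0\<close>.\<close>

lemma abs_sin_le_abs_sin_even_multiple:
  fixes m :: int and x :: real and n :: nat
  assumes n: "0 < n" and x: "\<bar>x\<bar> \<le> pi / (2 * real n)"
  shows "\<bar>sin x\<bar> \<le> \<bar>sin (2 * of_int m * (pi / (2 * real n)) - x)\<bar>"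
proof -
  define \<delta> where "\<delta> = pi / real n"
  have \<delta>: "0 < \<delta>" "real n * \<delta> = pi" using n by (simp_all add: \<delta>_def)
  have x2: "\<bar>2 * x\<bar> \<le> \<delta>" using x by (simp add: \<delta>_def)
  \<comment> \<open>Doubling the angle identifies antipodal points, so \<open>m\<close> matters only
    modulo \<open>n\<close>.\<close>
  define j where "j = m mod int n"
  have j: "0 \<le> j" "j < int n" using n by (auto simp: j_def)
  have m: "m = (m div int n) * int n + j" by (simp add: j_def)
  have "2 * of_int m * \<delta> - 2 * x = 2 * of_int j * \<delta> - 2 * x + of_int (m div int n) * (2 * pi)"
    by (subst m) (simp add: algebra_simps flip: \<delta>(2))
  moreover have "cos (of_int (m div int n) * (2 * pi)) = 1" "sin (of_int (m div int n) * (2 * pi)) = 0"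
    using cos_int_2pin[of "m div int n"] sin_int_2pin[of "m div int n"] by (simp_all only: mult.commute)
  ultimately have "cos (2 * of_int m * \<delta> - 2 * x) = cos (2 * of_int j * \<delta> - 2 * x)"
    by (simp only: cos_add mult_1_right mult_zero_right diff_zero)
  also have "\<dots> \<le> cos (2 * x)"
  proof (cases "j = 0")
    case False
    define y where "y = 2 * of_int j * \<delta> - 2 * x"
    have "1 \<le> j" "j \<le> int n - 1" using False j by auto
    then have "1 \<le> real_of_int j" "real_of_int j \<le> real n - 1" by linarith+
    then have "1 * \<delta> \<le> of_int j * \<delta>" "of_int j * \<delta> \<le> (real n - 1) * \<delta>"
      using \<delta>(1) by (intro mult_right_mono; simp)+
    then have "\<delta> \<le> of_int j * \<delta>" "of_int j * \<delta> \<le> pi - \<delta>" using \<delta>(2) by (simp_all add: left_diff_distrib)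
    moreover have "y = 2 * (of_int j * \<delta>) - 2 * x" by (simp add: y_def)
    \<comment> \<open>On the circle of length \<open>2 * pi\<close>, \<open>y\<close> is at least
      \<open>\<delta>\<close> away from 0 on either side, while \<open>2 * x\<close> is within
      \<open>\<delta>\<close> of it.\<close>
    ultimately have y: "\<delta> \<le> y" "y \<le> 2 * pi - \<delta>" using x2 by linarith+
    have le_pi: "\<bar>2 * x\<bar> \<le> pi" using x2 y by linarith
    have "cos y \<le> cos \<bar>2 * x\<bar>"
    proof (cases "y \<le> pi")
      case True
      then show ?thesis using y x2 \<delta> le_pi by (subst cos_mono_le_eq) auto
    next
      case False
      have "cos y = cos (2 * pi - y)" by (simp add: cos_diff)
      also have "\<dots> \<le> cos \<bar>2 * x\<bar>" using False y x2 \<delta> le_pi by (subst cos_mono_le_eq) auto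
      finally show ?thesis .
    qed
    then show ?thesis by (simp add: y_def)
  qed simp
  finally have "cos (2 * (of_int m * \<delta> - x)) \<le> cos (2 * x)" by (simp add: algebra_simps)
  then have "(sin x)\<^sup>2 \<le> (sin (of_int m * \<delta> - x))\<^sup>2"
    unfolding cos_double_sin by simp
  then show ?thesis by (simp add: abs_le_square_iff \<delta>_def)
qed

theorem mainTheorem2:
  fixes M :: "'a set" and d :: "'a \<Rightarrow> 'a \<Rightarrow> real" and S :: model
    and E :: "real \<Rightarrow> real \<Rightarrow> 'a" and G :: "real \<Rightarrow> 'a set set" and t\<^sub>0 :: "real \<Rightarrow> real"
  assumes "Metric_space M d"
    and "valid_model S"
    and "isometric_to_model M d S"
    and "\<And>L. L \<in> admissible S \<Longrightarrow> complete_geodesic M d (E L)"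
    and "\<And>L. L \<in> admissible S \<Longrightarrow> grating M d (E L) L (G L)"
    and "\<And>L. L \<in> admissible S \<Longrightarrow> E L (t\<^sub>0 L) \<in> \<Union>(G L)"
  shows "((\<lambda>L. buffon_probability M d L (E L) (G L) (t\<^sub>0 L)) \<longlongrightarrow> 2 / pi)
           (at 0 within admissible S)"
proof (cases S)
  case Plane
  obtain f where f: "bij_betw f M (UNIV :: (real^2) set)" "\<And>x y. x \<in> M \<Longrightarrow> y \<in> M \<Longrightarrow> dist (f x) (f y) = d x y"
    using assms(3) by (auto simp: Plane isometric_def)
  have "cc_space 0 1 (\<lambda>x. x) (\<lambda>x. 1) (\<lambda>x. x\<^sup>2 / 2) M d"
  proof (rule trig.cc_space_isometric[OF trig_plane assms(1) f])
    show "(dist x y)\<^sup>2 / 2 \<le> u\<^sup>2 / 2 \<longleftrightarrow> dist x y \<le> u" if "0 \<le> u" for x y :: "real^2" and u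
      using that abs_le_square_iff[of "dist x y" u] by simp
  qed (use plane_frame in auto)
  then show ?thesis
    by (rule cc_space.buffon_probability_tendsto)
       (use assms abs_le_abs_even_multiple in \<open>auto simp: Plane\<close>)
next
  case (Sphere r)
  then have r: "0 < r" using assms(2) by simp
  interpret C: conformal_model "1 / r\<^sup>2" r "\<lambda>x. r * sin (x / r)" "\<lambda>x. cos (x / r)" "\<lambda>x. r\<^sup>2 * (1 - cos (x / r))"
     "sphere (0::real^3) r" "\<lambda>p u v. u \<bullet> v" "sphere_dist r" "\<lambda>_ _. 1"
    by (rule sphere_conformal[OF r])
  obtain f where f: "bij_betw f M (sphere (0::real^3) r)"
    "\<And>x y. x \<in> M \<Longrightarrow> y \<in> M \<Longrightarrow> riem_dist (sphere 0 r) (\<lambda>p u v. u \<bullet> v) (f x) (f y) = d x y"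
    using assms(3) by (auto simp: Sphere isometric_def)
  \<comment> \<open>From here on the infimum over curves is replaced by the explicit formula; the
    rest uses the law of cosines only.\<close>
  have f_dist: "sphere_dist r (f x) (f y) = d x y" if "x \<in> M" "y \<in> M" for x y
    using f(2)[OF that] C.riem_dist_eq[of "f x" "f y"] bij_betwE[OF f(1)] that by auto
  have "cc_space (1 / r\<^sup>2) r (\<lambda>x. r * sin (x / r)) (\<lambda>x. cos (x / r)) (\<lambda>x. r\<^sup>2 * (1 - cos (x / r))) M d"
  proof (rule C.cc_space_isometric[OF assms(1) f(1) f_dist C.md_D_le])
    show "\<exists>F. C.frame (sphere 0 r) (sphere_dist r) F \<and> F 0 0 0 = p \<and> F 0 (sphere_dist r p q) 0 = q"
      if "p \<in> sphere 0 r" "q \<in> sphere 0 r" for p q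
      using sphere_frame_through[OF r that] by blast
  qed
  then show ?thesis
  proof (rule cc_space.buffon_probability_tendsto)
    show "admissible S \<subseteq> {0<..}" using r by (auto simp: Sphere)
    fix L z :: real and m :: int
    assume "L \<in> admissible S" and z: "\<bar>z\<bar> \<le> L"
    then obtain n :: nat where n: "1 < n" and L: "L = pi * r / (2 * real n)" by (auto simp: Sphere)
    have "\<bar>z / r\<bar> \<le> pi / (2 * real n)" using z r by (simp add: L divide_le_eq)
    then have "\<bar>sin (z / r)\<bar> \<le> \<bar>sin (2 * of_int m * (pi / (2 * real n)) - z / r)\<bar>"
      using n by (intro abs_sin_le_abs_sin_even_multiple) auto
    also have "2 * of_int m * (pi / (2 * real n)) - z / r = (2 * of_int m * L - z) / r"
      using r by (simp add: L diff_divide_distrib)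
    finally show "\<bar>r * sin (z / r)\<bar> \<le> \<bar>r * sin ((2 * of_int m * L - z) / r)\<bar>"
      using r by (simp add: abs_mult)
  qed (use assms in auto)
next
  case (Hyperbolic k)
  then have k: "0 < k" using assms(2) by simp
  interpret C: conformal_model "- 1 / k\<^sup>2" k "\<lambda>x. k * sinh (x / k)" "\<lambda>x. cosh (x / k)" "\<lambda>x. k\<^sup>2 * (cosh (x / k) - 1)"
     "ball (0::real^2) 1" "hyp_metric k" "hyp_dist k" "\<lambda>p q. 4 * k\<^sup>2 / ((1 - (norm p)\<^sup>2) * (1 - (norm q)\<^sup>2))"
    by (rule hyp_conformal[OF k])
  obtain f where f: "bij_betw f M (ball (0::real^2) 1)"
    "\<And>x y. x \<in> M \<Longrightarrow> y \<in> M \<Longrightarrow> riem_dist (ball 0 1) (hyp_metric k) (f x) (f y) = d x y"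
    using assms(3) by (auto simp: Hyperbolic isometric_def)
  have f_dist: "hyp_dist k (f x) (f y) = d x y" if "x \<in> M" "y \<in> M" for x y
    using f(2)[OF that] C.riem_dist_eq[of "f x" "f y"] bij_betwE[OF f(1)] that by auto
  have "cc_space (- 1 / k\<^sup>2) k (\<lambda>x. k * sinh (x / k)) (\<lambda>x. cosh (x / k)) (\<lambda>x. k\<^sup>2 * (cosh (x / k) - 1)) M d"
  proof (rule C.cc_space_isometric[OF assms(1) f(1) f_dist C.md_D_le])
    show "\<exists>F. C.frame (ball 0 1) (hyp_dist k) F \<and> F 0 0 0 = p \<and> F 0 (hyp_dist k p q) 0 = q"
      if "p \<in> ball 0 1" "q \<in> ball 0 1" for p q
      using hyp_frame_through[OF k that] by blast
  qed
  then show ?thesis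
  proof (rule cc_space.buffon_probability_tendsto)
    show "admissible S \<subseteq> {0<..}" by (auto simp: Hyperbolic)
    fix L z :: real and m :: int
    assume z: "\<bar>z\<bar> \<le> L"
    \<comment> \<open>\<open>sinh\<close> is increasing, so the comparison of lengths as in the
      plane suffices.\<close>
    have "\<bar>z / k\<bar> \<le> \<bar>(2 * of_int m * L - z) / k\<bar>"
      using abs_le_abs_even_multiple[OF z, of m] k by (simp add: abs_divide divide_right_mono)
    then have "\<bar>sinh (z / k)\<bar> \<le> \<bar>sinh ((2 * of_int m * L - z) / k)\<bar>"
      unfolding sinh_real_abs[symmetric] by simp
    then show "\<bar>k * sinh (z / k)\<bar> \<le> \<bar>k * sinh ((2 * of_int m * L - z) / k)\<bar>"
      using k by (simp add: abs_mult)
  qed (use assms in auto)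
qed

end
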